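(* Let $u$ be a weak radial solution of $S_k(D^2u)=g(u)$ in $B_1$. Then $u$ is an integral radial solution of this equation. Conversely, every integral radial solution is a weak radial solution.
   Context: $n$ is a positive integer, $k\in\{1,\dots,n\}$, $B_1$ is the open unit ball of $\mathbb{R}^n$, $c_{n,k}=\binom{n}{k}/n$, $(\cdot,\cdot)$ is the Euclidean inner product, and $g:\mathbb{R}\to\mathbb{R}$ is a positive $C^1$ function. A function is radial if $u(x)=u(r)$, $r=|x|$; $u'$ is its derivative in $r$. A radial function on $B_1$ is identified with its profile on $(0,1)$, and, as a weakly differentiable function, with its locally absolutely continuous representative. $S_k(D^2u)=\sigma_k(\lambda(D^2u))$ is the $k$-th elementary symmetric function of the eigenvalues of the Hessian $D^2u$, and $S_k^{ij}(D^2u)=\frac{\partial}{\partial u_{ij}}S_k(D^2u)$, where $u_i=u_{x_i}$, $u_{ij}=u_{x_ix_j}$. For radial $u$, with $\lambda_1=u''$ and $\lambda_2=u'/r$, one has at $x\neq0$ $$S_k^{ij}(D^2u)=k\,c_{n,k}\left(\lambda_2^{k-1}\delta_{ij}+\frac{k-1}{n-1}\lambda_2^{k-2}(\lambda_1-\lambda_2)\Big(\delta_{ij}-\frac{x_ix_j}{|x|^2}\Big)\right)$$ (the second term is absent when $k=1$). For radial $u$ having only first weak derivatives, $\sum u_i\eta_jS_k^{ij}(D^2u)$ and $\sum u_iu_jS_k^{ij}(D^2u)$ are understood through this formula, in which $u''$ drops out: they denote $k\,c_{n,k}(u'/r)^{k}(x,\nabla\eta)$ and $k\,c_{n,k}(u'/r)^{k-1}(u')^2$,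 respectively. Weak radial solution: a radial weakly differentiable $u\in L^{k+1}(B_1)$ with $\int_{B_1}\sum u_iu_jS_k^{ij}(D^2u)<\infty$, $g(u)\in L^1(B_1)$ and $\int_{B_1}\{\frac1k\sum u_i\eta_jS_k^{ij}(D^2u)+g(u)\eta\}=0$ for all $\eta\in C_c^1(B_1)$. Integral radial solution: an absolutely continuous function $u$ on $(0,1]$ (absolutely continuous on each compact subinterval) such that $r^{n-1}g(u)\in L^1(0,1)$, $\int_0^1r^{n-1}|u|^{k+1}dr<\infty$, $\int_0^1r^{n-k}(u')^{k+1}dr<\infty$ and $$r^{n-k}(u')^k=c_{n,k}^{-1}\int_0^rs^{n-1}g(u)\,ds\quad\text{for a.e. }r\in(0,1).$$ Conditions "$<\infty$" mean that the integrals converge absolutely. *)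

theory Defs
  imports "HOL-Analysis.Analysis"
begin

section \<open>Absolute continuity, test functions, weak differentiability\<close>

definition absolutely_continuous_fun_on :: "real set \<Rightarrow> (real \<Rightarrow> real) \<Rightarrow> bool"
  where
  "absolutely_continuous_fun_on S u \<longleftrightarrow>
    (\<forall>\<epsilon>>0. \<exists>\<delta>>0. \<forall>(m::nat) (a::nat \<Rightarrow> real) (b::nat \<Rightarrow> real).
      (\<forall>i<m. a i \<le> b i \<and> {a i..b i} \<subseteq> S) \<longrightarrow>
      (\<forall>i<m. \<forall>j<m. i \<noteq> j \<longrightarrow> {a i<..<b i} \<inter> {a j<..<b j} = {}) \<longrightarrow>
      (\<Sum>i<m. b i - a i) < \<delta> \<longrightarrow>
      (\<Sum>i<m. \<bar>u (b i) - u (a i)\<bar>) < \<epsilon>)"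

definition locally_absolutely_continuous_on :: "real set \<Rightarrow> (real \<Rightarrow> real) \<Rightarrow> bool"
  where
  "locally_absolutely_continuous_on I u \<longleftrightarrow>
    (\<forall>a b. a \<le> b \<longrightarrow> {a..b} \<subseteq> I \<longrightarrow> absolutely_continuous_fun_on {a..b} u)"

text \<open>Meaningful only where the gradient exists; it is unique there.\<close>
definition grad :: "('a::real_inner \<Rightarrow> real) \<Rightarrow> 'a \<Rightarrow> 'a"
  where "grad f x = (THE D. GDERIV f x :> D)"

text \<open>The space of continuously differentiable functions with compact support in
  \<open>\<Omega>\<close>, each extended by zero to the whole space.\<close>
definition Cc1 :: "'a::euclidean_space set \<Rightarrow> ('a \<Rightarrow> real) set"
  where
  "Cc1 \<Omega> = {\<eta>. (\<forall>x. \<exists>D. GDERIV \<eta> x :> D) \<and> continuous_on UNIV (grad \<eta>) \<and>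
      (\<exists>K. compact K \<and> K \<subseteq> \<Omega> \<and> (\<forall>x. x \<notin> K \<longrightarrow> \<eta> x = 0))}"

definition locally_integrable_on ::
  "'a::euclidean_space set \<Rightarrow> ('a \<Rightarrow> 'b::{banach, second_countable_topology}) \<Rightarrow> bool"
  where
  "locally_integrable_on \<Omega> f \<longleftrightarrow>
    (\<forall>K. compact K \<longrightarrow> K \<subseteq> \<Omega> \<longrightarrow> set_integrable lebesgue K f)"

definition weak_gradient_on ::
  "'a::euclidean_space set \<Rightarrow> ('a \<Rightarrow> real) \<Rightarrow> ('a \<Rightarrow> 'a) \<Rightarrow> bool"
  where
  "weak_gradient_on \<Omega> U F \<longleftrightarrow>
    locally_integrable_on \<Omega> U \<and> locally_integrable_on \<Omega> F \<and>
    (\<forall>\<eta>\<in>Cc1 \<Omega>. (LINT x:\<Omega>|lebesgue. U x *\<^sub>R grad \<eta> x) = - (LINT x:\<Omega>|lebesgue. \<eta> x *\<^sub>R F x))"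

definition weakly_differentiable_on :: "'a::euclidean_space set \<Rightarrow> ('a \<Rightarrow> real) \<Rightarrow> bool"
  where "weakly_differentiable_on \<Omega> U \<longleftrightarrow> (\<exists>F. weak_gradient_on \<Omega> U F)"


section \<open>The radial Hessian operator\<close>

definition c_const :: "nat \<Rightarrow> nat \<Rightarrow> real"
  where "c_const n k = real (n choose k) / real n"

text \<open>The coefficients \<open>S\<^sub>k\<^sup>i\<^sup>j(D\<^sup>2u)\<close> of a radial function at \<open>x \<noteq> 0\<close>, where
  \<open>l1\<close> stands for \<open>u''\<close> and \<open>l2\<close> for \<open>u'/r\<close>.\<close>
definition Sk_coeff :: "nat \<Rightarrow> real \<Rightarrow> real \<Rightarrow> real ^ 'n \<Rightarrow> 'n \<Rightarrow> 'n \<Rightarrow> real"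
  where
  "Sk_coeff k l1 l2 x i j =
    real k * c_const CARD('n) k *
      (l2 ^ (k - 1) * (if i = j then 1 else 0) +
       (if k = 1 then 0
        else (real k - 1) / (real CARD('n) - 1) * l2 ^ (k - 2) * (l1 - l2) *
             ((if i = j then 1 else 0) - x $ i * x $ j / (norm x)\<^sup>2)))"

text \<open>Reading of \<open>\<Sum> u\<^sub>i \<eta>\<^sub>j S\<^sub>k\<^sup>i\<^sup>j(D\<^sup>2u)\<close> and \<open>\<Sum> u\<^sub>i u\<^sub>j S\<^sub>k\<^sup>i\<^sup>j(D\<^sup>2u)\<close> at the point \<open>x\<close> for a radial
  function with profile \<open>u\<close> having only first derivatives: \<open>u''\<close> cancels in both sums, see the
  two lemmas below. The argument \<open>v\<close> is \<open>\<nabla>\<eta>(x)\<close>.\<close>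
definition Sk_flux :: "nat \<Rightarrow> (real \<Rightarrow> real) \<Rightarrow> real ^ 'n \<Rightarrow> real ^ 'n \<Rightarrow> real"
  where
  "Sk_flux k u x v =
    real k * c_const CARD('n) k * (deriv u (norm x) / norm x) ^ k * (x \<bullet> v)"

definition Sk_energy :: "nat \<Rightarrow> (real \<Rightarrow> real) \<Rightarrow> real ^ 'n \<Rightarrow> real"
  where
  "Sk_energy k u x =
    real k * c_const CARD('n) k * (deriv u (norm x) / norm x) ^ (k - 1) * (deriv u (norm x))\<^sup>2"

lemma Sk_coeff_contract:
  fixes x v :: "real ^ 'n"
  assumes "x \<noteq> 0"
  shows "(\<Sum>i\<in>UNIV. \<Sum>j\<in>UNIV. x $ i * v $ j * Sk_coeff k l1 l2 x i j) =
    real k * c_const CARD('n) k * l2 ^ (k - 1) * (x \<bullet> v)"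
proof -
  define A where "A = real k * c_const CARD('n) k * l2 ^ (k - 1)"
  define B where "B = real k * c_const CARD('n) k * (if k = 1 then 0 else
    (real k - 1) / (real CARD('n) - 1) * l2 ^ (k - 2) * (l1 - l2))"
  have xx: "(\<Sum>i\<in>UNIV. x $ i * x $ i) = (norm x)\<^sup>2"
    by (simp add: power2_norm_eq_inner inner_vec_def)
  have S: "Sk_coeff k l1 l2 x i j =
      (A + B) * (if i = j then 1 else 0) - B / (norm x)\<^sup>2 * (x $ i * x $ j)" for i j
  proof -
    have ring: "K * (a * d + b * (d - y / N)) = (K * a + K * b) * d - K * b / N * y"
      for K a b d y N :: real
      by (simp add: algebra_simps)
    show ?thesis
    proof (cases "k = 1")
      case True
      then show ?thesis by (simp add: Sk_coeff_def A_def B_def)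
    next
      case False
      then show ?thesis
        unfolding Sk_coeff_def A_def B_def by (simp only: if_False ring)
    qed
  qed
  have row: "(\<Sum>j\<in>UNIV. x $ i * v $ j * Sk_coeff k l1 l2 x i j) =
      (A + B) * (x $ i * v $ i) - B / (norm x)\<^sup>2 * (x \<bullet> v) * (x $ i * x $ i)" for i
  proof -
    have "(\<Sum>j\<in>UNIV. x $ i * v $ j * Sk_coeff k l1 l2 x i j) =
        (\<Sum>j\<in>UNIV. (if i = j then (A + B) * (x $ i * v $ j) else 0) -
          B / (norm x)\<^sup>2 * (x $ i * x $ i) * (x $ j * v $ j))"
      unfolding S by (rule sum.cong) (auto simp: algebra_simps)
    also have "\<dots> = (A + B) * (x $ i * v $ i) -
        B / (norm x)\<^sup>2 * (x $ i * x $ i) * (\<Sum>j\<in>UNIV. x $ j * v $ j)"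
      by (simp add: sum_subtractf sum_distrib_left)
    finally show ?thesis
      by (simp add: inner_vec_def mult.commute mult.left_commute)
  qed
  have "(\<Sum>i\<in>UNIV. \<Sum>j\<in>UNIV. x $ i * v $ j * Sk_coeff k l1 l2 x i j) =
      (A + B) * (\<Sum>i\<in>UNIV. x $ i * v $ i) -
      B / (norm x)\<^sup>2 * (x \<bullet> v) * (\<Sum>i\<in>UNIV. x $ i * x $ i)"
    unfolding row by (simp only: sum_subtractf sum_distrib_left)
  also have "\<dots> = A * (x \<bullet> v)"
    using assms unfolding xx by (simp add: inner_vec_def algebra_simps)
  finally show ?thesis by (simp add: A_def)
qed

lemma Sk_flux_eq_sum:
  fixes x v :: "real ^ 'n"
  assumes "x \<noteq> 0" and "k \<ge> 1"
  shows "Sk_flux k u x v =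
    (\<Sum>i\<in>UNIV. \<Sum>j\<in>UNIV. (deriv u (norm x) * x $ i / norm x) * v $ j *
      Sk_coeff k l1 (deriv u (norm x) / norm x) x i j)"
proof -
  define l where "l = deriv u (norm x) / norm x"
  have "(\<Sum>i\<in>UNIV. \<Sum>j\<in>UNIV. (deriv u (norm x) * x $ i / norm x) * v $ j *
      Sk_coeff k l1 l x i j) =
      l * (\<Sum>i\<in>UNIV. \<Sum>j\<in>UNIV. x $ i * v $ j * Sk_coeff k l1 l x i j)"
    by (simp add: l_def sum_distrib_left mult.assoc)
  also have "\<dots> = real k * c_const CARD('n) k * (l * l ^ (k - 1)) * (x \<bullet> v)"
    unfolding Sk_coeff_contract[OF assms(1)] by simp
  also have "l * l ^ (k - 1) = l ^ k"
    using assms(2) by (cases k) auto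
  finally show ?thesis by (simp add: Sk_flux_def l_def)
qed

lemma Sk_energy_eq_sum:
  fixes x :: "real ^ 'n"
  assumes "x \<noteq> 0" and "k \<ge> 1"
  shows "Sk_energy k u x =
    (\<Sum>i\<in>UNIV. \<Sum>j\<in>UNIV. (deriv u (norm x) * x $ i / norm x) * (deriv u (norm x) * x $ j / norm x) *
      Sk_coeff k l1 (deriv u (norm x) / norm x) x i j)"
proof -
  define l where "l = deriv u (norm x) / norm x"
  have d: "deriv u (norm x) = l * norm x"
    using assms(1) by (simp add: l_def)
  have "Sk_energy k u x = Sk_flux k u x (l *\<^sub>R x)"
    using assms unfolding Sk_energy_def Sk_flux_def
    by (cases k) (simp_all add: d power2_eq_square dot_square_norm algebra_simps)
  also have "\<dots> = (\<Sum>i\<in>UNIV. \<Sum>j\<in>UNIV. (deriv u (norm x) * x $ i / norm x) * (l *\<^sub>R x) $ j *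
      Sk_coeff k l1 (deriv u (norm x) / norm x) x i j)"
    by (rule Sk_flux_eq_sum[OF assms])
  finally show ?thesis by (simp add: l_def)
qed


section \<open>Weak and integral radial solutions in the unit ball\<close>

text \<open>Radial functions on the ball are determined up to null sets; \<open>u\<close> is the locally absolutely
  continuous representative of the profile of \<open>U\<close>.\<close>
definition radial_profile :: "('a::euclidean_space \<Rightarrow> real) \<Rightarrow> (real \<Rightarrow> real) \<Rightarrow> bool"
  where
  "radial_profile U u \<longleftrightarrow>
    locally_absolutely_continuous_on {0<..<1} u \<and>
    (AE x in lebesgue. x \<in> ball 0 1 \<longrightarrow> U x = u (norm x))"

text \<open>The profile \<open>u\<close> is determined by \<open>U\<close> on \<open>{0<..<1}\<close>, and its derivative exists almost
  everywhere there. The integral of the weak equation converges absolutely: \<open>g \<circ> U\<close> is integrable,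
  and the flux term is controlled through the energy by Hoelder's inequality (using \<open>k \<le> n\<close>).
  For even \<open>k\<close> the energy density may change sign; its integrability means absolute convergence.\<close>
definition weak_radial_solution :: "nat \<Rightarrow> (real \<Rightarrow> real) \<Rightarrow> (real ^ 'n \<Rightarrow> real) \<Rightarrow> bool"
  where
  "weak_radial_solution k g U \<longleftrightarrow>
    weakly_differentiable_on (ball 0 1) U \<and>
    set_integrable lebesgue (ball 0 1) (\<lambda>x. \<bar>U x\<bar> ^ (k + 1)) \<and>
    set_integrable lebesgue (ball 0 1) (\<lambda>x. g (U x)) \<and>
    (\<exists>u. radial_profile U u \<and>
      set_integrable lebesgue (ball 0 1) (\<lambda>x::real ^ 'n. Sk_energy k u x) \<and>
      (\<forall>\<eta>\<in>Cc1 (ball 0 1).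
        (LINT x:ball 0 1|lebesgue. 1 / real k * Sk_flux k u x (grad \<eta> x) + g (U x) * \<eta> x) = 0))"

definition integral_radial_solution :: "nat \<Rightarrow> nat \<Rightarrow> (real \<Rightarrow> real) \<Rightarrow> (real \<Rightarrow> real) \<Rightarrow> bool"
  where
  "integral_radial_solution n k g u \<longleftrightarrow>
    locally_absolutely_continuous_on {0<..1} u \<and>
    set_integrable lebesgue {0<..<1} (\<lambda>r. r ^ (n - 1) * g (u r)) \<and>
    set_integrable lebesgue {0<..<1} (\<lambda>r. r ^ (n - 1) * \<bar>u r\<bar> ^ (k + 1)) \<and>
    set_integrable lebesgue {0<..<1} (\<lambda>r. r ^ (n - k) * deriv u r ^ (k + 1)) \<and>
    (AE r in lebesgue. r \<in> {0<..<1} \<longrightarrow>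
      r ^ (n - k) * deriv u r ^ k =
        inverse (c_const n k) * (LINT s:{0<..<r}|lebesgue. s ^ (n - 1) * g (u s)))"

end

theory Submission
  imports Defs
begin

text \<open>
  Both notions of solution say that the flux \<open>w(r) = c\<^sub>n\<^sub>,\<^sub>k r\<^sup>n\<^sup>-\<^sup>k (u')\<^sup>k\<close> equals the mass
  \<open>G(r)\<close>, the integral of \<open>f(s) = s\<^sup>n\<^sup>-\<^sup>1 g(u(s))\<close> over \<open>(0, r)\<close>; the weak equation says it in
  divergence form on the ball, the integral equation says it radius by radius.

  From weak to integral: for a radial test function \<open>\<eta>(x) = \<phi>(|x|)\<close> polar coordinates turn the weak
  equation into \<open>\<integral> w \<phi>' + f \<phi> = 0\<close> on \<open>(0, 1)\<close>. The profile \<open>\<phi>\<close> has to vanish near \<open>1\<close> and to be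
  constant near \<open>0\<close>, but it need not vanish at \<open>0\<close>. So \<open>\<psi> = -\<phi>'\<close> runs through all continuous functions
  with compact support in \<open>(0, 1)\<close>, without a condition on the mean, and integrating \<open>f \<phi>\<close> by parts gives
  \<open>\<integral> (w - G) \<psi> = 0\<close>. Hence \<open>w = G\<close> almost everywhere, with no constant of integration
  (\<open>weak_primitive_AE_eq\<close>). As \<open>G\<close> is bounded, \<open>u'\<close> is bounded away from the origin, so that \<open>u\<close> is
  Lipschitz near \<open>r = 1\<close> and extends to an absolutely continuous function up to \<open>1\<close>.

  From integral to weak: the integral equation again makes \<open>u\<close> Lipschitz away from the origin. Away
  from the origin two integrations by parts are legitimate: one for \<open>u(|x|)\<close>, which yields the weak
  gradient \<open>u'(|x|) x/|x|\<close>, and one for the vector field \<open>G(|x|) |x|\<^sup>-\<^sup>n x\<close>, whose divergence is \<open>g(u)\<close>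
  and which is the flux of the equation. To remove the origin both radial factors are frozen for
  \<open>|x| \<le> \<epsilon>\<close>. When \<open>\<epsilon> \<rightarrow> 0\<close> the first integral converges by the growth bound \<open>|u(r)| \<le> C r\<^sup>1\<^sup>-\<^sup>n\<close>; the
  second one leaves an error of the size of \<open>G(\<epsilon>)\<close>, which tends to \<open>0\<close>
  (\<open>radial_weak_gradient\<close>, \<open>primitive_flux_divergence\<close>).

  Three general tools carry this: the fundamental theorem of calculus for absolutely continuous
  functions (\<open>absolutely_continuous_FTC\<close>), which is where \<open>u'\<close> is shown to exist almost everywhere and
  to control \<open>u\<close>; polar coordinates for radial integrands (\<open>radial_integral\<close>); and integration by parts
  of a Lipschitz radial function against a test function (\<open>radial_integration_by_parts\<close>). For even \<open>k\<close>
  the sign of \<open>u'\<close> is not determined by the equation, which is why only Lipschitz bounds and never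
  continuity of \<open>u'\<close> are used.
\<close>

section \<open>The variation of an absolutely continuous function\<close>

text \<open>Only the interiors are disjoint, so families survive clipping, which may collapse many members to
  the same point; an index set keeps these collapsed members apart.\<close>
definition nonoverlapping :: "'i set \<Rightarrow> ('i \<Rightarrow> real) \<Rightarrow> ('i \<Rightarrow> real) \<Rightarrow> bool" where
  "nonoverlapping I a b \<longleftrightarrow> finite I \<and> (\<forall>i\<in>I. a i \<le> b i) \<and>
    (\<forall>i\<in>I. \<forall>j\<in>I. i \<noteq> j \<longrightarrow> {a i<..<b i} \<inter> {a j<..<b j} = {})"

definition clip :: "real \<Rightarrow> real \<Rightarrow> real \<Rightarrow> real" where
  "clip c d x = max c (min d x)"

lemma clip_bounds: "c \<le> d \<Longrightarrow> c \<le> clip c d x" "c \<le> d \<Longrightarrow> clip c d x \<le> d"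
  by (auto simp: clip_def)

lemma clip_eq: "c \<le> x \<Longrightarrow> x \<le> d \<Longrightarrow> clip c d x = x"
  by (auto simp: clip_def)

lemma clip_mono: "x \<le> y \<Longrightarrow> clip c d x \<le> clip c d y"
  by (auto simp: clip_def)

lemma clip_contract: "\<bar>clip c d x - clip c d y\<bar> \<le> \<bar>x - y\<bar>"
  by (auto simp: clip_def max_def min_def)

lemma open_interval_clip: "{clip c d x<..<clip c d y} \<subseteq> {x<..<y} \<inter> {c<..<d}"
  by (auto simp: clip_def max_def min_def split: if_splits)

lemma nonoverlapping_clip:
  assumes "nonoverlapping I a b"
  shows "nonoverlapping I (\<lambda>i. clip c d (a i)) (\<lambda>i. clip c d (b i))"
proof -
  have "{clip c d (a i)<..<clip c d (b i)} \<inter> {clip c d (a j)<..<clip c d (b j)} = {}"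
    if "i \<in> I" "j \<in> I" "i \<noteq> j" for i j
    using assms that open_interval_clip[of c d "a i" "b i"] open_interval_clip[of c d "a j" "b j"]
    unfolding nonoverlapping_def by blast
  then show ?thesis
    using assms unfolding nonoverlapping_def by (simp add: clip_mono)
qed

text \<open>The open intervals are disjoint, so their total length is the measure of their union.\<close>
lemma nonoverlapping_length_le_measure:
  assumes I: "nonoverlapping I a b" and T: "T \<in> lmeasurable"
    and sub: "\<And>i. i \<in> I \<Longrightarrow> {a i<..<b i} \<subseteq> T"
  shows "(\<Sum>i\<in>I. b i - a i) \<le> measure lebesgue T"
proof -
  have fin: "finite I" and le: "\<And>i. i \<in> I \<Longrightarrow> a i \<le> b i"
    using I by (auto simp: nonoverlapping_def)
  have "(\<Sum>i\<in>I. b i - a i) = (\<Sum>i\<in>I. measure lebesgue {a i<..<b i})"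
    using le by (intro sum.cong) auto
  also have "\<dots> = measure lebesgue (\<Union>i\<in>I. {a i<..<b i})"
    using I fin by (intro measure_UNION'[symmetric])
      (auto simp: nonoverlapping_def pairwise_def disjnt_def)
  also have "\<dots> \<le> measure lebesgue T"
    using sub T by (intro measure_mono_fmeasurable) (auto intro!: sets.finite_UN fin)
  finally show ?thesis .
qed

lemma nonoverlapping_length_le:
  assumes "nonoverlapping I a b" and "c \<le> d" and "\<And>i. i \<in> I \<Longrightarrow> c \<le> a i \<and> b i \<le> d"
  shows "(\<Sum>i\<in>I. b i - a i) \<le> d - c"
proof -
  have "(\<Sum>i\<in>I. b i - a i) \<le> measure lebesgue {c..d}"
    using assms(3) by (intro nonoverlapping_length_le_measure[OF assms(1)])
      (auto dest!: assms(3) intro: order.trans less_imp_le)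
  then show ?thesis using assms by simp
qed

text \<open>The threshold \<open>\<delta>\<close> is a parameter so that thresholds of several functions can be compared.\<close>
definition ac_modulus :: "real set \<Rightarrow> (real \<Rightarrow> real) \<Rightarrow> real \<Rightarrow> real \<Rightarrow> bool" where
  "ac_modulus S u \<epsilon> \<delta> \<longleftrightarrow> 0 < \<delta> \<and> (\<forall>(m::nat) a b. nonoverlapping {..<m} a b \<longrightarrow>
    (\<forall>i<m. {a i..b i} \<subseteq> S) \<longrightarrow> (\<Sum>i<m. b i - a i) < \<delta> \<longrightarrow> (\<Sum>i<m. \<bar>u (b i) - u (a i)\<bar>) < \<epsilon>)"

lemma absolutely_continuous_fun_on_iff:
  "absolutely_continuous_fun_on S u \<longleftrightarrow> (\<forall>\<epsilon>>0. \<exists>\<delta>. ac_modulus S u \<epsilon> \<delta>)"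
proof -
  have eq: "(nonoverlapping {..<m} a b \<longrightarrow> (\<forall>i<m. {a i..b i} \<subseteq> S) \<longrightarrow> Q) \<longleftrightarrow>
      ((\<forall>i<m. a i \<le> b i \<and> {a i..b i} \<subseteq> S) \<longrightarrow>
       (\<forall>i<m. \<forall>j<m. i \<noteq> j \<longrightarrow> {a i<..<b i} \<inter> {a j<..<b j} = {}) \<longrightarrow> Q)" for m :: nat and a b Q
  proof -
    have "(\<forall>i<m. a i \<le> b i \<and> {a i..b i} \<subseteq> S) \<longleftrightarrow> (\<forall>i<m. a i \<le> b i) \<and> (\<forall>i<m. {a i..b i} \<subseteq> S)"
      by blast
    then show ?thesis
      unfolding nonoverlapping_def Ball_def lessThan_iff by (simp only: finite_lessThan simp_thms) argo
  qed
  show ?thesis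
    unfolding absolutely_continuous_fun_on_def ac_modulus_def eq ..
qed

text \<open>Absolute continuity for families over an arbitrary index type. The variation estimates below
  combine several families into one that is indexed by pairs, and coverings are indexed by the
  covering sets.\<close>
lemma absolutely_continuous_fun_on_family:
  fixes u :: "real \<Rightarrow> real"
  assumes "absolutely_continuous_fun_on S u" and "\<epsilon> > 0"
  obtains \<delta> where "\<delta> > 0"
    "\<And>(I :: 'i set) a b. \<lbrakk>nonoverlapping I a b; \<And>i. i \<in> I \<Longrightarrow> {a i..b i} \<subseteq> S;
       (\<Sum>i\<in>I. b i - a i) < \<delta>\<rbrakk> \<Longrightarrow> (\<Sum>i\<in>I. \<bar>u (b i) - u (a i)\<bar>) < \<epsilon>"
proof -
  obtain \<delta> where "ac_modulus S u \<epsilon> \<delta>"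
    using assms unfolding absolutely_continuous_fun_on_iff by blast
  then have "\<delta> > 0" and \<delta>: "\<And>(m::nat) a b. nonoverlapping {..<m} a b \<Longrightarrow> \<forall>i<m. {a i..b i} \<subseteq> S \<Longrightarrow>
      (\<Sum>i<m. b i - a i) < \<delta> \<Longrightarrow> (\<Sum>i<m. \<bar>u (b i) - u (a i)\<bar>) < \<epsilon>"
    unfolding ac_modulus_def by blast+
  show ?thesis
  proof (rule that[OF \<open>\<delta> > 0\<close>])
    fix I :: "'i set" and a b
    assume I: "nonoverlapping I a b" and sub: "\<And>i. i \<in> I \<Longrightarrow> {a i..b i} \<subseteq> S"
      and len: "(\<Sum>i\<in>I. b i - a i) < \<delta>"
    have "finite I" using I by (simp add: nonoverlapping_def)
    then obtain h where h: "bij_betw h {..<card I} I"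
      by (metis bij_betw_from_nat_into_finite)
    have hI: "h i \<in> I" if "i < card I" for i
      using bij_betwE[OF h] that by blast
    have inj: "h i \<noteq> h j" if "i < card I" "j < card I" "i \<noteq> j" for i j
      using h that unfolding bij_betw_def inj_on_def by blast
    have "(\<Sum>i<card I. \<bar>u (b (h i)) - u (a (h i))\<bar>) < \<epsilon>"
    proof (rule \<delta>)
      show "(\<Sum>i<card I. b (h i) - a (h i)) < \<delta>"
        using len sum.reindex_bij_betw[OF h, of "\<lambda>i. b i - a i"] by simp
      show "\<forall>i<card I. {a (h i)..b (h i)} \<subseteq> S" using hI sub by blast
      show "nonoverlapping {..<card I} (\<lambda>i. a (h i)) (\<lambda>i. b (h i))"
        unfolding nonoverlapping_def
      proof (intro conjI ballI impI)
        fix i j assume ij: "i \<in> {..<card I}" "j \<in> {..<card I}" "i \<noteq> j"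
        then show "{a (h i)<..<b (h i)} \<inter> {a (h j)<..<b (h j)} = {}"
          using I hI[of i] hI[of j] inj[of i j] unfolding nonoverlapping_def lessThan_iff by blast
      qed (use I hI in \<open>auto simp: nonoverlapping_def\<close>)
    qed
    then show "(\<Sum>i\<in>I. \<bar>u (b i) - u (a i)\<bar>) < \<epsilon>"
      using sum.reindex_bij_betw[OF h, of "\<lambda>i. \<bar>u (b i) - u (a i)\<bar>"] by simp
  qed
qed

text \<open>If \<open>c\<close> separates \<open>p\<close> from \<open>q\<close> this is the triangle inequality through \<open>u(c)\<close>; otherwise one of
  the two terms on the right vanishes and the other one is the left-hand side.\<close>
lemma clip_oscillation_split:
  fixes u :: "real \<Rightarrow> real"
  assumes "p \<le> q" "c \<le> d"
  shows "\<bar>u (min d q) - u (min d p)\<bar> \<le>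
    \<bar>u (min c q) - u (min c p)\<bar> + \<bar>u (clip c d q) - u (clip c d p)\<bar>"
proof -
  consider "q \<le> c" | "c \<le> p" | "p < c" "c < q" by linarith
  then show ?thesis
  proof cases
    case 1
    then have "min d q = q" "min d p = p" "min c q = q" "min c p = p" using assms by auto
    then show ?thesis by simp
  next
    case 2 then show ?thesis using assms by (simp add: clip_def min_def max_def)
  next
    case 3
    then have "min d p = p" "min c q = c" "min c p = p" "clip c d q = min d q" "clip c d p = c"
      using assms by (auto simp: clip_def)
    then show ?thesis by simp
  qed
qed

text \<open>The majorant is the total variation: the supremum of the variation sums of \<open>u\<close> over finite
  families cut off at \<open>x\<close>. Cutting families off with \<open>min\<close> instead of restricting the
  families to \<open>(-\<infinity>, x]\<close> lets the same family be evaluated at every \<open>x\<close>. The function has to be constant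
  on the left because otherwise the supremum may be infinite.\<close>
lemma absolutely_continuous_variation:
  fixes u :: "real \<Rightarrow> real"
  assumes ac: "absolutely_continuous_fun_on UNIV u" and const: "\<And>x. x \<le> l \<Longrightarrow> u x = u l"
  obtains V where "absolutely_continuous_fun_on UNIV V"
    "\<And>x y. x \<le> y \<Longrightarrow> \<bar>u y - u x\<bar> \<le> V y - V x"
proof -
  define \<F> where "\<F> = {(I :: nat set, a, b). nonoverlapping I a b}"
  define T where "T = (\<lambda>(I :: nat set, a, b) x. \<Sum>i\<in>I. \<bar>u (min x (b i)) - u (min x (a i))\<bar>)"
  have T: "T (I, a, b) x = (\<Sum>i\<in>I. \<bar>u (min x (b i)) - u (min x (a i))\<bar>)" for I a b x
    by (simp add: T_def)
  have ne: "\<F> \<noteq> {}"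
    by (auto simp: \<F>_def nonoverlapping_def intro!: exI[of _ "{}"])
  have incr: "T (I, a, b) d \<le> T (I, a, b) c + (\<Sum>i\<in>I. \<bar>u (clip c d (b i)) - u (clip c d (a i))\<bar>)"
    if "nonoverlapping I a b" "c \<le> d" for I a b c d
    unfolding T sum.distrib[symmetric] using that
    by (intro sum_mono clip_oscillation_split) (auto simp: nonoverlapping_def)
  have len: "(\<Sum>i\<in>I. clip c d (b i) - clip c d (a i)) \<le> d - c"
    if "nonoverlapping I a b" "c \<le> d" for I :: "nat set" and a b c d
    using that by (intro nonoverlapping_length_le nonoverlapping_clip) (auto simp: clip_bounds)
  have bdd: "bdd_above ((\<lambda>F. T F x) ` \<F>)" for x
  proof -
    obtain \<delta> where \<delta>: "\<delta> > 0" and ac1: "\<And>(I :: nat set) a b. \<lbrakk>nonoverlapping I a b;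
      \<And>i. i \<in> I \<Longrightarrow> {a i..b i} \<subseteq> UNIV;
      (\<Sum>i\<in>I. b i - a i) < \<delta>\<rbrakk> \<Longrightarrow> (\<Sum>i\<in>I. \<bar>u (b i) - u (a i)\<bar>) < 1"
      using absolutely_continuous_fun_on_family[OF ac zero_less_one, where 'i = nat] by blast
    \<comment> \<open>A variation sum grows by at most 1 over each of finitely many short steps, uniformly in the family.\<close>
    have step: "T F d \<le> T F c + 1" if F\<F>: "F \<in> \<F>" and cd: "c \<le> d" "d - c < \<delta>" for F c d
    proof -
      obtain I a b where F: "F = (I, a, b)" and I: "nonoverlapping I a b"
        using F\<F> by (auto simp: \<F>_def)
      have "(\<Sum>i\<in>I. \<bar>u (clip c d (b i)) - u (clip c d (a i))\<bar>) < 1"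
        using len[OF I cd(1)] cd(2) by (intro ac1 nonoverlapping_clip I) auto
      then show ?thesis using incr[OF I cd(1)] F by simp
    qed
    have const': "u (min y z) = u l" if "y \<le> l" for y z
      using const[of "min y z"] that by auto
    have zero: "T F y = 0" if "F \<in> \<F>" "y \<le> l" for F y
      using that(1) const'[OF that(2)] by (auto simp: \<F>_def T)
    show ?thesis
    proof (cases "x \<le> l")
      case True
      then show ?thesis using zero by (auto intro!: bdd_aboveI[of _ 0])
    next
      case False
      obtain N :: nat where N: "(x - l) / \<delta> < real N" using reals_Archimedean2 by blast
      have "0 < (x - l) / \<delta>" using False \<delta> by simp
      then have N0: "N > 0" using N by (cases N) auto
      define w where "w = (x - l) / N"
      have h: "w < \<delta>" "0 \<le> w" and Nw: "l + real N * w = x"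
        using N N0 \<delta> False by (auto simp: w_def field_simps)
      have "T F x \<le> N" if F: "F \<in> \<F>" for F
      proof -
        have "T F (l + real m * w) \<le> real m" for m
        proof (induction m)
          case 0 then show ?case using zero[OF F, of l] by simp
        next
          case (Suc m)
          have "T F (l + real (Suc m) * w) \<le> T F (l + real m * w) + 1"
            using h by (intro step F) (auto simp: algebra_simps)
          then show ?case using Suc by simp
        qed
        from this[of N] show ?thesis using Nw by simp
      qed
      then show ?thesis by (auto intro!: bdd_aboveI[of _ "real N"])
    qed
  qed
  define V where "V x = (SUP F\<in>\<F>. T F x)" for x
  have dom: "\<bar>u y - u x\<bar> \<le> V y - V x" if "x \<le> y" for x y
  proof -
    have "T F x \<le> V y - \<bar>u y - u x\<bar>" if F\<F>: "F \<in> \<F>" for F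
    proof -
      obtain I a b where F: "F = (I, a, b)" and I: "nonoverlapping I a b"
        using F\<F> by (auto simp: \<F>_def)
      have fin: "finite I" using I by (simp add: nonoverlapping_def)
      then obtain i0 where i0: "i0 \<notin> I" using ex_new_if_finite by blast
      \<comment> \<open>Cut the family off at x and add the interval from x to y under a fresh index.\<close>
      define a' where "a' = (\<lambda>i. if i = i0 then x else min x (a i))"
      define b' where "b' = (\<lambda>i. if i = i0 then y else min x (b i))"
      have "nonoverlapping (insert i0 I) a' b'"
        unfolding nonoverlapping_def
      proof (intro conjI ballI impI)
        show "finite (insert i0 I)" using fin by simp
        show "a' i \<le> b' i" if "i \<in> insert i0 I" for i
          using that I \<open>x \<le> y\<close> by (auto simp: nonoverlapping_def a'_def b'_def min.coboundedI2)
        have left: "{a' i<..<b' i} \<subseteq> {a i<..<b i} \<inter> {..<x}" if "i \<noteq> i0" for i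
          using that by (auto simp: a'_def b'_def min_def split: if_splits)
        have right: "{a' i0<..<b' i0} \<subseteq> {x..}"
          by (auto simp: a'_def)
        fix i j assume ij: "i \<in> insert i0 I" "j \<in> insert i0 I" "i \<noteq> j"
        consider "i = i0" "j \<noteq> i0" | "j = i0" "i \<noteq> i0" | "i \<noteq> i0" "j \<noteq> i0" using ij by blast
        then show "{a' i<..<b' i} \<inter> {a' j<..<b' j} = {}"
        proof cases
          case 1 then show ?thesis using left[of j] right by fastforce
        next
          case 2 then show ?thesis using left[of i] right by fastforce
        next
          case 3
          then have "{a i<..<b i} \<inter> {a j<..<b j} = {}"
            using I ij by (auto simp: nonoverlapping_def)
          then show ?thesis using left[of i] left[of j] 3 by blast
        qed
      qed
      then have "T (insert i0 I, a', b') y \<le> V y"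
        unfolding V_def by (intro cSUP_upper bdd) (auto simp: \<F>_def)
      moreover have "T (insert i0 I, a', b') y = \<bar>u y - u x\<bar> + T F x"
      proof -
        have "(\<Sum>i\<in>I. \<bar>u (min y (b' i)) - u (min y (a' i))\<bar>) = T F x"
          unfolding F T using i0 \<open>x \<le> y\<close> by (intro sum.cong) (auto simp: a'_def b'_def min_def)
        then show ?thesis
          unfolding T using fin i0 \<open>x \<le> y\<close> by (simp add: a'_def b'_def)
      qed
      ultimately show ?thesis by simp
    qed
    then have "V x \<le> V y - \<bar>u y - u x\<bar>"
      unfolding V_def[of x] by (intro cSUP_least ne)
    then show ?thesis by simp
  qed
  have "absolutely_continuous_fun_on UNIV V"
    unfolding absolutely_continuous_fun_on_iff
  proof (intro allI impI)
    fix \<epsilon> :: real assume "\<epsilon> > 0"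
    then have "\<epsilon> / 2 > 0" by simp
    from absolutely_continuous_fun_on_family[OF ac this, where 'i = "nat \<times> nat"]
    obtain \<delta> where \<delta>: "\<delta> > 0" and ac2: "\<And>(I :: (nat \<times> nat) set) a b. \<lbrakk>nonoverlapping I a b;
      \<And>i. i \<in> I \<Longrightarrow> {a i..b i} \<subseteq> UNIV;
      (\<Sum>i\<in>I. b i - a i) < \<delta>\<rbrakk> \<Longrightarrow> (\<Sum>i\<in>I. \<bar>u (b i) - u (a i)\<bar>) < \<epsilon> / 2"
      by blast
    show "\<exists>\<delta>. ac_modulus UNIV V \<epsilon> \<delta>"
      unfolding ac_modulus_def
    proof (intro exI[of _ \<delta>] conjI \<delta> allI impI)
      fix m :: nat and c d :: "nat \<Rightarrow> real"
      assume nov: "nonoverlapping {..<m} c d"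
        and short: "(\<Sum>i<m. d i - c i) < \<delta>"
      have cd: "\<forall>i<m. c i \<le> d i"
        and dis: "\<forall>i<m. \<forall>j<m. i \<noteq> j \<longrightarrow> {c i<..<d i} \<inter> {c j<..<d j} = {}"
        using nov by (auto simp: nonoverlapping_def)
      define \<eta> where "\<eta> = \<epsilon> / (2 * (real m + 1))"
      have \<eta>: "\<eta> > 0" using \<open>\<epsilon> > 0\<close> by (simp add: \<eta>_def)
      have "\<exists>F. F \<in> \<F> \<and> V (d j) - \<eta> < T F (d j)" for j
        using less_cSUP_iff[OF ne bdd, of "V (d j) - \<eta>" "d j"] \<eta> by (auto simp: V_def)
      then obtain F where F: "\<And>j. F j \<in> \<F>" "\<And>j. V (d j) - \<eta> < T (F j) (d j)"
        by metis
      define I where "I j = fst (F j)" for j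
      define a where "a j = fst (snd (F j))" for j
      define b where "b j = snd (snd (F j))" for j
      have Feq: "F j = (I j, a j, b j)" for j by (simp add: I_def a_def b_def)
      have I: "nonoverlapping (I j) (a j) (b j)" for j
        using F(1)[of j] by (auto simp: \<F>_def Feq)
      have finI: "finite (I j)" for j using I[of j] by (simp add: nonoverlapping_def)
      \<comment> \<open>Nearly optimal families for the right ends, each clipped to its own window, form one nonoverlapping
        family that is no longer than the windows.\<close>
      define A where "A = (\<lambda>(j, i). clip (c j) (d j) (a j i))"
      define B where "B = (\<lambda>(j, i). clip (c j) (d j) (b j i))"
      have "nonoverlapping (SIGMA j:{..<m}. I j) A B"
        unfolding nonoverlapping_def
      proof (intro conjI ballI impI)
        show "finite (SIGMA j:{..<m}. I j)" using finI by auto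
        show "A p \<le> B p" if "p \<in> (SIGMA j:{..<m}. I j)" for p
          using that I unfolding A_def B_def
          by (auto simp: nonoverlapping_def intro!: clip_mono)
        fix p q assume p: "p \<in> (SIGMA j:{..<m}. I j)" and q: "q \<in> (SIGMA j:{..<m}. I j)"
          and pq: "p \<noteq> q"
        obtain j i where p': "p = (j, i)" "j < m" "i \<in> I j" using p by auto
        obtain j' i' where q': "q = (j', i')" "j' < m" "i' \<in> I j'" using q by auto
        show "{A p<..<B p} \<inter> {A q<..<B q} = {}"
        proof (cases "j = j'")
          case True
          then show ?thesis
            using nonoverlapping_clip[OF I[of j], of "c j" "d j"] p' q' pq
            by (auto simp: nonoverlapping_def A_def B_def)
        next
          case False
          then have "{c j<..<d j} \<inter> {c j'<..<d j'} = {}" using dis p' q' by blast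
          then show ?thesis
            using open_interval_clip[of "c j" "d j" "a j i" "b j i"]
              open_interval_clip[of "c j'" "d j'" "a j' i'" "b j' i'"] p'(1) q'(1)
            unfolding A_def B_def by (simp only: prod.case) blast
        qed
      qed
      moreover have "(\<Sum>p\<in>(SIGMA j:{..<m}. I j). B p - A p) < \<delta>"
      proof -
        have "(\<Sum>p\<in>(SIGMA j:{..<m}. I j). B p - A p) =
            (\<Sum>j<m. \<Sum>i\<in>I j. clip (c j) (d j) (b j i) - clip (c j) (d j) (a j i))"
          by (subst sum.Sigma) (auto simp: finI A_def B_def split_def)
        also have "\<dots> \<le> (\<Sum>j<m. d j - c j)"
          using cd by (intro sum_mono len I) auto
        finally show ?thesis using short by simp
      qed
      ultimately have "(\<Sum>p\<in>(SIGMA j:{..<m}. I j). \<bar>u (B p) - u (A p)\<bar>) < \<epsilon> / 2"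
        by (intro ac2) auto
      then have small: "(\<Sum>j<m. \<Sum>i\<in>I j. \<bar>u (clip (c j) (d j) (b j i)) - u (clip (c j) (d j) (a j i))\<bar>) < \<epsilon> / 2"
        by (subst sum.Sigma) (auto simp: finI A_def B_def split_def)
      have "(\<Sum>j<m. \<bar>V (d j) - V (c j)\<bar>) \<le>
          (\<Sum>j<m. \<eta> + (\<Sum>i\<in>I j. \<bar>u (clip (c j) (d j) (b j i)) - u (clip (c j) (d j) (a j i))\<bar>))"
      proof (rule sum_mono)
        fix j assume "j \<in> {..<m}"
        then have cdj: "c j \<le> d j" using cd by auto
        have "T (F j) (c j) \<le> V (c j)"
          unfolding V_def by (intro cSUP_upper bdd F)
        moreover have "\<bar>V (d j) - V (c j)\<bar> = V (d j) - V (c j)"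
          using dom[OF cdj] by simp
        ultimately show "\<bar>V (d j) - V (c j)\<bar> \<le> \<eta> +
            (\<Sum>i\<in>I j. \<bar>u (clip (c j) (d j) (b j i)) - u (clip (c j) (d j) (a j i))\<bar>)"
          using incr[OF I[of j] cdj] F(2)[of j] unfolding Feq by simp
      qed
      also have "\<dots> < m * \<eta> + \<epsilon> / 2"
        using small by (simp add: sum.distrib)
      also have "m * \<eta> \<le> \<epsilon> / 2"
        using \<open>\<epsilon> > 0\<close> by (simp add: \<eta>_def field_simps)
      finally show "(\<Sum>j<m. \<bar>V (d j) - V (c j)\<bar>) < \<epsilon>" by simp
    qed
  qed
  then show ?thesis using that dom by blast
qed

section \<open>The fundamental theorem of calculus for absolutely continuous functions\<close>

lemma absolutely_continuous_imp_continuous_on: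
  assumes "absolutely_continuous_fun_on S u" "convex S"
  shows "continuous_on S u"
  unfolding continuous_on_iff
proof (intro ballI allI impI)
  fix x \<epsilon> :: real assume x: "x \<in> S" and "0 < \<epsilon>"
  obtain \<delta> where "\<delta> > 0" and \<delta>: "\<And>(I :: unit set) a b. \<lbrakk>nonoverlapping I a b; \<And>i. i \<in> I \<Longrightarrow> {a i..b i} \<subseteq> S;
       (\<Sum>i\<in>I. b i - a i) < \<delta>\<rbrakk> \<Longrightarrow> (\<Sum>i\<in>I. \<bar>u (b i) - u (a i)\<bar>) < \<epsilon>"
    using absolutely_continuous_fun_on_family[OF assms(1) \<open>0 < \<epsilon>\<close>, where 'i = unit] by blast
  have "dist (u y) (u x) < \<epsilon>" if y: "y \<in> S" "dist y x < \<delta>" for y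
  proof -
    have "closed_segment x y \<subseteq> S" using assms(2) x y(1) by (simp add: closed_segment_subset)
    then have "{min x y..max x y} \<subseteq> S" by (simp add: closed_segment_eq_real_ivl min_def max_def split: if_splits)
    then have "(\<Sum>i\<in>{()}. \<bar>u (max x y) - u (min x y)\<bar>) < \<epsilon>"
      using y(2) by (intro \<delta>) (auto simp: nonoverlapping_def dist_real_def)
    then show ?thesis by (auto simp: dist_real_def max_def min_def abs_minus_commute split: if_splits)
  qed
  then show "\<exists>d>0. \<forall>x'\<in>S. dist x' x < d \<longrightarrow> dist (u x') (u x) < \<epsilon>"
    using \<open>\<delta> > 0\<close> by blast
qed

text \<open>Cover the null set by an open set of measure below the threshold \<open>\<delta>\<close> of absolute continuity and
  write the covering as countably many nonoverlapping intervals. By absolute continuity every finite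
  part of the covering has Stieltjes measure at most \<open>\<epsilon>\<close>.\<close>
lemma emeasure_interval_measure_null:
  assumes mono: "\<And>x y. x \<le> y \<Longrightarrow> P x \<le> P y" and ac: "absolutely_continuous_fun_on UNIV P"
    and N: "N \<in> null_sets lborel" "N \<subseteq> {-R..R}" and R: "R > 0"
  shows "emeasure (interval_measure P) N = 0"
proof -
  have cont: "continuous_on UNIV P"
    using ac by (intro absolutely_continuous_imp_continuous_on) auto
  have "emeasure (interval_measure P) N \<le> ennreal \<epsilon>" if eps: "\<epsilon> > 0" for \<epsilon> :: real
  proof -
    obtain \<delta> where "\<delta> > 0" and \<delta>: "\<And>(I :: real set set) a b. \<lbrakk>nonoverlapping I a b; \<And>i. i \<in> I \<Longrightarrow> {a i..b i} \<subseteq> UNIV;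
       (\<Sum>i\<in>I. b i - a i) < \<delta>\<rbrakk> \<Longrightarrow> (\<Sum>i\<in>I. \<bar>P (b i) - P (a i)\<bar>) < \<epsilon>"
      using absolutely_continuous_fun_on_family[OF ac eps, where 'i = "real set"] by blast
    have neg: "negligible N"
      using N(1) by (simp add: negligible_iff_null_sets null_sets_completionI)
    have N0: "N \<in> lmeasurable" "measure lebesgue N = 0"
      using neg by (auto simp: negligible_iff_measure)
    obtain T where T: "open T" "N \<subseteq> T" "T \<in> lmeasurable" "measure lebesgue T < \<delta>"
    proof -
      obtain T where T: "open T" "N \<subseteq> T" "T - N \<in> lmeasurable" "emeasure lebesgue (T - N) < ennreal \<delta>"
        using sets_lebesgue_outer_open[OF fmeasurableD[OF N0(1)] \<open>\<delta> > 0\<close>] by blast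
      have "T = (T - N) \<union> N" using T(2) by blast
      then have "T \<in> lmeasurable" using fmeasurable.Un[OF T(3) N0(1)] by simp
      moreover have "measure lebesgue T \<le> measure lebesgue (T - N) + measure lebesgue N"
        using measure_Un_le[of "T - N" lebesgue N] T(3) N0(1) \<open>T = (T - N) \<union> N\<close> by auto
      moreover have "measure lebesgue (T - N) < \<delta>"
        using T(3,4) \<open>\<delta> > 0\<close> by (simp add: emeasure_eq_measure2 ennreal_less_iff)
      ultimately show thesis using that T(1,2) N0(2) by auto
    qed
    \<comment> \<open>A gauge that forces every interval of the covering into T.\<close>
    define g where "g x = (if x \<in> T then T else UNIV)" for x
    have gauge: "gauge g" using T(1) by (auto simp: gauge_def g_def)
    have NR: "N \<subseteq> cbox (-R) R" using N(2) by simp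
    have ne: "box (-R) R \<noteq> {}" using R by simp
    obtain \<D> where "countable \<D>"
      and int: "\<And>K. K \<in> \<D> \<Longrightarrow> interior K \<noteq> {} \<and> (\<exists>c d. K = cbox c d)"
      and pw: "pairwise (\<lambda>A B. interior A \<inter> interior B = {}) \<D>"
      and inT: "\<And>K. K \<in> \<D> \<Longrightarrow> \<exists>x \<in> N \<inter> K. K \<subseteq> g x"
      and cov: "N \<subseteq> \<Union>\<D>"
      using covering_lemma[OF NR ne gauge] by (metis (no_types, lifting))
    have "\<forall>K\<in>\<D>. \<exists>c d. K = {c..d} \<and> c \<le> d"
      using int by fastforce
    then obtain lo hi where K: "\<And>K. K \<in> \<D> \<Longrightarrow> K = {lo K..hi K}" "\<And>K. K \<in> \<D> \<Longrightarrow> lo K \<le> hi K"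
      by metis
    have KT: "K \<subseteq> T" if "K \<in> \<D>" for K
      using inT[OF that] T(2) by (auto simp: g_def split: if_splits)
    have KI: "interior K = {lo K<..<hi K}" if "K \<in> \<D>" for K
      by (subst K(1)[OF that]) (rule interior_atLeastAtMost_real)
    have fin: "emeasure (interval_measure P) (\<Union>F) \<le> ennreal \<epsilon>" if F: "finite F" "F \<subseteq> \<D>" for F
    proof -
      have no: "nonoverlapping F lo hi"
        unfolding nonoverlapping_def using F K(2) pw KI
        by (auto simp: pairwise_def subset_eq)
      have "{lo K<..<hi K} \<subseteq> T" if "K \<in> F" for K
        using KT[of K] KI[of K] that F(2) interior_subset[of K] by blast
      then have "(\<Sum>K\<in>F. hi K - lo K) \<le> measure lebesgue T"
        by (intro nonoverlapping_length_le_measure no T(3))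
      then have sm: "(\<Sum>K\<in>F. \<bar>P (hi K) - P (lo K)\<bar>) < \<epsilon>"
        using T(4) by (intro \<delta> no) auto
      have sF: "F \<subseteq> sets (interval_measure P)"
      proof
        fix k assume "k \<in> F"
        then have "k = {lo k..hi k}" using F(2) K(1) by blast
        then show "k \<in> sets (interval_measure P)" by (metis atLeastAtMost_borel sets_interval_measure)
      qed
      have "emeasure (interval_measure P) (\<Union>K\<in>F. K) \<le> (\<Sum>K\<in>F. emeasure (interval_measure P) K)"
        by (rule emeasure_subadditive_finite) (use F sF in auto)
      also have "\<dots> = (\<Sum>K\<in>F. ennreal \<bar>P (hi K) - P (lo K)\<bar>)"
      proof (rule sum.cong[OF refl])
        fix k assume "k \<in> F"
        then have k: "k \<in> \<D>" using F(2) by blast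
        have "emeasure (interval_measure P) k = emeasure (interval_measure P) {lo k..hi k}"
          using K(1)[OF k] by simp
        also have "\<dots> = ennreal (P (hi k) - P (lo k))"
          by (rule emeasure_interval_measure_Icc[OF K(2)[OF k] mono cont])
        finally show "emeasure (interval_measure P) k = ennreal \<bar>P (hi k) - P (lo k)\<bar>"
          using mono[OF K(2)[OF k]] by simp
      qed
      also have "\<dots> = ennreal (\<Sum>K\<in>F. \<bar>P (hi K) - P (lo K)\<bar>)"
        by (rule sum_ennreal) simp
      also have "\<dots> \<le> ennreal \<epsilon>" using sm by (intro ennreal_leI) simp
      finally show ?thesis by simp
    qed
    have D: "emeasure (interval_measure P) (\<Union>\<D>) \<le> ennreal \<epsilon>"
    proof (cases "\<D> = {}")
      case True then show ?thesis by simp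
    next
      case False
      define A where "A n = \<Union>(from_nat_into \<D> ` {..n})" for n
      have sub: "from_nat_into \<D> ` {..n} \<subseteq> \<D>" for n
        using from_nat_into[OF False] by auto
      have meas: "A n \<in> sets (interval_measure P)" for n
      proof -
        have "k \<in> sets borel" if "k \<in> \<D>" for k
          using K(1)[OF that] by (metis atLeastAtMost_borel)
        then show ?thesis unfolding A_def using sub[of n] by (auto intro!: sets.finite_UN)
      qed
      have inc: "incseq A"
        unfolding A_def incseq_def by (intro allI impI Union_mono image_mono) auto
      have "\<Union>\<D> = (\<Union>n. A n)"
      proof -
        have "\<D> = range (from_nat_into \<D>)"
          using range_from_nat_into[OF False \<open>countable \<D>\<close>] by simp
        then have "\<Union>\<D> = (\<Union>i. from_nat_into \<D> i)" by metis
        also have "\<dots> = (\<Union>n. A n)" unfolding A_def by blast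
        finally show ?thesis .
      qed
      moreover have "(SUP n. emeasure (interval_measure P) (A n)) = emeasure (interval_measure P) (\<Union>n. A n)"
        using meas inc by (intro SUP_emeasure_incseq) auto
      moreover have "(SUP n. emeasure (interval_measure P) (A n)) \<le> ennreal \<epsilon>"
        unfolding A_def using sub by (intro SUP_least fin) auto
      ultimately show ?thesis by simp
    qed
    have "\<Union>\<D> \<in> sets (interval_measure P)"
    proof -
      have "k \<in> sets borel" if "k \<in> \<D>" for k
        using K(1)[OF that] by (metis atLeastAtMost_borel)
      then show ?thesis using \<open>countable \<D>\<close> by (auto intro!: sets.countable_Union)
    qed
    then have "emeasure (interval_measure P) N \<le> emeasure (interval_measure P) (\<Union>\<D>)"
      by (intro emeasure_mono cov)
    then show ?thesis using D by simp
  qed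
  then have "emeasure (interval_measure P) N \<le> 0 + ennreal \<epsilon>" if "\<epsilon> > 0" for \<epsilon> :: real
    using that by simp
  then have "emeasure (interval_measure P) N \<le> 0"
    using ennreal_le_epsilon[of 0 "emeasure (interval_measure P) N"] by (simp del: le_zero_eq)
  then show ?thesis by (simp only: le_zero_eq)
qed

text \<open>The Stieltjes measure of \<open>P\<close> is absolutely continuous with respect to Lebesgue measure; the
  density is its Radon-Nikodym derivative.\<close>
lemma monotone_absolutely_continuous_density:
  assumes mono: "\<And>x y. x \<le> y \<Longrightarrow> P x \<le> P y" and ac: "absolutely_continuous_fun_on UNIV P"
  obtains f :: "real \<Rightarrow> real" where "\<And>x. 0 \<le> f x"
    "\<And>x y. x \<le> y \<Longrightarrow> (f has_integral (P y - P x)) {x..y}"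
proof -
  have cont: "continuous_on UNIV P"
    using ac by (intro absolutely_continuous_imp_continuous_on) auto
  have "absolutely_continuous lborel (interval_measure P)"
    unfolding absolutely_continuous_def
  proof
    fix N assume N: "N \<in> null_sets (lborel :: real measure)"
    have "N \<inter> {- real (Suc n)..real (Suc n)} \<in> null_sets (interval_measure P)" for n
    proof -
      have "N \<inter> {- real (Suc n)..real (Suc n)} \<in> null_sets lborel"
        using N by (intro null_set_Int2) auto
      then show ?thesis
        using emeasure_interval_measure_null[OF mono ac, of "N \<inter> {- real (Suc n)..real (Suc n)}" "real (Suc n)"]
        by (auto simp: null_sets_def)
    qed
    then have "(\<Union>n. N \<inter> {- real (Suc n)..real (Suc n)}) \<in> null_sets (interval_measure P)"
      by (intro null_sets_UN) auto
    moreover have "(\<Union>n. N \<inter> {- real (Suc n)..real (Suc n)}) = N"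
    proof -
      have "\<exists>n. x \<in> {- real (Suc n)..real (Suc n)}" for x
      proof -
        obtain n :: nat where "\<bar>x\<bar> \<le> real n" using real_arch_simple by blast
        then show ?thesis by (intro exI[of _ n]) auto
      qed
      then show ?thesis by blast
    qed
    ultimately show "N \<in> null_sets (interval_measure P)" by simp
  qed
  then obtain h where h: "h \<in> borel_measurable lborel" "density lborel h = interval_measure P"
    using sigma_finite_measure.Radon_Nikodym[OF sigma_finite_lborel, of "interval_measure P"] by auto
  have hm [measurable]: "h \<in> borel_measurable borel" using h(1) by simp
  define f where "f x = enn2real (h x)" for x
  show ?thesis
  proof (rule that)
    show "0 \<le> f x" for x by (simp add: f_def)
    fix x y :: real assume "x \<le> y"
    have I: "(\<integral>\<^sup>+z. h z * indicator {x..y} z \<partial>lborel) = ennreal (P y - P x)"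
    proof -
      have "(\<integral>\<^sup>+z. h z * indicator {x..y} z \<partial>lborel) = emeasure (density lborel h) {x..y}"
        by (rule emeasure_density[symmetric]) auto
      also have "\<dots> = ennreal (P y - P x)"
        unfolding h(2) by (rule emeasure_interval_measure_Icc[OF \<open>x \<le> y\<close> mono cont])
      finally show ?thesis .
    qed
    have "AE z in lborel. h z * indicator {x..y} z \<noteq> \<infinity>"
      by (rule nn_integral_PInf_AE) (auto simp: I)
    then have "AE z in lborel. ennreal (f z * indicator {x..y} z) = h z * indicator {x..y} z"
    proof eventually_elim
      case (elim z)
      then show ?case by (cases "z \<in> {x..y}") (auto simp: f_def less_top)
    qed
    then have "(\<integral>\<^sup>+z. ennreal (f z * indicator {x..y} z) \<partial>lborel) = ennreal (P y - P x)"
      using I by (subst nn_integral_cong_AE) auto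
    moreover have "(\<lambda>z. f z * indicator {x..y} z) \<in> borel_measurable borel"
      unfolding f_def by measurable
    ultimately have "((\<lambda>z. f z * indicator {x..y} z) has_integral (P y - P x)) UNIV"
      using mono[OF \<open>x \<le> y\<close>] by (intro nn_integral_has_integral) (auto simp: f_def)
    moreover have "(\<lambda>z. f z * indicator {x..y} z) = (\<lambda>z. if z \<in> {x..y} then f z else 0)"
      by auto
    ultimately show "(f has_integral (P y - P x)) {x..y}"
      using has_integral_restrict_UNIV[of "{x..y}" f] by simp
  qed
qed

text \<open>Lebesgue's differentiation theorem on the line. The theorem \<open>integrable_ccontinuous_explicit\<close>
  averages over intervals to the right of the point; averages to the left are obtained from the
  reflected function.\<close>
lemma indefinite_integral_has_derivative_AE:
  fixes f F :: "real \<Rightarrow> real"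
  assumes F: "\<And>x y. x \<le> y \<Longrightarrow> (f has_integral (F y - F x)) {x..y}"
  shows "AE x in lebesgue. (F has_real_derivative f x) (at x)"
proof -
  have "f integrable_on cbox a b" for a b
    using F[of a b] by (cases "a \<le> b") (auto simp: integrable_on_def)
  then obtain N1 where N1: "negligible N1" "\<And>x e. \<lbrakk>x \<notin> N1; 0 < e\<rbrakk> \<Longrightarrow> \<exists>d>0. \<forall>h. 0 < h \<and> h < d \<longrightarrow>
      norm (integral (cbox x (x + h *\<^sub>R One)) f /\<^sub>R h ^ DIM(real) - f x) < e"
    using integrable_ccontinuous_explicit[of f] by blast
  define f' where "f' x = f (- x)" for x
  have F': "(f' has_integral (F (-x) - F (-y))) {x..y}" if "x \<le> y" for x y
    using F[of "-y" "-x"] that has_integral_reflect_real[of f "F (-x) - F (-y)" "-x" "-y"]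
    unfolding f'_def by simp
  have "f' integrable_on cbox a b" for a b
    using F'[of a b] by (cases "a \<le> b") (auto simp: integrable_on_def)
  then obtain N2 where N2: "negligible N2" "\<And>x e. \<lbrakk>x \<notin> N2; 0 < e\<rbrakk> \<Longrightarrow> \<exists>d>0. \<forall>h. 0 < h \<and> h < d \<longrightarrow>
      norm (integral (cbox x (x + h *\<^sub>R One)) f' /\<^sub>R h ^ DIM(real) - f' x) < e"
    using integrable_ccontinuous_explicit[of f'] by blast
  have "negligible (uminus ` N2)"
    using N2(1) by (rule negligible_differentiable_image_negligible[OF order_refl])
      (auto simp: differentiable_on_def intro!: derivative_intros)
  then have neg: "negligible (N1 \<union> uminus ` N2)"
    using N1(1) by auto
  have "(F has_real_derivative f x) (at x)" if x: "x \<notin> N1 \<union> uminus ` N2" for x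
    unfolding DERIV_def
  proof (rule LIM_I)
    fix e :: real assume "0 < e"
    have "-x \<notin> N2" using x by force
    from N2(2)[OF this \<open>0 < e\<close>] obtain d2 where d2: "d2 > 0" "\<And>h. 0 < h \<Longrightarrow> h < d2 \<Longrightarrow>
      norm (integral (cbox (-x) (-x + h *\<^sub>R One)) f' /\<^sub>R h ^ DIM(real) - f' (-x)) < e" by blast
    from N1(2)[OF _ \<open>0 < e\<close>, of x] x obtain d1 where d1: "d1 > 0" "\<And>h. 0 < h \<Longrightarrow> h < d1 \<Longrightarrow>
      norm (integral (cbox x (x + h *\<^sub>R One)) f /\<^sub>R h ^ DIM(real) - f x) < e" by blast
    have "norm ((F (x + h) - F x) / h - f x) < e" if h: "h \<noteq> 0" "norm (h - 0) < min d1 d2" for h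
    proof (cases "h > 0")
      case True
      have "integral {x..x + h} f = F (x + h) - F x"
        using F[of x "x + h"] True by (intro integral_unique) auto
      then show ?thesis using d1(2)[of h] True h by (simp add: divide_inverse mult.commute)
    next
      case False
      then have "h < 0" using h by simp
      have "integral {-x..-x + (-h)} f' = F x - F (x + h)"
        using F'[of "-x" "-x + (-h)"] \<open>h < 0\<close> by (intro integral_unique) (auto simp: add.commute)
      moreover have "(F x - F (x + h)) / (- h) = (F (x + h) - F x) / h"
        using \<open>h < 0\<close> by (simp add: field_simps)
      ultimately show ?thesis
        using d2(2)[of "-h"] \<open>h < 0\<close> h by (simp add: f'_def divide_inverse mult.commute)
    qed
    then show "\<exists>s>0. \<forall>h. h \<noteq> 0 \<and> norm (h - 0) < s \<longrightarrow> norm ((F (x + h) - F x) / h - f x) < e"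
      using d1(1) d2(1) by (intro exI[of _ "min d1 d2"]) auto
  qed
  then have "{x. \<not> (F has_real_derivative f x) (at x)} \<subseteq> N1 \<union> uminus ` N2"
    by blast
  then have "negligible {x. \<not> (F has_real_derivative f x) (at x)}"
    using neg negligible_subset by blast
  then have "{x. \<not> (F has_real_derivative f x) (at x)} \<in> null_sets lebesgue"
    by (simp add: negligible_iff_null_sets)
  then show ?thesis by (auto intro!: AE_I')
qed

lemma absolutely_continuous_diff:
  assumes "absolutely_continuous_fun_on S u" "absolutely_continuous_fun_on S v"
  shows "absolutely_continuous_fun_on S (\<lambda>x. u x - v x)"
  unfolding absolutely_continuous_fun_on_iff
proof (intro allI impI)
  fix \<epsilon> :: real assume "\<epsilon> > 0"
  then have "\<epsilon> / 2 > 0" by simp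
  then obtain d1 d2 where d: "ac_modulus S u (\<epsilon> / 2) d1" "ac_modulus S v (\<epsilon> / 2) d2"
    using assms unfolding absolutely_continuous_fun_on_iff by blast
  have "ac_modulus S (\<lambda>x. u x - v x) \<epsilon> (min d1 d2)"
    unfolding ac_modulus_def
  proof (intro conjI allI impI)
    fix m :: nat and a b :: "nat \<Rightarrow> real"
    assume "nonoverlapping {..<m} a b" "\<forall>i<m. {a i..b i} \<subseteq> S" "(\<Sum>i<m. b i - a i) < min d1 d2"
    then have "(\<Sum>i<m. \<bar>u (b i) - u (a i)\<bar>) < \<epsilon> / 2" "(\<Sum>i<m. \<bar>v (b i) - v (a i)\<bar>) < \<epsilon> / 2"
      using d unfolding ac_modulus_def min_less_iff_conj by auto
    moreover have "(\<Sum>i<m. \<bar>u (b i) - v (b i) - (u (a i) - v (a i))\<bar>) \<le>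
        (\<Sum>i<m. \<bar>u (b i) - u (a i)\<bar> + \<bar>v (b i) - v (a i)\<bar>)"
      by (intro sum_mono) auto
    ultimately show "(\<Sum>i<m. \<bar>u (b i) - v (b i) - (u (a i) - v (a i))\<bar>) < \<epsilon>"
      by (simp add: sum.distrib)
  qed (use d in \<open>auto simp: ac_modulus_def\<close>)
  then show "\<exists>\<delta>. ac_modulus S (\<lambda>x. u x - v x) \<epsilon> \<delta>" ..
qed

lemma absolutely_continuous_clip:
  assumes ac: "absolutely_continuous_fun_on {a..b} u" and "a \<le> b"
  shows "absolutely_continuous_fun_on UNIV (\<lambda>x. u (clip a b x))"
  unfolding absolutely_continuous_fun_on_iff
proof (intro allI impI)
  fix \<epsilon> :: real assume "\<epsilon> > 0"
  then obtain d where d: "ac_modulus {a..b} u \<epsilon> d"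
    using ac unfolding absolutely_continuous_fun_on_iff by blast
  have "ac_modulus UNIV (\<lambda>x. u (clip a b x)) \<epsilon> d"
    unfolding ac_modulus_def
  proof (intro conjI allI impI)
    fix m :: nat and c e :: "nat \<Rightarrow> real"
    assume no: "nonoverlapping {..<m} c e" and len: "(\<Sum>i<m. e i - c i) < d"
    have "(\<Sum>i<m. clip a b (e i) - clip a b (c i)) \<le> (\<Sum>i<m. e i - c i)"
    proof (rule sum_mono)
      fix i assume "i \<in> {..<m}"
      then show "clip a b (e i) - clip a b (c i) \<le> e i - c i"
        using clip_contract[of a b "e i" "c i"] no by (auto simp: nonoverlapping_def)
    qed
    moreover have "{clip a b (c i)..clip a b (e i)} \<subseteq> {a..b}" for i
      using clip_bounds[OF \<open>a \<le> b\<close>] by (auto intro: order.trans)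
    ultimately show "(\<Sum>i<m. \<bar>u (clip a b (e i)) - u (clip a b (c i))\<bar>) < \<epsilon>"
      using d nonoverlapping_clip[OF no, of a b] len unfolding ac_modulus_def by auto
  qed (use d in \<open>simp add: ac_modulus_def\<close>)
  then show "\<exists>\<delta>. ac_modulus UNIV (\<lambda>x. u (clip a b x)) \<epsilon> \<delta>" ..
qed

text \<open>The variation \<open>V\<close> of \<open>u\<close> and \<open>V - u\<close> are increasing and absolutely continuous, so both have densities,
  and \<open>u\<close> is the integral of the difference of these. At almost every point \<open>deriv u\<close> is the
  classical derivative; at the remaining points it is an arbitrary value.\<close>
theorem absolutely_continuous_FTC:
  assumes ac: "absolutely_continuous_fun_on {a..b} u" and ab: "a \<le> b"
  shows "AE x\<in>{a<..<b} in lebesgue. (u has_real_derivative deriv u x) (at x)"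
    and "deriv u absolutely_integrable_on {a..b}"
    and "(deriv u has_integral (u b - u a)) {a..b}"
proof -
  \<comment> \<open>Extending u by its end values gives a function on the line that is constant on the left.\<close>
  define w where "w x = u (clip a b x)" for x
  have acw: "absolutely_continuous_fun_on UNIV w"
    using absolutely_continuous_clip[OF ac ab] by (simp add: w_def[abs_def])
  have "w x = w a" if "x \<le> a" for x
    using that ab by (simp add: w_def clip_def)
  from absolutely_continuous_variation[OF acw this]
  obtain V where V: "absolutely_continuous_fun_on UNIV V" "\<And>x y. x \<le> y \<Longrightarrow> \<bar>w y - w x\<bar> \<le> V y - V x"
    by blast
  have "V x \<le> V y" if "x \<le> y" for x y using V(2)[OF that] by simp
  from monotone_absolutely_continuous_density[OF this V(1)]
  obtain f1 where f1: "\<And>x. 0 \<le> f1 x" "\<And>x y. x \<le> y \<Longrightarrow> (f1 has_integral (V y - V x)) {x..y}"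
    by blast
  have "V x - w x \<le> V y - w y" if "x \<le> y" for x y using V(2)[OF that] by simp
  from monotone_absolutely_continuous_density[OF this absolutely_continuous_diff[OF V(1) acw]]
  obtain f2 where f2: "\<And>x. 0 \<le> f2 x"
      "\<And>x y. x \<le> y \<Longrightarrow> (f2 has_integral ((V y - w y) - (V x - w x))) {x..y}"
    by blast
  define f where "f x = f1 x - f2 x" for x
  have f: "(f has_integral (w y - w x)) {x..y}" if "x \<le> y" for x y
    using has_integral_diff[OF f1(2)[OF that] f2(2)[OF that]] by (simp add: f_def[abs_def])
  have "f1 absolutely_integrable_on {a..b}" "f2 absolutely_integrable_on {a..b}"
    using f1(1) f2(1) has_integral_integrable[OF f1(2)[OF ab]] has_integral_integrable[OF f2(2)[OF ab]]
    by (auto intro!: nonnegative_absolutely_integrable_1)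
  then have fabs: "f absolutely_integrable_on {a..b}"
    unfolding f_def by (rule set_integral_diff)
  have D: "(u has_real_derivative f x) (at x)" if "(w has_real_derivative f x) (at x)" "x \<in> {a<..<b}" for x
  proof (rule has_field_derivative_transform_within_open[OF that(1) _ that(2)])
    show "w y = u y" if "y \<in> {a<..<b}" for y using that by (simp add: w_def clip_eq)
  qed auto
  have AE: "AE x\<in>{a<..<b} in lebesgue. (u has_real_derivative f x) (at x)"
  proof -
    have "AE x in lebesgue. (w has_real_derivative f x) (at x)"
      by (rule indefinite_integral_has_derivative_AE) (rule f)
    then show ?thesis by eventually_elim (use D in blast)
  qed
  then show "AE x\<in>{a<..<b} in lebesgue. (u has_real_derivative deriv u x) (at x)"
    by eventually_elim (use DERIV_deriv_iff_real_differentiable real_differentiable_def in blast)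
  have "AE x\<in>{a<..<b} in lebesgue. deriv u x = f x"
    using AE by eventually_elim (use DERIV_imp_deriv in blast)
  then obtain N where N: "\<And>x. x \<in> space lebesgue - N \<Longrightarrow> x \<in> {a<..<b} \<longrightarrow> deriv u x = f x"
      "N \<in> null_sets lebesgue"
    by (rule AE_E3) (erule that, assumption)
  then have neg: "negligible (N \<union> {a, b})"
    using N(2) by (auto simp: negligible_iff_null_sets[symmetric])
  have eq: "deriv u x = f x" if "x \<in> {a..b} - (N \<union> {a, b})" for x
    using N(1)[of x] that by auto
  show "deriv u absolutely_integrable_on {a..b}"
    using fabs neg eq by (rule absolutely_integrable_spike)
  have "(f has_integral (u b - u a)) {a..b}"
    using f[OF ab] ab by (simp add: w_def clip_eq)
  then show "(deriv u has_integral (u b - u a)) {a..b}"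
    by (rule has_integral_spike[OF neg eq, rotated])
qed

section \<open>Radial functions in polar coordinates\<close>

definition sphere_area :: "'a::euclidean_space itself \<Rightarrow> real" where
  "sphere_area _ = real DIM('a) * unit_ball_vol (real DIM('a))"

lemma sphere_area_pos: "sphere_area TYPE('a::euclidean_space) > 0"
  by (simp add: sphere_area_def)

text \<open>Both measures give \<open>{x<..}\<close> the volume of the part of the unit ball outside radius \<open>x\<close>. The centre
  is removed because \<open>r \<mapsto> r\<^sup>n\<^sup>-\<^sup>1\<close> lives on the open interval.\<close>
lemma distr_norm_punctured_ball:
  "distr (restrict_space lborel (ball 0 1 - {0} :: 'a::euclidean_space set)) borel norm =
   density lborel (\<lambda>r. ennreal (sphere_area TYPE('a) * r ^ (DIM('a) - 1) * indicator {0<..<1} r))"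
    (is "?M = ?N")
proof (rule measure_eqI_lessThan)
  define \<omega> where "\<omega> = unit_ball_vol (real DIM('a))"
  have \<omega>: "\<omega> \<ge> 0" by (simp add: \<omega>_def)
  have "emeasure ?M {x<..} = ennreal (\<omega> * (1 - (min 1 (max 0 x)) ^ DIM('a))) \<and>
        emeasure ?N {x<..} = ennreal (\<omega> * (1 - (min 1 (max 0 x)) ^ DIM('a)))" for x
  proof
    define z where "z = min 1 (max 0 x)"
    have z: "0 \<le> z" "z \<le> 1" by (auto simp: z_def)
    have zD: "z ^ DIM('a) \<le> 1" using z by (intro power_le_one) auto
    have "emeasure ?M {x<..} =
        emeasure (restrict_space lborel (ball 0 1 - {0} :: 'a set)) (norm -` {x<..} \<inter> (ball 0 1 - {0} :: 'a set))"
      by (subst emeasure_distr) (auto simp: space_restrict_space intro!: measurable_restrict_space1)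
    also have "\<dots> = emeasure lborel (norm -` {x<..} \<inter> (ball 0 1 - {0} :: 'a set))"
      by (rule emeasure_restrict_space) auto
    also have "norm -` {x<..} \<inter> (ball 0 1 - {0} :: 'a set) = ball 0 1 - cball 0 z"
      by (auto simp: z_def min_def max_def split: if_splits) (smt (verit) norm_ge_zero)
    also have "emeasure lborel (ball 0 1 - cball 0 z :: 'a set) =
        emeasure lborel (ball 0 1 :: 'a set) - emeasure lborel (ball 0 z :: 'a set)"
    proof -
      have "emeasure lborel (ball 0 1 - cball 0 z :: 'a set) = emeasure lborel (ball 0 1 - ball 0 z :: 'a set)"
      proof (rule emeasure_eq_AE)
        have "sphere 0 z \<in> null_sets (lborel :: 'a measure)"
          using negligible_sphere[of "0 :: 'a" z]
          by (auto simp: null_sets_completion_iff negligible_iff_null_sets)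
        then show "AE x in lborel. x \<in> (ball 0 1 - cball 0 z :: 'a set) \<longleftrightarrow> x \<in> ball 0 1 - ball 0 z"
          by (rule AE_I') auto
      qed auto
      also have "\<dots> = emeasure lborel (ball 0 1 :: 'a set) - emeasure lborel (ball 0 z :: 'a set)"
        using z by (intro emeasure_Diff) (auto simp: emeasure_ball)
      finally show ?thesis .
    qed
    also have "\<dots> = ennreal (\<omega> * (1 - z ^ DIM('a)))"
      using z zD \<omega> by (simp add: emeasure_ball \<omega>_def[symmetric] algebra_simps ennreal_minus)
    finally show "emeasure ?M {x<..} = ennreal (\<omega> * (1 - (min 1 (max 0 x)) ^ DIM('a)))"
      by (simp add: z_def)
    have "emeasure ?N {x<..} = (\<integral>\<^sup>+r. ennreal (sphere_area TYPE('a) * r ^ (DIM('a) - 1) * indicator {0<..<1} r) * indicator {x<..} r \<partial>lborel)"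
      by (rule emeasure_density) auto
    also have "\<dots> = (\<integral>\<^sup>+r. ennreal (sphere_area TYPE('a) * r ^ (DIM('a) - 1)) * indicator {z..1} r \<partial>lborel)"
    proof (rule nn_integral_cong_AE)
      have "{z, 1} \<in> null_sets (lborel :: real measure)" by (simp add: null_sets_def emeasure_lborel_countable)
      then show "AE r in lborel. ennreal (sphere_area TYPE('a) * r ^ (DIM('a) - 1) * indicator {0<..<1} r) * indicator {x<..} r =
          ennreal (sphere_area TYPE('a) * r ^ (DIM('a) - 1)) * indicator {z..1} r"
        by (rule AE_I') (auto simp: z_def indicator_def min_def max_def split: if_splits)
    qed
    also have "\<dots> = ennreal (\<omega> * 1 ^ DIM('a) - \<omega> * z ^ DIM('a))"
    proof (rule nn_integral_FTC_Icc[where F = "\<lambda>r. \<omega> * r ^ DIM('a)"])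
      show "((\<lambda>r. \<omega> * r ^ DIM('a)) has_real_derivative sphere_area TYPE('a) * r ^ (DIM('a) - 1)) (at r)" for r
        unfolding sphere_area_def \<omega>_def[symmetric] by (auto intro!: derivative_eq_intros)
    qed (use z sphere_area_pos[where 'a = 'a] in auto)
    finally show "emeasure ?N {x<..} = ennreal (\<omega> * (1 - (min 1 (max 0 x)) ^ DIM('a)))"
      by (simp add: z_def algebra_simps)
  qed
  then show "emeasure ?M {x<..} < \<infinity>" "emeasure ?M {x<..} = emeasure ?N {x<..}" for x
    by auto
qed auto

text \<open>A null set of radii pulls back to a null set of points, since the norm sends the volume of the
  ball to a measure with a density.\<close>
lemma AE_radial:
  assumes "AE r\<in>{0<..<1} in lebesgue. Q r"
  shows "AE x::'a::euclidean_space in lebesgue. x \<in> ball 0 1 \<longrightarrow> x \<noteq> 0 \<longrightarrow> Q (norm x)"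
proof -
  have "AE r in lborel. r \<in> {0<..<1} \<longrightarrow> Q r"
    using assms by (simp add: AE_completion_iff)
  then have "AE r in density lborel (\<lambda>r. ennreal (sphere_area TYPE('a) * r ^ (DIM('a) - 1) * indicator {0<..<1} r)). Q r"
    by (subst AE_density) (auto elim!: eventually_mono split: split_indicator_asm)
  then have "AE x in restrict_space lborel (ball 0 1 - {0} :: 'a set). Q (norm x)"
    unfolding distr_norm_punctured_ball[symmetric]
    by (rule AE_distrD[rotated]) (auto intro!: measurable_restrict_space1)
  then have "AE x::'a in lborel. x \<in> ball 0 1 - {0} \<longrightarrow> Q (norm x)"
    by (subst (asm) AE_restrict_space_iff) auto
  then have "AE x::'a in lebesgue. x \<in> ball 0 1 - {0} \<longrightarrow> Q (norm x)"
    by (rule AE_completion)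
  then show ?thesis by eventually_elim auto
qed

lemma AE_not_zero: "AE x::'a::euclidean_space in lebesgue. x \<noteq> 0"
proof -
  have "{0::'a} \<in> null_sets lebesgue"
    by (simp add: negligible_iff_null_sets[symmetric])
  then show ?thesis by (rule AE_I') auto
qed

lemma AE_radial_ball:
  assumes "AE r\<in>{0<..<1} in lebesgue. Q r"
  shows "AE x::'a::euclidean_space in lebesgue. x \<in> ball 0 1 \<longrightarrow> Q (norm x)"
  using AE_radial[OF assms, where 'a = 'a] AE_not_zero by eventually_elim auto

text \<open>The composition of a Lebesgue measurable function with the norm is not measurable for formal
  reasons; it is so because \<open>h\<close> agrees with a Borel function outside a null set of radii.\<close>
lemma set_borel_measurable_radial:
  fixes h :: "real \<Rightarrow> real"
  assumes "set_borel_measurable lebesgue {0<..<1} h"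
  obtains h' where "h' \<in> borel_measurable borel" "AE r\<in>{0<..<1} in lebesgue. h r = h' r"
    "set_borel_measurable lebesgue (ball 0 1 :: 'a::euclidean_space set) (\<lambda>x. h (norm x))"
proof -
  obtain h' where h': "h' \<in> borel_measurable lborel" "AE r in lborel. indicator {0<..<1} r *\<^sub>R h r = h' r"
    using completion_ex_borel_measurable_real[OF assms[unfolded set_borel_measurable_def]] by blast
  have [measurable]: "h' \<in> borel_measurable borel" using h' by simp
  have ae: "AE r\<in>{0<..<1} in lebesgue. h r = h' r"
    using AE_completion[OF h'(2)] by eventually_elim (auto split: split_indicator_asm)
  have [measurable]: "ball 0 1 \<in> sets (borel :: 'a measure)" by simp
  have "(\<lambda>x::'a. indicator (ball 0 1) x *\<^sub>R h' (norm x)) \<in> borel_measurable lborel"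
    by measurable
  then have "(\<lambda>x::'a. indicator (ball 0 1) x *\<^sub>R h' (norm x)) \<in> borel_measurable lebesgue"
    by (rule measurable_completion)
  moreover have "AE x::'a in lebesgue. indicator (ball 0 1) x *\<^sub>R h' (norm x) = indicator (ball 0 1) x *\<^sub>R h (norm x)"
    using AE_radial_ball[OF ae, where 'a = 'a] by eventually_elim (auto simp: indicator_def)
  ultimately have "(\<lambda>x::'a. indicator (ball 0 1) x *\<^sub>R h (norm x)) \<in> borel_measurable lebesgue"
    by (rule borel_measurable_AE)
  then show ?thesis
    using h' ae by (intro that[of h']) (auto simp: set_borel_measurable_def)
qed

text \<open>Polar coordinates: replace \<open>h\<close> by a Borel function and transport the integral along the norm.\<close>
theorem radial_integral:
  fixes h :: "real \<Rightarrow> real"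
  assumes meas: "set_borel_measurable lebesgue {0<..<1} h"
  shows "set_integrable lebesgue (ball 0 1 :: 'a::euclidean_space set) (\<lambda>x. h (norm x)) \<longleftrightarrow>
      set_integrable lebesgue {0<..<1} (\<lambda>r. r ^ (DIM('a) - 1) * h r)" (is ?I)
    and "(LINT x:(ball 0 1 :: 'a set)|lebesgue. h (norm x)) =
      sphere_area TYPE('a) * (LINT r:{0<..<1}|lebesgue. r ^ (DIM('a) - 1) * h r)" (is ?L)
proof -
  obtain h' where h'[measurable]: "h' \<in> borel_measurable borel"
    and ae: "AE r\<in>{0<..<1} in lebesgue. h r = h' r"
    and mb: "set_borel_measurable lebesgue (ball 0 1 :: 'a set) (\<lambda>x. h (norm x))"
    using set_borel_measurable_radial[OF meas, where 'a = 'a] by blast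
  define W where "W = sphere_area TYPE('a)"
  have W: "W > 0" by (simp add: W_def sphere_area_pos)
  define B where "B = (ball 0 1 - {0} :: 'a set)"
  have B[measurable]: "B \<in> sets borel" by (auto simp: B_def)
  have pw: "sphere_area TYPE('a) * r ^ (DIM('a) - 1) * indicator {0<..<1} r \<ge> 0" for r :: real
    using W by (auto simp: W_def indicator_def)
  have m1: "(\<lambda>x::'a. indicator (ball 0 1) x *\<^sub>R h (norm x)) \<in> borel_measurable lebesgue"
    using mb by (simp add: set_borel_measurable_def)
  have m2: "(\<lambda>x::'a. indicator B x *\<^sub>R h' (norm x)) \<in> borel_measurable lborel"
    by measurable
  have ae1: "AE x::'a in lebesgue. indicator (ball 0 1) x *\<^sub>R h (norm x) = indicator B x *\<^sub>R h' (norm x)"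
    using AE_radial_ball[OF ae, where 'a = 'a] AE_not_zero
    by eventually_elim (auto simp: indicator_def B_def)
  have m3: "(\<lambda>r. indicator {0<..<1} r *\<^sub>R (r ^ (DIM('a) - 1) * h r)) \<in> borel_measurable lebesgue"
  proof -
    have "(\<lambda>r::real. r ^ (DIM('a) - 1)) \<in> borel_measurable lebesgue"
      by (rule measurable_completion) measurable
    from borel_measurable_times[OF this meas[unfolded set_borel_measurable_def]]
    show ?thesis by (simp add: mult_ac)
  qed
  have m4: "(\<lambda>r. indicator {0<..<1} r *\<^sub>R (r ^ (DIM('a) - 1) * h' r)) \<in> borel_measurable lborel"
    by measurable
  have ae2: "AE r in lebesgue. indicator {0<..<1} r *\<^sub>R (r ^ (DIM('a) - 1) * h r) =
      indicator {0<..<1} r *\<^sub>R (r ^ (DIM('a) - 1) * h' r)"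
    using ae by eventually_elim (auto simp: indicator_def)
  have wl: "(\<lambda>r. (sphere_area TYPE('a) * r ^ (DIM('a) - 1) * indicator {0<..<1} r) *\<^sub>R h' r) =
      (\<lambda>r. W * (indicator {0<..<1} r *\<^sub>R (r ^ (DIM('a) - 1) * h' r)))"
    by (auto simp: W_def)
  have "integrable lebesgue (\<lambda>x::'a. indicator (ball 0 1) x *\<^sub>R h (norm x)) \<longleftrightarrow>
      integrable lebesgue (\<lambda>x. indicator B x *\<^sub>R h' (norm x))"
    by (rule integrable_cong_AE[OF m1 measurable_completion[OF m2] ae1])
  also have "\<dots> \<longleftrightarrow> integrable lborel (\<lambda>x. indicator B x *\<^sub>R h' (norm x))"
    by (rule integrable_completion[OF m2])
  also have "\<dots> \<longleftrightarrow> integrable (restrict_space lborel B) (\<lambda>x. h' (norm x))"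
    by (rule integrable_restrict_space[symmetric]) simp
  also have "\<dots> \<longleftrightarrow> integrable (distr (restrict_space lborel B) borel norm) h'"
    by (rule integrable_distr_eq[symmetric]) (auto intro!: measurable_restrict_space1)
  also have "\<dots> \<longleftrightarrow> integrable lborel (\<lambda>r. (sphere_area TYPE('a) * r ^ (DIM('a) - 1) * indicator {0<..<1} r) *\<^sub>R h' r)"
    unfolding B_def distr_norm_punctured_ball by (rule integrable_density) (use pw in auto)
  also have "\<dots> \<longleftrightarrow> integrable lborel (\<lambda>r. indicator {0<..<1} r *\<^sub>R (r ^ (DIM('a) - 1) * h' r))"
    unfolding wl using W by (subst integrable_mult_left_iff) simp
  also have "\<dots> \<longleftrightarrow> integrable lebesgue (\<lambda>r. indicator {0<..<1} r *\<^sub>R (r ^ (DIM('a) - 1) * h' r))"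
    by (rule integrable_completion[OF m4, symmetric])
  also have "\<dots> \<longleftrightarrow> integrable lebesgue (\<lambda>r. indicator {0<..<1} r *\<^sub>R (r ^ (DIM('a) - 1) * h r))"
    by (rule integrable_cong_AE[OF m3 measurable_completion[OF m4] ae2, symmetric])
  finally show ?I unfolding set_integrable_def .
  have "integral\<^sup>L lebesgue (\<lambda>x::'a. indicator (ball 0 1) x *\<^sub>R h (norm x)) =
      integral\<^sup>L lebesgue (\<lambda>x. indicator B x *\<^sub>R h' (norm x))"
    by (rule integral_cong_AE[OF m1 measurable_completion[OF m2] ae1])
  also have "\<dots> = integral\<^sup>L lborel (\<lambda>x. indicator B x *\<^sub>R h' (norm x))"
    by (rule integral_completion[OF m2])
  also have "\<dots> = integral\<^sup>L (restrict_space lborel B) (\<lambda>x. h' (norm x))"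
    by (rule integral_restrict_space[symmetric]) simp
  also have "\<dots> = integral\<^sup>L (distr (restrict_space lborel B) borel norm) h'"
    by (rule integral_distr[symmetric]) (auto intro!: measurable_restrict_space1)
  also have "\<dots> = integral\<^sup>L lborel (\<lambda>r. (sphere_area TYPE('a) * r ^ (DIM('a) - 1) * indicator {0<..<1} r) *\<^sub>R h' r)"
    unfolding B_def distr_norm_punctured_ball by (rule integral_density) (use pw in auto)
  also have "\<dots> = W * integral\<^sup>L lborel (\<lambda>r. indicator {0<..<1} r *\<^sub>R (r ^ (DIM('a) - 1) * h' r))"
    unfolding wl by simp
  also have "integral\<^sup>L lborel (\<lambda>r. indicator {0<..<1} r *\<^sub>R (r ^ (DIM('a) - 1) * h' r)) =
      integral\<^sup>L lebesgue (\<lambda>r. indicator {0<..<1} r *\<^sub>R (r ^ (DIM('a) - 1) * h' r))"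
    by (rule integral_completion[OF m4, symmetric])
  also have "\<dots> = integral\<^sup>L lebesgue (\<lambda>r. indicator {0<..<1} r *\<^sub>R (r ^ (DIM('a) - 1) * h r))"
    by (rule integral_cong_AE[OF m3 measurable_completion[OF m4] ae2, symmetric])
  finally show ?L unfolding set_lebesgue_integral_def W_def .
qed

section \<open>Test functions and integration by parts against radial functions\<close>

lemma grad_eqI:
  assumes "GDERIV f x :> D"
  shows "grad f x = D"
  unfolding grad_def
proof (rule the_equality)
  show "GDERIV f x :> D" by (rule assms)
next
  fix E assume "GDERIV f x :> E"
  then have "(\<lambda>h. inner h E) = (\<lambda>h. inner h D)"
    using assms has_derivative_unique unfolding gderiv_def by blast
  then show "E = D" using vector_eq_ldot by metis
qed

lemma Cc1_GDERIV: "\<eta> \<in> Cc1 \<Omega> \<Longrightarrow> GDERIV \<eta> x :> grad \<eta> x"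
  using grad_eqI unfolding Cc1_def by blast

lemma Cc1_continuous_grad: "\<eta> \<in> Cc1 \<Omega> \<Longrightarrow> continuous_on UNIV (grad \<eta>)"
  by (simp add: Cc1_def)

lemma Cc1_continuous: "\<eta> \<in> Cc1 \<Omega> \<Longrightarrow> continuous_on UNIV \<eta>"
  using Cc1_GDERIV unfolding gderiv_def
  by (meson continuous_at_imp_continuous_on has_derivative_continuous)

text \<open>The radius is chosen strictly between the support and the unit sphere, so that the gradient
  vanishes on the sphere of radius \<open>\<rho>\<close> too.\<close>
lemma Cc1_ball_support:
  fixes \<eta> :: "'a::euclidean_space \<Rightarrow> real"
  assumes "\<eta> \<in> Cc1 (ball 0 1)"
  obtains \<rho> where "0 < \<rho>" "\<rho> < 1" "\<And>x. \<rho> \<le> norm x \<Longrightarrow> \<eta> x = 0" "\<And>x. \<rho> \<le> norm x \<Longrightarrow> grad \<eta> x = 0"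
proof -
  obtain K where K: "compact K" "K \<subseteq> ball 0 1" "\<And>x. x \<notin> K \<Longrightarrow> \<eta> x = 0"
    using assms by (auto simp: Cc1_def)
  obtain \<rho>0 where \<rho>0: "0 \<le> \<rho>0" "\<rho>0 < 1" "\<And>x. x \<in> K \<Longrightarrow> norm x \<le> \<rho>0"
  proof (cases "K = {}")
    case True then show ?thesis using that[of 0] by auto
  next
    case False
    have "continuous_on K norm" by (intro continuous_intros)
    then obtain y where y: "y \<in> K" "\<And>x. x \<in> K \<Longrightarrow> norm x \<le> norm y"
      using continuous_attains_sup[OF K(1) False] by blast
    then show ?thesis using that[of "norm y"] K(2) by auto
  qed
  have out: "\<eta> x = 0" if "\<rho>0 < norm x" for x using K(3) \<rho>0(3) that by force
  have "grad \<eta> x = 0" if "\<rho>0 < norm x" for x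
  proof (rule grad_eqI)
    have "(\<eta> has_derivative (\<lambda>h. 0)) (at x)"
    proof (rule has_derivative_transform_within_open[where f = "\<lambda>_. 0"])
      show "open {x :: 'a. \<rho>0 < norm x}" by (intro open_Collect_less continuous_intros)
    qed (use that out in auto)
    then show "GDERIV \<eta> x :> 0" by (simp add: gderiv_def)
  qed
  then show ?thesis using that[of "(\<rho>0 + 1) / 2"] out \<rho>0 by auto
qed

lemma Cc1_bounded:
  fixes \<eta> :: "'a::euclidean_space \<Rightarrow> real"
  assumes "\<eta> \<in> Cc1 (ball 0 1)"
  obtains B where "0 \<le> B" "\<And>x. \<bar>\<eta> x\<bar> \<le> B" "\<And>x. norm (grad \<eta> x) \<le> B"
proof -
  obtain \<rho> where \<rho>: "0 < \<rho>" "\<rho> < 1" "\<And>x. \<rho> \<le> norm x \<Longrightarrow> \<eta> x = 0" "\<And>x. \<rho> \<le> norm x \<Longrightarrow> grad \<eta> x = 0"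
    using Cc1_ball_support[OF assms] by blast
  have "bounded (\<eta> ` cball 0 1)" "bounded (grad \<eta> ` cball 0 1)"
    using Cc1_continuous[OF assms] Cc1_continuous_grad[OF assms]
    by (auto intro!: compact_imp_bounded compact_continuous_image intro: continuous_on_subset)
  then obtain B1 B2 where B: "\<forall>x\<in>cball 0 1. norm (\<eta> x) \<le> B1" "\<forall>x\<in>cball 0 1. norm (grad \<eta> x) \<le> B2"
    by (auto simp: bounded_iff)
  show ?thesis
  proof (rule that[of "max 0 (max B1 B2)"])
    show "\<bar>\<eta> x\<bar> \<le> max 0 (max B1 B2)" for x
      using B(1)[rule_format, of x] \<rho>(2) \<rho>(3)[of x] by (cases "norm x \<le> 1") (auto simp: le_max_iff_disj)
    show "norm (grad \<eta> x) \<le> max 0 (max B1 B2)" for x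
      using B(2)[rule_format, of x] \<rho>(2) \<rho>(4)[of x] by (cases "norm x \<le> 1") (auto simp: le_max_iff_disj)
  qed auto
qed

lemma Cc1_Lipschitz:
  fixes \<eta> :: "'a::euclidean_space \<Rightarrow> real"
  assumes "\<eta> \<in> Cc1 \<Omega>" "\<And>x. norm (grad \<eta> x) \<le> B"
  shows "\<bar>\<eta> x - \<eta> y\<bar> \<le> B * norm (x - y)"
proof -
  have "norm (\<eta> x - \<eta> y) \<le> B * norm (x - y)"
  proof (rule differentiable_bound[of UNIV])
    show "(\<eta> has_derivative (\<lambda>h. inner h (grad \<eta> x))) (at x within UNIV)" for x
      using Cc1_GDERIV[OF assms(1)] by (simp add: gderiv_def)
    show "onorm (\<lambda>h. inner h (grad \<eta> x)) \<le> B" for x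
    proof (rule onorm_le)
      show "norm (inner h (grad \<eta> x)) \<le> B * norm h" for h
        using Cauchy_Schwarz_ineq2[of h "grad \<eta> x"] mult_left_mono[OF assms(2)[of x] norm_ge_zero[of h]]
        by (simp add: mult.commute)
    qed
  qed auto
  then show ?thesis by simp
qed

lemma Cc1_times_linear:
  fixes \<eta> :: "'a::euclidean_space \<Rightarrow> real"
  assumes "\<eta> \<in> Cc1 \<Omega>"
  shows "(\<lambda>x. inner x e * \<eta> x) \<in> Cc1 \<Omega>"
    and "grad (\<lambda>x. inner x e * \<eta> x) = (\<lambda>x. inner x e *\<^sub>R grad \<eta> x + \<eta> x *\<^sub>R e)"
proof -
  have "GDERIV (\<lambda>x. inner x e) x :> e" for x
    by (auto simp: gderiv_def intro!: derivative_eq_intros)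
  then have D: "GDERIV (\<lambda>x. inner x e * \<eta> x) x :> inner x e *\<^sub>R grad \<eta> x + \<eta> x *\<^sub>R e" for x
    by (intro GDERIV_mult Cc1_GDERIV[OF assms])
  then show g: "grad (\<lambda>x. inner x e * \<eta> x) = (\<lambda>x. inner x e *\<^sub>R grad \<eta> x + \<eta> x *\<^sub>R e)"
    by (intro ext grad_eqI)
  have "continuous_on UNIV (\<lambda>x. inner x e *\<^sub>R grad \<eta> x + \<eta> x *\<^sub>R e)"
    by (intro continuous_intros Cc1_continuous_grad[OF assms] Cc1_continuous[OF assms])
  then show "(\<lambda>x. inner x e * \<eta> x) \<in> Cc1 \<Omega>"
  proof -
    assume c: "continuous_on UNIV (\<lambda>x. inner x e *\<^sub>R grad \<eta> x + \<eta> x *\<^sub>R e)"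
    obtain K where K: "compact K" "K \<subseteq> \<Omega>" "\<forall>x. x \<notin> K \<longrightarrow> \<eta> x = 0"
      using assms by (auto simp: Cc1_def)
    have "\<forall>x. x \<notin> K \<longrightarrow> inner x e * \<eta> x = 0" using K(3) by simp
    moreover have "\<forall>x. \<exists>E. GDERIV (\<lambda>x. inner x e * \<eta> x) x :> E" using D by blast
    ultimately show ?thesis
      unfolding Cc1_def g mem_Collect_eq using c K(1,2) by blast
  qed
qed

text \<open>Difference quotients along a fixed sequence of steps, in the form used for dominated convergence.\<close>
lemma GDERIV_directional_sequence:
  assumes "GDERIV f x :> D"
  shows "(\<lambda>m. (f (x + inverse (real (Suc m)) *\<^sub>R e) - f x) * real (Suc m)) \<longlonglongrightarrow> inner e D"
proof -
  have "((\<lambda>t. f (x + t *\<^sub>R e)) has_derivative (\<lambda>t. inner (t *\<^sub>R e) D)) (at 0)"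
  proof (rule has_derivative_compose[where g = f and f = "\<lambda>t. x + t *\<^sub>R e" and g' = "\<lambda>h. inner h D"])
    show "((\<lambda>t. x + t *\<^sub>R e) has_derivative (\<lambda>t. t *\<^sub>R e)) (at 0)"
      by (auto intro!: derivative_eq_intros)
    show "(f has_derivative (\<lambda>h. inner h D)) (at (x + 0 *\<^sub>R e))"
      using assms by (simp add: gderiv_def)
  qed
  then have "((\<lambda>t. f (x + t *\<^sub>R e)) has_real_derivative inner e D) (at 0)"
    by (simp add: has_field_derivative_def mult_commute_abs)
  then have lim: "((\<lambda>h. (f (x + h *\<^sub>R e) - f x) / h) \<longlongrightarrow> inner e D) (at 0)"
    by (simp add: DERIV_def)
  have "filterlim (\<lambda>m. inverse (real (Suc m))) (at 0) sequentially"
    by (rule filterlim_atI[OF LIMSEQ_inverse_real_of_nat]) auto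
  from filterlim_compose[OF lim this] show ?thesis
    by (simp add: field_simps)
qed

lemma set_integrable_imp_set_borel_measurable:
  "set_integrable M S f \<Longrightarrow> set_borel_measurable M S f"
  unfolding set_integrable_def set_borel_measurable_def by (rule borel_measurable_integrable)

lemma set_integrable_bounded:
  fixes f :: "'a::euclidean_space \<Rightarrow> 'b::{banach, second_countable_topology}"
  assumes S: "S \<in> lmeasurable" and m: "set_borel_measurable lebesgue S f"
    and b: "AE x\<in>S in lebesgue. norm (f x) \<le> C"
  shows "set_integrable lebesgue S f"
  unfolding set_integrable_def
proof (rule Bochner_Integration.integrable_bound)
  show "integrable lebesgue (\<lambda>x. C * indicator S x)"
    using S by (intro integrable_mult_right) (auto simp: fmeasurable_def)
  show "(\<lambda>x. indicator S x *\<^sub>R f x) \<in> borel_measurable lebesgue"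
    using m by (simp add: set_borel_measurable_def)
  show "AE x in lebesgue. norm (indicator S x *\<^sub>R f x) \<le> norm (C * indicator S x)"
    using b by eventually_elim (auto simp: indicator_def)
qed

text \<open>Translation invariance; letting the step tend to \<open>0\<close> shows that directional derivatives have
  integral zero.\<close>
lemma integral_difference_quotient_zero:
  fixes f :: "'a::euclidean_space \<Rightarrow> real"
  assumes "integrable lborel f"
  shows "integral\<^sup>L lborel (\<lambda>x. (f (x + e) - f x) * c) = 0"
proof -
  have m: "f \<in> borel_measurable borel" using borel_measurable_integrable[OF assms] by simp
  have "integrable (distr lborel borel ((+) e)) f"
    unfolding lborel_distr_plus by (rule assms)
  then have i: "integrable lborel (\<lambda>x. f (e + x))"
    using m by (subst (asm) integrable_distr_eq) auto
  have "integral\<^sup>L lborel f = integral\<^sup>L (distr lborel borel ((+) e)) f"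
    by (simp only: lborel_distr_plus)
  also have "\<dots> = integral\<^sup>L lborel (\<lambda>x. f (e + x))"
    using m by (intro integral_distr) auto
  finally have "integral\<^sup>L lborel (\<lambda>x. f (x + e)) = integral\<^sup>L lborel f"
    by (simp add: add.commute)
  then show ?thesis using i assms by (simp add: add.commute)
qed

lemma set_borel_measurable_scaleR_sgn:
  fixes h \<eta> :: "'a::euclidean_space \<Rightarrow> real"
  assumes h: "set_borel_measurable lebesgue (ball 0 1) h" and \<eta>: "continuous_on UNIV \<eta>"
  shows "set_borel_measurable lebesgue (ball 0 1) (\<lambda>x. (\<eta> x * h x) *\<^sub>R sgn x)"
proof -
  have zm: "\<eta> \<in> borel_measurable lborel"
    using borel_measurable_continuous_onI[OF \<eta>] by simp
  have sm: "(sgn :: 'a \<Rightarrow> 'a) \<in> borel_measurable lborel"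
    unfolding sgn_div_norm by measurable
  have "(\<lambda>x. (\<eta> x * (indicator (ball 0 1) x *\<^sub>R h x)) *\<^sub>R sgn x) \<in> borel_measurable lebesgue"
    by (rule borel_measurable_scaleR[OF borel_measurable_times[OF measurable_completion[OF zm]
          h[unfolded set_borel_measurable_def]] measurable_completion[OF sm]])
  then show ?thesis unfolding set_borel_measurable_def by (simp add: mult_ac)
qed

text \<open>The product \<open>f = V(|x|) \<zeta>\<close> is Lipschitz with compact support. Its difference quotients in a
  direction \<open>e\<close> have integral zero, are bounded by a multiple of an indicator function, and converge
  almost everywhere to the directional derivative, which therefore has integral zero as well. This
  replaces an approximation of \<open>V\<close> by smooth functions.\<close>
theorem radial_integration_by_parts:
  fixes V dV :: "real \<Rightarrow> real" and \<zeta> :: "'a::euclidean_space \<Rightarrow> real"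
  assumes L: "\<And>r s. \<bar>V r - V s\<bar> \<le> L * \<bar>r - s\<bar>" and M: "\<And>r. \<bar>V r\<bar> \<le> M"
    and dV: "AE r\<in>{0<..<1} in lebesgue. (V has_real_derivative dV r) (at r)"
    and dVm: "set_borel_measurable lebesgue {0<..<1} dV"
    and \<zeta>: "\<zeta> \<in> Cc1 (ball 0 1)"
  shows "set_integrable lebesgue (ball 0 1) (\<lambda>x. V (norm x) *\<^sub>R grad \<zeta> x)" (is ?IA)
    and "set_integrable lebesgue (ball 0 1) (\<lambda>x. (\<zeta> x * dV (norm x)) *\<^sub>R sgn x)" (is ?IB)
    and "(LINT x:ball 0 1|lebesgue. V (norm x) *\<^sub>R grad \<zeta> x) =
      - (LINT x:ball 0 1|lebesgue. (\<zeta> x * dV (norm x)) *\<^sub>R sgn x)" (is "?A = - ?B")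
proof -
  obtain \<rho> where \<rho>: "0 < \<rho>" "\<rho> < 1" "\<And>x. \<rho> \<le> norm x \<Longrightarrow> \<zeta> x = 0" "\<And>x. \<rho> \<le> norm x \<Longrightarrow> grad \<zeta> x = 0"
    using Cc1_ball_support[OF \<zeta>] by blast
  obtain B where B: "0 \<le> B" "\<And>x. \<bar>\<zeta> x\<bar> \<le> B" "\<And>x. norm (grad \<zeta> x) \<le> B"
    using Cc1_bounded[OF \<zeta>] by blast
  have L0: "0 \<le> L" using L[of 1 0] by simp
  have M0: "0 \<le> M" using M[of 0] by simp
  have "L-lipschitz_on UNIV V"
    using L L0 by (intro lipschitz_onI) (auto simp: dist_real_def)
  then have Vcont: "continuous_on UNIV V" by (rule lipschitz_on_continuous_on)
  have \<zeta>c: "continuous_on UNIV \<zeta>" "continuous_on UNIV (grad \<zeta>)"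
    using Cc1_continuous[OF \<zeta>] Cc1_continuous_grad[OF \<zeta>] .
  have Vnc: "continuous_on UNIV (\<lambda>x::'a. V (norm x))"
    using continuous_on_compose2[OF Vcont, of UNIV "norm :: 'a \<Rightarrow> real"] by (simp add: continuous_on_norm continuous_on_id)
  define f where "f x = V (norm x) * \<zeta> x" for x
  define K where "K = L * B + M * B"
  have fK: "\<bar>f x - f y\<bar> \<le> K * norm (x - y)" for x y
  proof -
    have "f x - f y = (V (norm x) - V (norm y)) * \<zeta> x + V (norm y) * (\<zeta> x - \<zeta> y)"
      by (simp add: f_def algebra_simps)
    then have "\<bar>f x - f y\<bar> \<le> \<bar>V (norm x) - V (norm y)\<bar> * \<bar>\<zeta> x\<bar> + \<bar>V (norm y)\<bar> * \<bar>\<zeta> x - \<zeta> y\<bar>"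
      by (simp add: abs_mult[symmetric] abs_triangle_ineq)
    also have "\<dots> \<le> (L * norm (x - y)) * B + M * (B * norm (x - y))"
    proof (intro add_mono mult_mono)
      have "L * \<bar>norm x - norm y\<bar> \<le> L * norm (x - y)"
        using L0 by (intro mult_left_mono norm_triangle_ineq3)
      then show "\<bar>V (norm x) - V (norm y)\<bar> \<le> L * norm (x - y)"
        using L[of "norm x" "norm y"] by linarith
      show "\<bar>\<zeta> x - \<zeta> y\<bar> \<le> B * norm (x - y)" by (rule Cc1_Lipschitz[OF \<zeta> B(3)])
    qed (use B M M0 L0 in auto)
    also have "\<dots> = K * norm (x - y)" by (simp add: K_def algebra_simps)
    finally show ?thesis .
  qed
  have K0: "0 \<le> K" using L0 M0 B by (simp add: K_def)
  have fc: "continuous_on UNIV f"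
    unfolding f_def by (intro continuous_on_mult Vnc \<zeta>c)
  have f0: "f x = 0" if "\<rho> \<le> norm x" for x using \<rho>(3)[OF that] by (simp add: f_def)
  have fint: "integrable lborel f"
  proof -
    have "integrable lborel (\<lambda>x. indicator (cball 0 1) x *\<^sub>R f x)"
      using fc continuous_on_subset by (intro borel_integrable_compact) auto
    moreover have "(\<lambda>x. indicator (cball 0 1) x *\<^sub>R f x) = f"
      using f0 \<rho>(2) by (auto simp: indicator_def fun_eq_iff)
    ultimately show ?thesis by simp
  qed
  have dVm': "set_borel_measurable lebesgue (ball 0 1 :: 'a set) (\<lambda>x. dV (norm x))"
    using set_borel_measurable_radial[OF dVm] by blast
  have dVb: "AE x::'a in lebesgue. x \<in> ball 0 1 \<longrightarrow> \<bar>dV (norm x)\<bar> \<le> L"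
  proof (rule AE_radial_ball)
    show "AE r\<in>{0<..<1} in lebesgue. \<bar>dV r\<bar> \<le> L"
      using dV
    proof eventually_elim
      case (elim r)
      show ?case
      proof
        assume "r \<in> {0<..<1}"
        then have "((\<lambda>h. (V (r + h) - V r) / h) \<longlongrightarrow> dV r) (at 0)"
          using elim by (simp add: DERIV_def)
        then have "((\<lambda>h. \<bar>(V (r + h) - V r) / h\<bar>) \<longlongrightarrow> \<bar>dV r\<bar>) (at 0)"
          by (rule tendsto_rabs)
        moreover have "\<bar>(V (r + h) - V r) / h\<bar> \<le> L" if "h \<noteq> 0" for h
          using L[of "r + h" r] that by (simp add: abs_divide field_simps)
        then have "eventually (\<lambda>h. \<bar>(V (r + h) - V r) / h\<bar> \<le> L) (at 0)"
          by (auto simp: eventually_at intro: exI[of _ 1])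
        ultimately show "\<bar>dV r\<bar> \<le> L"
          by (rule tendsto_upperbound) simp
      qed
    qed
  qed
  have lb: "(ball 0 1 :: 'a set) \<in> lmeasurable" by simp
  show Amint: "set_integrable lebesgue (ball 0 1) (\<lambda>x. V (norm x) *\<^sub>R grad \<zeta> x)"
  proof (rule set_integrable_bounded[OF lb])
    have "(\<lambda>x. V (norm x) *\<^sub>R grad \<zeta> x) \<in> borel_measurable borel"
      by (intro borel_measurable_continuous_onI continuous_on_scaleR Vnc \<zeta>c)
    then have "(\<lambda>x. V (norm x) *\<^sub>R grad \<zeta> x) \<in> borel_measurable lborel" by simp
    then have "(\<lambda>x. indicator (ball 0 1) x *\<^sub>R V (norm x) *\<^sub>R grad \<zeta> x) \<in> borel_measurable lborel"
      by (rule borel_measurable_scaleR[rotated]) (intro borel_measurable_indicator, simp)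
    then show "set_borel_measurable lebesgue (ball 0 1) (\<lambda>x. V (norm x) *\<^sub>R grad \<zeta> x)"
      unfolding set_borel_measurable_def by (rule measurable_completion)
    show "AE x\<in>ball 0 1 in lebesgue. norm (V (norm x) *\<^sub>R grad \<zeta> x) \<le> M * B"
      using M B M0 by (intro AE_I2) (auto intro!: mult_mono)
  qed
  show Bmint: "set_integrable lebesgue (ball 0 1) (\<lambda>x. (\<zeta> x * dV (norm x)) *\<^sub>R sgn x)"
  proof (rule set_integrable_bounded[OF lb])
    show "set_borel_measurable lebesgue (ball 0 1) (\<lambda>x. (\<zeta> x * dV (norm x)) *\<^sub>R sgn x)"
      by (rule set_borel_measurable_scaleR_sgn[OF dVm' \<zeta>c(1)])
    show "AE x\<in>ball 0 1 in lebesgue. norm ((\<zeta> x * dV (norm x)) *\<^sub>R sgn x) \<le> B * L"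
      using dVb by eventually_elim
        (use B L0 in \<open>auto simp: norm_sgn abs_mult intro!: mult_mono\<close>)
  qed
  define F where "F x = indicator (ball 0 1) x *\<^sub>R (V (norm x) *\<^sub>R grad \<zeta> x)
      + indicator (ball 0 1) x *\<^sub>R ((\<zeta> x * dV (norm x)) *\<^sub>R sgn x)" for x
  have Fint: "integrable lebesgue F"
    unfolding F_def using Amint Bmint unfolding set_integrable_def by (rule Bochner_Integration.integrable_add)
  have deriv: "AE x in lebesgue. GDERIV f x :> F x"
  proof -
    have *: "AE x::'a in lebesgue. x \<in> ball 0 1 \<longrightarrow> (V has_real_derivative dV (norm x)) (at (norm x))"
      by (rule AE_radial_ball[OF dV])
    show ?thesis
      using * AE_not_zero
    proof eventually_elim
      case (elim x)
      show ?case
      proof (cases "x \<in> ball 0 1")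
        case True
        then have "GDERIV (\<lambda>x. V (norm x)) x :> dV (norm x) *\<^sub>R sgn x"
          using elim by (intro GDERIV_DERIV_compose GDERIV_norm) auto
        then have "GDERIV f x :> V (norm x) *\<^sub>R grad \<zeta> x + \<zeta> x *\<^sub>R (dV (norm x) *\<^sub>R sgn x)"
          unfolding f_def by (intro GDERIV_mult Cc1_GDERIV[OF \<zeta>])
        then show ?thesis using True by (simp add: F_def)
      next
        case False
        have "(f has_derivative (\<lambda>h. 0)) (at x)"
        proof (rule has_derivative_transform_within_open[where f = "\<lambda>_. 0"])
          show "open {x :: 'a. \<rho> < norm x}" by (intro open_Collect_less continuous_intros)
        qed (use False f0 \<rho> in auto)
        then show ?thesis using False by (simp add: gderiv_def F_def)
      qed
    qed
  qed
  have zero: "inner e (integral\<^sup>L lebesgue F) = 0" for e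
  proof -
    define s where "s m x = (f (x + inverse (real (Suc m)) *\<^sub>R e) - f x) * real (Suc m)" for m x
    have sm: "s m \<in> borel_measurable lborel" for m
    proof -
      have "continuous_on UNIV (s m)"
        unfolding s_def by (intro continuous_intros continuous_on_compose2[OF fc] fc) auto
      then show ?thesis using borel_measurable_continuous_onI by simp
    qed
    have s0: "integral\<^sup>L lebesgue (s m) = 0" for m
    proof -
      have "s m = (\<lambda>x. (f (x + inverse (real (Suc m)) *\<^sub>R e) - f x) * real (Suc m))"
        by (simp add: s_def fun_eq_iff)
      then have "integral\<^sup>L lborel (s m) = 0"
        by (simp only: integral_difference_quotient_zero[OF fint])
      then show ?thesis by (simp only: integral_completion[OF sm])
    qed
    have "(\<lambda>m. integral\<^sup>L lebesgue (s m)) \<longlonglongrightarrow> integral\<^sup>L lebesgue (\<lambda>x. inner e (F x))"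
    proof (rule integral_dominated_convergence)
      show "(\<lambda>x. inner e (F x)) \<in> borel_measurable lebesgue"
        using borel_measurable_integrable[OF Fint] by (intro borel_measurable_inner) auto
      show "s m \<in> borel_measurable lebesgue" for m by (rule measurable_completion[OF sm])
      show "integrable lebesgue (\<lambda>x::'a. K * norm e * indicator (cball 0 (1 + norm e)) x)"
        by (intro integrable_mult_right integrable_real_indicator) (auto simp: emeasure_cball)
      show "AE x in lebesgue. (\<lambda>m. s m x) \<longlonglongrightarrow> inner e (F x)"
        using deriv unfolding s_def by eventually_elim (rule GDERIV_directional_sequence)
      show "AE x in lebesgue. norm (s m x) \<le> K * norm e * indicator (cball 0 (1 + norm e)) x" for m
      proof (rule AE_I2)
        fix x
        have "\<bar>f (x + inverse (real (Suc m)) *\<^sub>R e) - f x\<bar> \<le> K * (norm e / real (Suc m))"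
          using fK[of "x + inverse (real (Suc m)) *\<^sub>R e" x] by (simp add: divide_inverse mult.commute)
        then have b: "\<bar>s m x\<bar> \<le> K * norm e"
        proof -
          assume *: "\<bar>f (x + inverse (real (Suc m)) *\<^sub>R e) - f x\<bar> \<le> K * (norm e / real (Suc m))"
          have "\<bar>s m x\<bar> = \<bar>f (x + inverse (real (Suc m)) *\<^sub>R e) - f x\<bar> * real (Suc m)"
            by (simp only: s_def abs_mult abs_of_nat)
          also have "\<dots> \<le> K * (norm e / real (Suc m)) * real (Suc m)"
            by (rule mult_right_mono[OF *]) simp
          also have "\<dots> = K * norm e" by simp
          finally show ?thesis .
        qed
        show "norm (s m x) \<le> K * norm e * indicator (cball 0 (1 + norm e)) x"
        proof (cases "norm x \<le> 1 + norm e")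
          case True then show ?thesis using b by simp
        next
          case False
          have "norm (inverse (real (Suc m)) *\<^sub>R e) \<le> norm e"
            by (simp add: divide_simps mult_le_cancel_left1)
          then have "1 \<le> norm (x + inverse (real (Suc m)) *\<^sub>R e)"
            using False norm_diff_ineq[of x "inverse (real (Suc m)) *\<^sub>R e"] by linarith
          then have "f (x + inverse (real (Suc m)) *\<^sub>R e) = 0"
            using f0 \<rho>(2) by simp
          moreover have "f x = 0" using f0[of x] \<rho>(2) False norm_ge_zero[of e] by linarith
          ultimately show ?thesis by (simp add: s_def K0)
        qed
      qed
    qed
    then have "integral\<^sup>L lebesgue (\<lambda>x. inner e (F x)) = 0"
      using s0 by (simp add: LIMSEQ_const_iff)
    then show ?thesis using Fint by simp
  qed
  have "integral\<^sup>L lebesgue F = 0"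
    using zero[of "integral\<^sup>L lebesgue F"] by simp
  moreover have "integral\<^sup>L lebesgue F = ?A + ?B"
    unfolding F_def set_lebesgue_integral_def
    using Amint Bmint unfolding set_integrable_def by (rule Bochner_Integration.integral_add)
  ultimately show "?A = - ?B" by (simp add: eq_neg_iff_add_eq_0)
qed

text \<open>The vector field \<open>V(|x|) x\<close> tested against \<open>\<nabla>\<eta>\<close>: apply the integration by parts to the test
  functions \<open>x\<^sub>b \<eta>\<close> and sum the \<open>b\<close>-th components over the coordinates \<open>b\<close>.\<close>
theorem radial_divergence_theorem:
  fixes V dV :: "real \<Rightarrow> real" and \<eta> :: "'a::euclidean_space \<Rightarrow> real"
  assumes L: "\<And>r s. \<bar>V r - V s\<bar> \<le> L * \<bar>r - s\<bar>" and M: "\<And>r. \<bar>V r\<bar> \<le> M"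
    and dV: "AE r\<in>{0<..<1} in lebesgue. (V has_real_derivative dV r) (at r)"
    and dVm: "set_borel_measurable lebesgue {0<..<1} dV"
    and \<eta>: "\<eta> \<in> Cc1 (ball 0 1)"
  shows "set_integrable lebesgue (ball 0 1) (\<lambda>x. V (norm x) * (inner x (grad \<eta> x) + real DIM('a) * \<eta> x))" (is ?I1)
    and "set_integrable lebesgue (ball 0 1) (\<lambda>x. \<eta> x * (norm x * dV (norm x)))" (is ?I2)
    and "(LINT x:ball 0 1|lebesgue. V (norm x) * (inner x (grad \<eta> x) + real DIM('a) * \<eta> x)) =
      - (LINT x:ball 0 1|lebesgue. \<eta> x * (norm x * dV (norm x)))" (is ?E)
proof -
  define \<zeta> where "\<zeta> b x = inner x b * \<eta> x" for b x
  have \<zeta>: "\<zeta> b \<in> Cc1 (ball 0 1)" "grad (\<zeta> b) = (\<lambda>x. inner x b *\<^sub>R grad \<eta> x + \<eta> x *\<^sub>R b)" for b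
    using Cc1_times_linear[OF \<eta>, of b] by (simp_all add: \<zeta>_def[abs_def])
  note ibp = radial_integration_by_parts[OF L M dV dVm \<zeta>(1)]
  have A: "integrable lebesgue (\<lambda>x. inner (indicator (ball 0 1) x *\<^sub>R V (norm x) *\<^sub>R grad (\<zeta> b) x) b)" for b
    using ibp(1)[of b] unfolding set_integrable_def by (rule integrable_inner_left)
  have B: "integrable lebesgue (\<lambda>x. inner (indicator (ball 0 1) x *\<^sub>R ((\<zeta> b x * dV (norm x)) *\<^sub>R sgn x)) b)" for b
    using ibp(2)[of b] unfolding set_integrable_def by (rule integrable_inner_left)
  have eq: "(LINT x|lebesgue. inner (indicator (ball 0 1) x *\<^sub>R V (norm x) *\<^sub>R grad (\<zeta> b) x) b) =
      - (LINT x|lebesgue. inner (indicator (ball 0 1) x *\<^sub>R ((\<zeta> b x * dV (norm x)) *\<^sub>R sgn x)) b)" for b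
  proof -
    have "(LINT x|lebesgue. inner (indicator (ball 0 1) x *\<^sub>R V (norm x) *\<^sub>R grad (\<zeta> b) x) b) =
        inner (LINT x:ball 0 1|lebesgue. V (norm x) *\<^sub>R grad (\<zeta> b) x) b"
      unfolding set_lebesgue_integral_def
      by (rule integral_inner_left) (rule ibp(1)[unfolded set_integrable_def])
    moreover have "(LINT x|lebesgue. inner (indicator (ball 0 1) x *\<^sub>R ((\<zeta> b x * dV (norm x)) *\<^sub>R sgn x)) b) =
        inner (LINT x:ball 0 1|lebesgue. (\<zeta> b x * dV (norm x)) *\<^sub>R sgn x) b"
      unfolding set_lebesgue_integral_def
      by (rule integral_inner_left) (rule ibp(2)[unfolded set_integrable_def])
    ultimately show ?thesis
      using ibp(3)[of b] by (simp only: inner_minus_left)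
  qed
  have pt1: "indicator (ball 0 1) x *\<^sub>R (V (norm x) * (inner x (grad \<eta> x) + real DIM('a) * \<eta> x)) =
      (\<Sum>b\<in>Basis. inner (indicator (ball 0 1) x *\<^sub>R V (norm x) *\<^sub>R grad (\<zeta> b) x) b)" for x :: 'a
  proof -
    have "(\<Sum>b\<in>Basis. inner (grad (\<zeta> b) x) b) =
        (\<Sum>b\<in>Basis. inner x b * inner (grad \<eta> x) b) + (\<Sum>b\<in>(Basis :: 'a set). \<eta> x)"
      unfolding sum.distrib[symmetric] by (rule sum.cong) (auto simp: \<zeta>(2) inner_add_left inner_Basis)
    also have "\<dots> = inner x (grad \<eta> x) + real DIM('a) * \<eta> x"
      by (subst euclidean_inner[of x "grad \<eta> x"]) simp
    finally show ?thesis
      by (simp add: sum_distrib_left[symmetric])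
  qed
  have pt2: "indicator (ball 0 1) x *\<^sub>R (\<eta> x * (norm x * dV (norm x))) =
      (\<Sum>b\<in>Basis. inner (indicator (ball 0 1) x *\<^sub>R ((\<zeta> b x * dV (norm x)) *\<^sub>R sgn x)) b)" for x :: 'a
  proof -
    have "(\<Sum>b\<in>Basis. inner x b * inner (sgn x) b) = norm x"
    proof -
      have "(\<Sum>b\<in>Basis. inner x b * inner (sgn x) b) = inner x (sgn x)"
        by (rule euclidean_inner[symmetric])
      also have "\<dots> = norm x"
        by (cases "x = 0") (auto simp: sgn_div_norm dot_square_norm power2_eq_square)
      finally show ?thesis .
    qed
    then have "(\<Sum>b\<in>Basis. indicator (ball 0 1) x * \<eta> x * dV (norm x) * (inner x b * inner (sgn x) b)) =
        indicator (ball 0 1) x * \<eta> x * dV (norm x) * norm x"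
      by (simp only: sum_distrib_left[symmetric])
    then show ?thesis
      by (simp add: \<zeta>_def mult_ac)
  qed
  show ?I1 unfolding set_integrable_def pt1 by (intro Bochner_Integration.integrable_sum A)
  show ?I2 unfolding set_integrable_def pt2 by (intro Bochner_Integration.integrable_sum B)
  have "(LINT x:ball 0 1|lebesgue. V (norm x) * (inner x (grad \<eta> x) + real DIM('a) * \<eta> x)) =
      (LINT x|lebesgue. (\<Sum>b\<in>Basis. inner (indicator (ball 0 1) x *\<^sub>R V (norm x) *\<^sub>R grad (\<zeta> b) x) b))"
    unfolding set_lebesgue_integral_def pt1 ..
  also have "\<dots> = (\<Sum>b\<in>Basis. (LINT x|lebesgue. inner (indicator (ball 0 1) x *\<^sub>R V (norm x) *\<^sub>R grad (\<zeta> b) x) b))"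
    by (rule Bochner_Integration.integral_sum) (rule A)
  also have "\<dots> = - (\<Sum>b\<in>Basis. (LINT x|lebesgue. inner (indicator (ball 0 1) x *\<^sub>R ((\<zeta> b x * dV (norm x)) *\<^sub>R sgn x)) b))"
    unfolding eq by (rule sum_negf)
  also have "(\<Sum>b\<in>Basis. (LINT x|lebesgue. inner (indicator (ball 0 1) x *\<^sub>R ((\<zeta> b x * dV (norm x)) *\<^sub>R sgn x)) b)) =
      (LINT x|lebesgue. (\<Sum>b\<in>Basis. inner (indicator (ball 0 1) x *\<^sub>R ((\<zeta> b x * dV (norm x)) *\<^sub>R sgn x)) b))"
    by (rule Bochner_Integration.integral_sum[symmetric]) (rule B)
  also have "\<dots> = (LINT x:ball 0 1|lebesgue. \<eta> x * (norm x * dV (norm x)))"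
    unfolding set_lebesgue_integral_def pt2 ..
  finally show ?E .
qed

section \<open>Profiles on the unit interval\<close>

lemma set_borel_measurable_iff_lebesgue_on:
  fixes f :: "'a::euclidean_space \<Rightarrow> real"
  shows "S \<in> sets lebesgue \<Longrightarrow> set_borel_measurable lebesgue S f \<longleftrightarrow> f \<in> borel_measurable (lebesgue_on S)"
  unfolding set_borel_measurable_def by (simp add: borel_measurable_restrict_space_iff)

lemma set_borel_measurable_continuous_on:
  fixes f :: "real \<Rightarrow> real"
  assumes "continuous_on S f" "S \<in> sets borel"
  shows "set_borel_measurable lebesgue S f"
  unfolding set_borel_measurable_def
  by (rule measurable_completion) (use borel_measurable_continuous_on_indicator[OF assms(2,1)] in simp)

lemma locally_absolutely_continuous_on_subset:
  "locally_absolutely_continuous_on I u \<Longrightarrow> J \<subseteq> I \<Longrightarrow> locally_absolutely_continuous_on J u"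
  unfolding locally_absolutely_continuous_on_def by blast

lemma unit_interval_exhaustion:
  assumes "r \<in> {0<..<1::real}"
  shows "\<exists>m. \<forall>j\<ge>m. r \<in> {inverse (real (Suc j))<..<1 - inverse (real (Suc j))}"
proof -
  have r: "0 < min r (1 - r)" using assms by auto
  obtain m where m: "inverse (real (Suc m)) < min r (1 - r)"
    using reals_Archimedean[OF r] by blast
  have "inverse (real (Suc j)) \<le> inverse (real (Suc m))" if "m \<le> j" for j
    using that by (intro le_imp_inverse_le) auto
  note le = this
  have "r \<in> {inverse (real (Suc j))<..<1 - inverse (real (Suc j))}" if "m \<le> j" for j
    using m le[OF that] unfolding min_less_iff_conj greaterThanLessThan_iff by linarith
  then show ?thesis by blast
qed

lemma inverse_Suc_interval:
  "{inverse (real (Suc j))..1 - inverse (real (Suc j))} \<subseteq> {0<..<1}"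
proof -
  have "0 < c \<Longrightarrow> {c..1 - c} \<subseteq> {0<..<1}" for c :: real by auto
  then show ?thesis by simp
qed

lemma locally_absolutely_continuous_AE_deriv:
  assumes "locally_absolutely_continuous_on {0<..<1} u"
  shows "AE r\<in>{0<..<1} in lebesgue. (u has_real_derivative deriv u r) (at r)"
proof -
  have "AE r\<in>{inverse (real (Suc j))<..<1 - inverse (real (Suc j))} in lebesgue. (u has_real_derivative deriv u r) (at r)" for j
  proof (cases "inverse (real (Suc j)) \<le> 1 - inverse (real (Suc j))")
    case True
    then show ?thesis
      using assms inverse_Suc_interval[of j]
      by (intro absolutely_continuous_FTC(1)) (auto simp: locally_absolutely_continuous_on_def)
  next
    case False then show ?thesis by (intro AE_I2) auto
  qed
  then have "AE r in lebesgue. \<forall>j. r \<in> {inverse (real (Suc j))<..<1 - inverse (real (Suc j))} \<longrightarrow>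
      (u has_real_derivative deriv u r) (at r)"
    by (subst AE_all_countable) blast
  then show ?thesis
    by eventually_elim (use unit_interval_exhaustion in blast)
qed

lemma locally_absolutely_continuous_continuous_on:
  assumes "locally_absolutely_continuous_on {0<..<1} u"
  shows "continuous_on {0<..<1} u"
proof -
  have "isCont u r" if r: "r \<in> {0<..<1}" for r
  proof -
    have "continuous_on {r / 2..(r + 1) / 2} u"
    proof (rule absolutely_continuous_imp_continuous_on)
      have "{r / 2..(r + 1) / 2} \<subseteq> {0<..<1}" "r / 2 \<le> (r + 1) / 2" using r by auto
      then show "absolutely_continuous_fun_on {r / 2..(r + 1) / 2} u"
        using assms unfolding locally_absolutely_continuous_on_def by blast
    qed simp
    moreover have "r \<in> interior {r / 2..(r + 1) / 2}" using r by simp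
    ultimately show ?thesis using continuous_on_interior by blast
  qed
  then show ?thesis by (simp add: continuous_at_imp_continuous_on)
qed

text \<open>On each compact subinterval \<open>deriv u\<close> is integrable; exhaust the open interval.\<close>
lemma locally_absolutely_continuous_deriv_measurable:
  assumes "locally_absolutely_continuous_on {0<..<1} u"
  shows "set_borel_measurable lebesgue {0<..<1} (deriv u)"
  unfolding set_borel_measurable_def
proof (rule borel_measurable_LIMSEQ_real)
  define J where "J j = {inverse (real (Suc j))..1 - inverse (real (Suc j))}" for j
  show "(\<lambda>r. indicator (J j) r *\<^sub>R deriv u r) \<in> borel_measurable lebesgue" for j
  proof (cases "inverse (real (Suc j)) \<le> 1 - inverse (real (Suc j))")
    case True
    then have "deriv u absolutely_integrable_on J j"
      using assms inverse_Suc_interval[of j] unfolding J_def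
      by (intro absolutely_continuous_FTC(2)) (auto simp: locally_absolutely_continuous_on_def)
    then show ?thesis unfolding set_integrable_def by (rule borel_measurable_integrable)
  next
    case False then have "J j = {}" by (simp add: J_def)
    then show ?thesis by simp
  qed
  show "(\<lambda>j. indicator (J j) r *\<^sub>R deriv u r) \<longlonglongrightarrow> indicator {0<..<1} r *\<^sub>R deriv u r"
    if "r \<in> space lebesgue" for r
  proof (cases "r \<in> {0<..<1}")
    case True
    then obtain m where "\<forall>j\<ge>m. r \<in> J j"
      using unit_interval_exhaustion[OF True] by (force simp: J_def)
    then have "eventually (\<lambda>j. indicator (J j) r *\<^sub>R deriv u r = indicator {0<..<1} r *\<^sub>R deriv u r) sequentially"
      using True by (auto simp: eventually_sequentially intro!: exI[of _ m])
    then show ?thesis by (rule tendsto_eventually)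
  next
    case False
    moreover have "J j \<subseteq> {0<..<1}" for j unfolding J_def by (rule inverse_Suc_interval)
    ultimately have "r \<notin> J j" for j by blast
    then show ?thesis using False by simp
  qed
qed

lemma Lipschitz_imp_absolutely_continuous:
  assumes "\<And>x y. x \<in> S \<Longrightarrow> y \<in> S \<Longrightarrow> \<bar>u x - u y\<bar> \<le> L * \<bar>x - y\<bar>"
  shows "absolutely_continuous_fun_on S u"
  unfolding absolutely_continuous_fun_on_iff
proof (intro allI impI)
  fix \<epsilon> :: real assume "\<epsilon> > 0"
  define K where "K = max L 0 + 1"
  have K: "K > 0" by (simp add: K_def)
  have "ac_modulus S u \<epsilon> (\<epsilon> / K)"
    unfolding ac_modulus_def
  proof (intro conjI allI impI)
    fix m :: nat and a b :: "nat \<Rightarrow> real"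
    assume h: "nonoverlapping {..<m} a b" "\<forall>i<m. {a i..b i} \<subseteq> S" "(\<Sum>i<m. b i - a i) < \<epsilon> / K"
    have "(\<Sum>i<m. \<bar>u (b i) - u (a i)\<bar>) \<le> (\<Sum>i<m. K * (b i - a i))"
    proof (rule sum_mono)
      fix i assume "i \<in> {..<m}"
      then have "a i \<le> b i" "{a i..b i} \<subseteq> S" using h by (auto simp: nonoverlapping_def)
      then have i: "a i \<le> b i" "a i \<in> S" "b i \<in> S" by auto
      have "\<bar>u (b i) - u (a i)\<bar> \<le> L * (b i - a i)" using assms[OF i(3,2)] i(1) by simp
      also have "\<dots> \<le> K * (b i - a i)" using i(1) by (intro mult_right_mono) (auto simp: K_def)
      finally show "\<bar>u (b i) - u (a i)\<bar> \<le> K * (b i - a i)" .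
    qed
    also have "\<dots> = K * (\<Sum>i<m. b i - a i)" by (simp add: sum_distrib_left)
    also have "\<dots> < \<epsilon>" using h(3) K by (simp add: field_simps)
    finally show "(\<Sum>i<m. \<bar>u (b i) - u (a i)\<bar>) < \<epsilon>" .
  qed (use K \<open>\<epsilon> > 0\<close> in simp)
  then show "\<exists>\<delta>. ac_modulus S u \<epsilon> \<delta>" ..
qed

text \<open>By the fundamental theorem of calculus the increment is the integral of the derivative. If \<open>M < 0\<close>
  and \<open>x < y\<close> the hypothesis is contradictory.\<close>
lemma bounded_deriv_imp_Lipschitz:
  assumes ac: "absolutely_continuous_fun_on {x..y} u" and xy: "x \<le> y"
    and b: "AE r\<in>{x<..<y} in lebesgue. \<bar>deriv u r\<bar> \<le> M"
  shows "\<bar>u y - u x\<bar> \<le> M * (y - x)"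
proof -
  obtain N where N: "N \<in> null_sets lebesgue" "{r. \<not> (r \<in> {x<..<y} \<longrightarrow> \<bar>deriv u r\<bar> \<le> M)} \<subseteq> N"
  proof -
    have "\<exists>N. N \<in> null_sets lebesgue \<and> {r. \<not> (r \<in> {x<..<y} \<longrightarrow> \<bar>deriv u r\<bar> \<le> M)} \<subseteq> N"
      using b unfolding eventually_ae_filter by auto
    then show thesis using that by blast
  qed
  define h where "h r = (if r \<in> N \<union> {x, y} then 0 else deriv u r)" for r
  have neg: "negligible (N \<union> {x, y})" using N(1) by (auto simp: negligible_iff_null_sets[symmetric])
  have "(h has_integral (u y - u x)) {x..y}"
    by (rule has_integral_spike[OF neg _ absolutely_continuous_FTC(3)[OF ac xy]]) (simp add: h_def)
  moreover have "\<bar>h r\<bar> \<le> max M 0" if "r \<in> {x..y}" for r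
  proof (cases "r \<in> N \<union> {x, y}")
    case False
    then have "\<bar>deriv u r\<bar> \<le> M" using N(2) that by force
    then show ?thesis using False by (simp add: h_def le_max_iff_disj)
  qed (simp add: h_def)
  ultimately have *: "\<bar>u y - u x\<bar> \<le> max M 0 * (y - x)"
    using has_integral_bound[of "max M 0" h "u y - u x" x y] xy by simp
  show ?thesis
  proof (cases "x = y \<or> 0 \<le> M")
    case True then show ?thesis using * by (auto simp: max_def split: if_splits)
  next
    case False
    then have "{x<..<y} \<subseteq> N" using N(2) by force
    then have "negligible {x<..<y}" using N(1) negligible_iff_null_sets negligible_subset by blast
    moreover have "\<not> negligible {x<..<y}"
      using False xy open_not_negligible[of "{x<..<y}"] by auto
    ultimately show ?thesis by blast
  qed
qed

definition primitive :: "(real \<Rightarrow> real) \<Rightarrow> real \<Rightarrow> real" where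
  "primitive f r = (LINT s:{0<..<r}|lebesgue. f s)"

lemma primitive_abs_le:
  assumes "set_integrable lebesgue {0<..<1} f" "r \<le> 1"
  shows "\<bar>primitive f r\<bar> \<le> (LINT s:{0<..<1}|lebesgue. \<bar>f s\<bar>)"
proof -
  have fr: "set_integrable lebesgue {0<..<r} f"
    using assms by (intro set_integrable_subset[OF assms(1)]) auto
  have "\<bar>primitive f r\<bar> \<le> (LINT s:{0<..<r}|lebesgue. \<bar>f s\<bar>)"
    unfolding primitive_def using set_integral_norm_bound[OF fr] by simp
  also have "\<dots> \<le> (LINT s:{0<..<1}|lebesgue. \<bar>f s\<bar>)"
    unfolding set_lebesgue_integral_def
    using assms(2) set_integrable_abs[OF assms(1)] set_integrable_abs[OF fr]
    by (intro integral_mono) (auto simp: set_integrable_def indicator_def)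
  finally show ?thesis .
qed

lemma primitive_eq_integral:
  assumes "set_integrable lebesgue {0<..<1} f" "r \<le> 1"
  shows "f integrable_on {0..r}" "primitive f r = integral {0..r} f"
proof -
  have fr: "set_integrable lebesgue {0<..<r} f"
    using assms by (intro set_integrable_subset[OF assms(1)]) auto
  show "f integrable_on {0..r}" "primitive f r = integral {0..r} f"
    using set_lebesgue_integral_eq_integral[OF fr]
    by (auto simp: primitive_def integrable_on_open_interval_real integral_open_interval_real)
qed

lemma DERIV_primitive:
  assumes int: "set_integrable lebesgue {0<..<1} f" and cont: "continuous_on {0<..<1} f"
    and r: "r \<in> {0<..<1}"
  shows "(primitive f has_real_derivative f r) (at r)"
proof -
  define a b where "a = r / 2" and "b = (r + 1) / 2"
  have ab: "0 < a" "a < r" "r < b" "b < 1" using r by (auto simp: a_def b_def)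
  have "continuous_on {a..b} f"
    using ab by (intro continuous_on_subset[OF cont]) auto
  then have "((\<lambda>x. integral {a..x} f) has_real_derivative f r) (at r within {a..b})"
    using ab by (intro integral_has_real_derivative) auto
  then have "((\<lambda>x. integral {a..x} f) has_real_derivative f r) (at r)"
    using at_within_interior[of r "{a..b}"] ab by simp
  then have "((\<lambda>x. integral {0..a} f + integral {a..x} f) has_real_derivative f r) (at r)"
    by (auto intro!: derivative_eq_intros)
  then show ?thesis
  proof (rule has_field_derivative_transform_within_open[of _ _ _ "{a<..<b}"])
    fix x assume "x \<in> {a<..<b}"
    then show "integral {0..a} f + integral {a..x} f = primitive f x"
      using ab primitive_eq_integral[OF int, of x]
      by (simp add: Henstock_Kurzweil_Integration.integral_combine)
  qed (use ab in auto)
qed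

text \<open>The integral of an integrable function over shrinking intervals tends to \<open>0\<close>.\<close>
lemma primitive_tendsto_0:
  assumes int: "set_integrable lebesgue {0<..<1} f"
    and e: "\<And>j. 0 < e j" "\<And>j. e j \<le> 1" "e \<longlonglongrightarrow> 0"
  shows "(\<lambda>j. primitive f (e j)) \<longlonglongrightarrow> 0"
proof -
  have "(\<lambda>j. integral\<^sup>L lebesgue (\<lambda>s. indicator {0<..<e j} s *\<^sub>R f s)) \<longlonglongrightarrow> integral\<^sup>L lebesgue (\<lambda>s :: real. 0 :: real)"
  proof (rule integral_dominated_convergence[where w = "\<lambda>s. norm (indicator {0<..<1} s *\<^sub>R f s)"
        and s = "\<lambda>j s. indicator {0<..<e j} s *\<^sub>R f s" and f = "\<lambda>s. 0"])
    show "integrable lebesgue (\<lambda>s. norm (indicator {0<..<1} s *\<^sub>R f s))"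
      using int unfolding set_integrable_def by (rule integrable_norm)
    show "(\<lambda>s. indicator {0<..<e j} s *\<^sub>R f s) \<in> borel_measurable lebesgue" for j
    proof -
      have "set_integrable lebesgue {0<..<e j} f"
        using e(2)[of j] by (intro set_integrable_subset[OF int]) auto
      then show ?thesis unfolding set_integrable_def by (rule borel_measurable_integrable)
    qed
    show "AE s in lebesgue. norm (indicator {0<..<e j} s *\<^sub>R f s) \<le> norm (indicator {0<..<1} s *\<^sub>R f s)" for j
      using e(2)[of j] by (intro AE_I2) (auto simp: indicator_def)
    show "AE s in lebesgue. (\<lambda>j. indicator {0<..<e j} s *\<^sub>R f s) \<longlonglongrightarrow> 0"
    proof (rule AE_I2)
      fix s
      have "eventually (\<lambda>j. indicator {0<..<e j} s *\<^sub>R f s = 0) sequentially"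
      proof (cases "s > 0")
        case True
        then have "eventually (\<lambda>j. e j < s) sequentially" using order_tendstoD(2)[OF e(3)] by blast
        then show ?thesis by eventually_elim auto
      qed auto
      then show "(\<lambda>j. indicator {0<..<e j} s *\<^sub>R f s) \<longlonglongrightarrow> 0" by (rule tendsto_eventually)
    qed
  qed auto
  then show ?thesis by (simp add: primitive_def set_lebesgue_integral_def)
qed

section \<open>From the weak equation to the integral equation\<close>

lemma set_integrable_times_continuous:
  fixes p z :: "real \<Rightarrow> real"
  assumes p: "set_integrable lebesgue {0<..<1} p" and z: "continuous_on {0..1} z"
  shows "set_integrable lebesgue {0<..<1} (\<lambda>r. p r * z r)"
proof -
  have "bounded (z ` {0..1})" using z by (intro compact_imp_bounded compact_continuous_image) auto
  then obtain C where "\<forall>y\<in>z ` {0..1}. norm y \<le> C" unfolding bounded_iff by blast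
  then have C: "\<bar>z r\<bar> \<le> C" if "r \<in> {0..1}" for r using that by auto
  have "set_borel_measurable lebesgue {0<..<1} p"
    by (rule set_integrable_imp_set_borel_measurable[OF p])
  moreover have "set_borel_measurable lebesgue {0<..<1} z"
    by (intro set_borel_measurable_continuous_on continuous_on_subset[OF z]) auto
  ultimately have pz: "set_borel_measurable lebesgue {0<..<1} (\<lambda>r. p r * z r)"
    by (auto simp: set_borel_measurable_iff_lebesgue_on)
  have "set_integrable lebesgue {0<..<1} (\<lambda>r. C * p r)" using p by simp
  then show ?thesis
  proof (rule set_integrable_bound[OF _ pz])
    show "AE r\<in>{0<..<1} in lebesgue. norm (p r * z r) \<le> norm (C * p r)"
    proof (intro AE_I2 impI)
      fix r :: real assume "r \<in> {0<..<1}"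
      then have "\<bar>z r\<bar> \<le> \<bar>C\<bar>" using C[of r] by auto
      from mult_right_mono[OF this, of "\<bar>p r\<bar>"]
      show "norm (p r * z r) \<le> norm (C * p r)"
        by (simp add: abs_mult mult.commute)
    qed
  qed
qed

text \<open>The indefinite integral is constant, so its derivative, which is \<open>q\<close> almost everywhere, is zero.\<close>
lemma AE_zero_if_zero_interval_integrals:
  fixes q :: "real \<Rightarrow> real"
  assumes int: "set_integrable lebesgue {0<..<1} q"
    and zero: "\<And>a b. 0 \<le> a \<Longrightarrow> a < b \<Longrightarrow> b \<le> 1 \<Longrightarrow> (LINT r:{a<..<b}|lebesgue. q r) = 0"
  shows "AE r\<in>{0<..<1} in lebesgue. q r = 0"
proof -
  define q0 where "q0 r = (if r \<in> {0<..<1} then q r else 0)" for r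
  have "(q0 has_integral ((\<lambda>_. 0) y - (\<lambda>_. 0) x)) {x..y}" if "x \<le> y" for x y :: real
  proof -
    define a b where "a = max 0 x" and "b = min 1 y"
    have ab: "0 \<le> a" "b \<le> 1" by (auto simp: a_def b_def)
    have "(q has_integral 0) {a<..<b}"
    proof (cases "a < b")
      case True
      have "set_integrable lebesgue {a<..<b} q"
        using ab by (intro set_integrable_subset[OF int]) auto
      then show ?thesis using has_integral_set_lebesgue[of "{a<..<b}" q] zero[OF ab(1) True ab(2)] by simp
    qed auto
    then have "((\<lambda>r. if r \<in> {a<..<b} then q r else 0) has_integral 0) UNIV"
      by (simp only: has_integral_restrict_UNIV)
    then have "((\<lambda>r. if r \<in> {x..y} then q0 r else 0) has_integral 0) UNIV"
    proof (rule has_integral_spike[of "{x, y}", rotated -1])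
      show "(if r \<in> {x..y} then q0 r else 0) = (if r \<in> {a<..<b} then q r else 0)" if "r \<in> UNIV - {x, y}" for r
        using that by (auto simp: q0_def a_def b_def)
    qed auto
    then show ?thesis by (simp only: has_integral_restrict_UNIV) simp
  qed
  then have "AE r in lebesgue. ((\<lambda>_. 0) has_real_derivative q0 r) (at r)"
    by (rule indefinite_integral_has_derivative_AE)
  then show ?thesis
  proof eventually_elim
    case (elim r)
    then have "q0 r = 0" using DERIV_unique[OF elim DERIV_const] by simp
    then show ?case by (auto simp: q0_def split: if_splits)
  qed
qed

text \<open>For \<open>0 \<le> r \<le> 1\<close> this is the integral of \<open>\<psi>\<close> over \<open>(r, 1)\<close>. Written as a difference it also
  vanishes for \<open>r > 1\<close> when \<open>\<psi>\<close> is supported in the unit interval, so that it defines a radial function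
  on the whole space.\<close>
definition tail_integral :: "(real \<Rightarrow> real) \<Rightarrow> real \<Rightarrow> real" where
  "tail_integral \<psi> r = integral {0..1} \<psi> - integral {0..r} \<psi>"

lemma tail_integral:
  fixes \<psi> :: "real \<Rightarrow> real"
  assumes \<psi>: "continuous_on UNIV \<psi>" and supp: "\<And>r. r \<notin> {\<alpha><..<\<beta>} \<Longrightarrow> \<psi> r = 0"
    and ab: "0 < \<alpha>" "\<beta> < 1"
  shows "\<And>r. 0 < r \<Longrightarrow> (tail_integral \<psi> has_real_derivative - \<psi> r) (at r)"
    and "\<And>r. 0 \<le> r \<Longrightarrow> r \<le> \<alpha> \<Longrightarrow> tail_integral \<psi> r = tail_integral \<psi> 0"
    and "\<And>r. 0 \<le> r \<Longrightarrow> \<beta> \<le> r \<Longrightarrow> tail_integral \<psi> r = 0"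
    and "continuous_on {0..1} (tail_integral \<psi>)"
proof -
  have int: "\<psi> integrable_on {x..y}" for x y
    using \<psi> by (intro integrable_continuous_real continuous_on_subset[OF \<psi>]) auto
  show "(tail_integral \<psi> has_real_derivative - \<psi> r) (at r)" if "0 < r" for r
  proof -
    have "((\<lambda>x. integral {0..x} \<psi>) has_real_derivative \<psi> r) (at r within {0..r + 1})"
      using that by (intro integral_has_real_derivative continuous_on_subset[OF \<psi>]) auto
    then have "((\<lambda>x. integral {0..x} \<psi>) has_real_derivative \<psi> r) (at r)"
      using at_within_interior[of r "{0..r + 1}"] that by simp
    then show ?thesis unfolding tail_integral_def[abs_def] by (auto intro!: derivative_eq_intros)
  qed
  show "tail_integral \<psi> r = tail_integral \<psi> 0" if "0 \<le> r" "r \<le> \<alpha>" for r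
  proof -
    have "integral {0..r} \<psi> = integral {0..r} (\<lambda>_. 0)"
      using that by (intro Henstock_Kurzweil_Integration.integral_cong supp) auto
    then show ?thesis by (simp add: tail_integral_def[abs_def])
  qed
  show "tail_integral \<psi> r = 0" if "0 \<le> r" "\<beta> \<le> r" for r
  proof -
    have z: "integral {x..y} \<psi> = 0" if "\<beta> \<le> x" for x y
    proof -
      have "integral {x..y} \<psi> = integral {x..y} (\<lambda>_. 0)"
        using that by (intro Henstock_Kurzweil_Integration.integral_cong supp) auto
      then show ?thesis by simp
    qed
    show ?thesis
    proof (cases "r \<le> 1")
      case True
      then have "integral {0..r} \<psi> + integral {r..1} \<psi> = integral {0..1} \<psi>"
        using that int by (intro Henstock_Kurzweil_Integration.integral_combine) auto
      then show ?thesis using z[OF that(2), of 1] by (simp add: tail_integral_def[abs_def])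
    next
      case False
      then have "integral {0..1} \<psi> + integral {1..r} \<psi> = integral {0..r} \<psi>"
        using that int by (intro Henstock_Kurzweil_Integration.integral_combine) auto
      then show ?thesis using z[of 1 r] ab by (simp add: tail_integral_def[abs_def])
    qed
  qed
  show "continuous_on {0..1} (tail_integral \<psi>)"
    unfolding tail_integral_def[abs_def] by (intro continuous_intros indefinite_integral_continuous_1 int)
qed

lemma set_integrable_primitive:
  assumes int: "set_integrable lebesgue {0<..<1} f" and cont: "continuous_on {0<..<1} f"
  shows "set_integrable lebesgue {0<..<1} (primitive f)"
proof -
  have Gc: "continuous_on {0<..<1} (primitive f)"
    using DERIV_primitive[OF int cont] by (meson DERIV_isCont continuous_at_imp_continuous_on)
  show ?thesis
  proof (rule set_integrable_bounded)
    show "set_borel_measurable lebesgue {0<..<1} (primitive f)"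
      using Gc by (intro set_borel_measurable_continuous_on) auto
    show "AE r\<in>{0<..<1} in lebesgue. norm (primitive f r) \<le> (LINT s:{0<..<1}|lebesgue. \<bar>f s\<bar>)"
      using primitive_abs_le[OF int] by (intro AE_I2) auto
  qed auto
qed

text \<open>The derivative of \<open>G \<phi>\<close> is \<open>f \<phi> - G \<psi>\<close>. Near \<open>0\<close>, where \<open>f\<close> need not be continuous, \<open>\<phi>\<close> is
  constant and the integral of \<open>f \<phi>\<close> is known directly, so no limit at the origin is needed.\<close>
lemma primitive_by_parts:
  fixes f \<psi> :: "real \<Rightarrow> real"
  assumes int: "set_integrable lebesgue {0<..<1} f" and cont: "continuous_on {0<..<1} f"
    and \<psi>: "continuous_on UNIV \<psi>" and supp: "\<And>r. r \<notin> {\<alpha><..<\<beta>} \<Longrightarrow> \<psi> r = 0"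
    and ab: "0 < \<alpha>" "\<alpha> \<le> \<beta>" "\<beta> < 1"
  defines "\<phi> \<equiv> tail_integral \<psi>"
  shows "set_integrable lebesgue {0<..<1} (\<lambda>r. f r * \<phi> r)"
    and "set_integrable lebesgue {0<..<1} (\<lambda>r. primitive f r * \<psi> r)"
    and "(LINT r:{0<..<1}|lebesgue. f r * \<phi> r) = (LINT r:{0<..<1}|lebesgue. primitive f r * \<psi> r)"
proof -
  note tail = tail_integral[OF \<psi> supp ab(1,3), folded \<phi>_def]
  have DG: "(primitive f has_real_derivative f r) (at r)" if "r \<in> {0<..<1}" for r
    by (rule DERIV_primitive[OF int cont that])
  show I1: "set_integrable lebesgue {0<..<1} (\<lambda>r. f r * \<phi> r)"
    by (rule set_integrable_times_continuous[OF int tail(4)])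
  have Gi: "set_integrable lebesgue {0<..<1} (primitive f)"
    by (rule set_integrable_primitive[OF int cont])
  show I2: "set_integrable lebesgue {0<..<1} (\<lambda>r. primitive f r * \<psi> r)"
    by (rule set_integrable_times_continuous[OF Gi continuous_on_subset[OF \<psi>]]) simp
  define D where "D r = f r * \<phi> r - primitive f r * \<psi> r" for r
  have "(D has_integral \<phi> 0 * primitive f \<alpha>) {0..\<alpha>}"
  proof (rule has_integral_eq[rotated])
    have "(f has_integral primitive f \<alpha>) {0..\<alpha>}"
      using primitive_eq_integral[OF int, of \<alpha>] ab by (auto intro: integrable_integral)
    then show "((\<lambda>r. \<phi> 0 * f r) has_integral \<phi> 0 * primitive f \<alpha>) {0..\<alpha>}"
      by (rule has_integral_mult_right)
    show "\<phi> 0 * f r = D r" if "r \<in> {0..\<alpha>}" for r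
      using tail(2)[of r] supp[of r] that by (simp add: D_def)
  qed
  moreover have "(D has_integral (primitive f \<beta> * \<phi> \<beta> - primitive f \<alpha> * \<phi> \<alpha>)) {\<alpha>..\<beta>}"
  proof (rule fundamental_theorem_of_calculus[OF ab(2)])
    fix r assume "r \<in> {\<alpha>..\<beta>}"
    then have r: "0 < r" "r < 1" using ab by auto
    have "((\<lambda>r. primitive f r * \<phi> r) has_real_derivative D r) (at r)"
      using DG[of r] tail(1)[of r] r by (auto intro!: derivative_eq_intros simp: D_def)
    then show "((\<lambda>r. primitive f r * \<phi> r) has_vector_derivative D r) (at r within {\<alpha>..\<beta>})"
      by (simp add: has_real_derivative_iff_has_vector_derivative has_vector_derivative_at_within)
  qed
  ultimately have "(D has_integral 0) {0..\<beta>}"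
    using has_integral_combine[of 0 \<alpha> \<beta> D "\<phi> 0 * primitive f \<alpha>"
        "primitive f \<beta> * \<phi> \<beta> - primitive f \<alpha> * \<phi> \<alpha>"] ab tail(2)[of \<alpha>] tail(3)[of \<beta>]
    by simp
  moreover have "(D has_integral 0) {\<beta>..1}"
    using ab tail(3) supp by (intro has_integral_is_0) (auto simp: D_def)
  ultimately have "(D has_integral 0) {0..1}"
    using has_integral_combine[of 0 \<beta> 1 D 0 0] ab by simp
  then have "(D has_integral 0) {0<..<1}"
    by (simp add: has_integral_Icc_iff_Ioo)
  moreover have "set_integrable lebesgue {0<..<1} D"
    unfolding D_def by (rule set_integral_diff(1)[OF I1 I2])
  ultimately have "(LINT r:{0<..<1}|lebesgue. D r) = 0"
    using set_lebesgue_integral_eq_integral(2) integral_unique by metis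
  then show "(LINT r:{0<..<1}|lebesgue. f r * \<phi> r) = (LINT r:{0<..<1}|lebesgue. primitive f r * \<psi> r)"
    unfolding D_def by (simp add: set_integral_diff(2)[OF I1 I2])
qed

text \<open>The lemma of du Bois-Reymond in a form without a free constant: there is no condition on the mean
  of \<open>\<psi>\<close>, because the profile may take any value at \<open>0\<close>. Trapezoidal \<open>\<psi>\<close> increasing to an indicator
  function show that \<open>w - G\<close> has integral zero over every interval.\<close>
lemma weak_primitive_AE_eq:
  fixes w f :: "real \<Rightarrow> real"
  assumes w: "set_integrable lebesgue {0<..<1} w"
    and int: "set_integrable lebesgue {0<..<1} f" and cont: "continuous_on {0<..<1} f"
    and weak: "\<And>\<psi> \<alpha> \<beta>. 0 < \<alpha> \<Longrightarrow> \<beta> < 1 \<Longrightarrow> continuous_on UNIV \<psi> \<Longrightarrow>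
      (\<And>r. r \<notin> {\<alpha><..<\<beta>} \<Longrightarrow> \<psi> r = 0) \<Longrightarrow>
      (LINT r:{0<..<1}|lebesgue. w r * \<psi> r) =
      (LINT r:{0<..<1}|lebesgue. f r * tail_integral \<psi> r)"
  shows "AE r\<in>{0<..<1} in lebesgue. w r = primitive f r"
proof -
  define q where "q r = w r - primitive f r" for r
  have Gi: "set_integrable lebesgue {0<..<1} (primitive f)"
    by (rule set_integrable_primitive[OF int cont])
  have qi: "set_integrable lebesgue {0<..<1} q"
    unfolding q_def by (rule set_integral_diff(1)[OF w Gi])
  have "(LINT r:{a<..<b}|lebesgue. q r) = 0" if ab: "0 \<le> a" "a < b" "b \<le> 1" for a b
  proof -
    \<comment> \<open>The shift by 1 keeps the support at distance 1/(j+1) from a and b, hence inside the unit interval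
      even if a = 0 or b = 1.\<close>
    define \<psi> where "\<psi> j r = max 0 (min 1 (real (Suc j) * min (r - a) (b - r) - 1))" for j r
    have \<psi>c: "continuous_on UNIV (\<psi> j)" for j
      unfolding \<psi>_def by (intro continuous_intros)
    have \<psi>01: "0 \<le> \<psi> j r" "\<psi> j r \<le> 1" for j r by (auto simp: \<psi>_def)
    have \<psi>0: "\<psi> j r = 0" if "r \<notin> {a + inverse (real (Suc j))<..<b - inverse (real (Suc j))}" for j r
    proof -
      have "min (r - a) (b - r) \<le> inverse (real (Suc j))"
        using that by (auto simp del: of_nat_Suc)
      then have "real (Suc j) * min (r - a) (b - r) \<le> real (Suc j) * inverse (real (Suc j))"
        by (intro mult_left_mono) auto
      then have "real (Suc j) * min (r - a) (b - r) - 1 \<le> 0" by simp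
      then show ?thesis unfolding \<psi>_def by linarith
    qed
    \<comment> \<open>The hypothesis applies if the supporting interval is nonempty; otherwise the trapezoid vanishes.\<close>
    have zero: "(LINT r:{0<..<1}|lebesgue. q r * \<psi> j r) = 0" for j
    proof (cases "a + inverse (real (Suc j)) \<le> b - inverse (real (Suc j))")
      case True
      have pos: "0 < a + inverse (real (Suc j))" using ab by (simp add: add_nonneg_pos)
      have lt: "b - inverse (real (Suc j)) < 1"
      proof -
        have "0 < inverse (real (Suc j))" by simp
        then show ?thesis using ab by linarith
      qed
      have p: "set_integrable lebesgue {0<..<1} (\<lambda>r. primitive f r * \<psi> j r)"
        "(LINT r:{0<..<1}|lebesgue. f r * tail_integral (\<psi> j) r) =
          (LINT r:{0<..<1}|lebesgue. primitive f r * \<psi> j r)"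
        using primitive_by_parts[OF int cont \<psi>c \<psi>0 pos True lt] by blast+
      have wi: "set_integrable lebesgue {0<..<1} (\<lambda>r. w r * \<psi> j r)"
        by (rule set_integrable_times_continuous[OF w continuous_on_subset[OF \<psi>c]]) simp
      have "(LINT r:{0<..<1}|lebesgue. w r * \<psi> j r) = (LINT r:{0<..<1}|lebesgue. primitive f r * \<psi> j r)"
        using weak[OF pos lt \<psi>c \<psi>0] p(2) by simp
      then show ?thesis
        unfolding q_def left_diff_distrib by (simp add: set_integral_diff(2)[OF wi p(1)])
    next
      case False
      then have "\<psi> j r = 0" for r by (intro \<psi>0) auto
      then show ?thesis by (simp add: set_lebesgue_integral_def)
    qed
    have "(\<lambda>j. integral\<^sup>L lebesgue (\<lambda>r. indicator {0<..<1} r *\<^sub>R (q r * \<psi> j r))) \<longlonglongrightarrow>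
        integral\<^sup>L lebesgue (\<lambda>r. indicator {a<..<b} r *\<^sub>R q r)"
    proof (rule integral_dominated_convergence)
      have "set_integrable lebesgue {a<..<b} q"
        using ab by (intro set_integrable_subset[OF qi]) auto
      then show "(\<lambda>r. indicator {a<..<b} r *\<^sub>R q r) \<in> borel_measurable lebesgue"
        unfolding set_integrable_def by (rule borel_measurable_integrable)
      show "(\<lambda>r. indicator {0<..<1} r *\<^sub>R (q r * \<psi> j r)) \<in> borel_measurable lebesgue" for j
      proof -
        have "set_integrable lebesgue {0<..<1} (\<lambda>r. q r * \<psi> j r)"
          by (rule set_integrable_times_continuous[OF qi continuous_on_subset[OF \<psi>c]]) simp
        then show ?thesis unfolding set_integrable_def by (rule borel_measurable_integrable)
      qed
      show "integrable lebesgue (\<lambda>r. norm (indicator {0<..<1} r *\<^sub>R q r))"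
        using qi unfolding set_integrable_def by (rule integrable_norm)
      show "AE r in lebesgue. norm (indicator {0<..<1} r *\<^sub>R (q r * \<psi> j r)) \<le> norm (indicator {0<..<1} r *\<^sub>R q r)" for j
      proof (rule AE_I2)
        fix r
        show "norm (indicator {0<..<1} r *\<^sub>R (q r * \<psi> j r)) \<le> norm (indicator {0<..<1} r *\<^sub>R q r)"
          using mult_left_mono[of "\<psi> j r" 1 "\<bar>q r\<bar>"] \<psi>01[of j r] by (auto simp: abs_mult indicator_def)
      qed
      show "AE r in lebesgue. (\<lambda>j. indicator {0<..<1} r *\<^sub>R (q r * \<psi> j r)) \<longlonglongrightarrow> indicator {a<..<b} r *\<^sub>R q r"
      proof (rule AE_I2)
        fix r
        have "eventually (\<lambda>j. indicator {0<..<1} r *\<^sub>R (q r * \<psi> j r) = indicator {a<..<b} r *\<^sub>R q r) sequentially"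
        proof (cases "r \<in> {a<..<b}")
          case True
          define m where "m = min (r - a) (b - r)"
          have m: "m > 0" using True by (auto simp: m_def)
          obtain N :: nat where N: "2 / m < real N" using reals_Archimedean2 by blast
          have "\<psi> j r = 1" if "N \<le> j" for j
          proof -
            have "2 / m < real (Suc j)" using N that by linarith
            then have "2 < real (Suc j) * m" using m by (simp add: pos_divide_less_eq)
            then have "1 \<le> real (Suc j) * m - 1" by simp
            then show ?thesis unfolding \<psi>_def m_def[symmetric] by (simp add: min_absorb1)
          qed
          then show ?thesis using True ab by (auto simp: eventually_sequentially intro!: exI[of _ N])
        next
          case False
          have "\<psi> j r = 0" for j
          proof (rule \<psi>0)
            have "0 < inverse (real (Suc j))" by simp
            then show "r \<notin> {a + inverse (real (Suc j))<..<b - inverse (real (Suc j))}"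
              using False unfolding greaterThanLessThan_iff by linarith
          qed
          then show ?thesis using False by simp
        qed
        then show "(\<lambda>j. indicator {0<..<1} r *\<^sub>R (q r * \<psi> j r)) \<longlonglongrightarrow> indicator {a<..<b} r *\<^sub>R q r"
          by (rule tendsto_eventually)
      qed
    qed
    moreover have "integral\<^sup>L lebesgue (\<lambda>r. indicator {0<..<1} r *\<^sub>R (q r * \<psi> j r)) = 0" for j
      using zero[of j] by (simp only: set_lebesgue_integral_def)
    ultimately have "(\<lambda>j :: nat. 0) \<longlonglongrightarrow> integral\<^sup>L lebesgue (\<lambda>r. indicator {a<..<b} r *\<^sub>R q r)"
      by simp
    then show ?thesis unfolding set_lebesgue_integral_def by (simp only: LIMSEQ_const_iff)
  qed
  then have "AE r\<in>{0<..<1} in lebesgue. q r = 0"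
    by (rule AE_zero_if_zero_interval_integrals[OF qi])
  then show ?thesis by eventually_elim (simp add: q_def)
qed

text \<open>The profile is constant near \<open>0\<close>, so the singularity of the norm at the origin does no harm.\<close>
lemma radial_test_function:
  fixes \<psi> :: "real \<Rightarrow> real"
  assumes \<psi>: "continuous_on UNIV \<psi>" and supp: "\<And>r. r \<notin> {\<alpha><..<\<beta>} \<Longrightarrow> \<psi> r = 0"
    and ab: "0 < \<alpha>" "\<beta> < 1"
  defines "\<phi> \<equiv> tail_integral \<psi>"
  shows "(\<lambda>x::'a::euclidean_space. \<phi> (norm x)) \<in> Cc1 (ball 0 1)"
    and "grad (\<lambda>x::'a. \<phi> (norm x)) = (\<lambda>x. - \<psi> (norm x) *\<^sub>R sgn x)"
proof -
  note tail = tail_integral[OF \<psi> supp ab, folded \<phi>_def]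
  have D: "GDERIV (\<lambda>x. \<phi> (norm x)) x :> - \<psi> (norm x) *\<^sub>R sgn x" for x :: 'a
  proof (cases "x = 0")
    case True
    have "((\<lambda>x::'a. \<phi> (norm x)) has_derivative (\<lambda>h. 0)) (at x)"
    proof (rule has_derivative_transform_within_open[where f = "\<lambda>_. \<phi> 0"])
      show "open (ball 0 \<alpha> :: 'a set)" by simp
      show "\<phi> 0 = \<phi> (norm y)" if "y \<in> ball 0 \<alpha>" for y :: 'a
        using tail(2)[of "norm y"] that by simp
    qed (use True ab in auto)
    then show ?thesis using True by (simp add: gderiv_def)
  next
    case False
    then show ?thesis
      using tail(1)[of "norm x"] by (intro GDERIV_DERIV_compose GDERIV_norm) auto
  qed
  then show g: "grad (\<lambda>x::'a. \<phi> (norm x)) = (\<lambda>x. - \<psi> (norm x) *\<^sub>R sgn x)"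
    by (intro ext grad_eqI)
  \<comment> \<open>Below \<alpha> both sides vanish; the right-hand side is visibly continuous at the origin.\<close>
  have "(\<lambda>x::'a. - \<psi> (norm x) *\<^sub>R sgn x) = (\<lambda>x. (- \<psi> (norm x) / max \<alpha> (norm x)) *\<^sub>R x)"
  proof
    fix x :: 'a
    show "- \<psi> (norm x) *\<^sub>R sgn x = (- \<psi> (norm x) / max \<alpha> (norm x)) *\<^sub>R x"
      using supp[of "norm x"] by (cases "\<alpha> < norm x") (auto simp: sgn_div_norm divide_inverse)
  qed
  moreover have "continuous_on UNIV (\<lambda>x::'a. (- \<psi> (norm x) / max \<alpha> (norm x)) *\<^sub>R x)"
    using ab by (intro continuous_intros continuous_on_compose2[OF \<psi>]) auto
  ultimately have c: "continuous_on UNIV (grad (\<lambda>x::'a. \<phi> (norm x)))" by (simp add: g)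
  have "compact (cball 0 (max 0 \<beta>) :: 'a set)" "(cball 0 (max 0 \<beta>) :: 'a set) \<subseteq> ball 0 1"
    using ab by auto
  moreover have "\<phi> (norm x) = 0" if "x \<notin> cball 0 (max 0 \<beta>)" for x :: 'a
    using that tail(3)[of "norm x"] by auto
  ultimately show "(\<lambda>x::'a. \<phi> (norm x)) \<in> Cc1 (ball 0 1)"
    using c D unfolding Cc1_def mem_Collect_eq by blast
qed

lemma abs_le_of_abs_power_le:
  fixes x :: real
  assumes "\<bar>x\<bar> ^ k \<le> C" "1 \<le> k"
  shows "\<bar>x\<bar> \<le> max 1 C"
proof (cases "\<bar>x\<bar> \<le> 1")
  case False
  then have "\<bar>x\<bar> ^ 1 \<le> \<bar>x\<bar> ^ k" using assms(2) by (intro power_increasing) auto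
  then show ?thesis using assms(1) by simp
qed simp

lemma abs_power_le_Suc:
  fixes x :: real
  assumes "j \<le> k"
  shows "\<bar>x\<bar> ^ j \<le> 1 + \<bar>x ^ k\<bar>"
proof (cases "\<bar>x\<bar> \<le> 1")
  case True
  then have "\<bar>x\<bar> ^ j \<le> 1" by (intro power_le_one) auto
  then show ?thesis by (smt (verit) abs_ge_zero)
next
  case False
  then have "\<bar>x\<bar> ^ j \<le> \<bar>x\<bar> ^ k" using assms by (intro power_increasing) auto
  then show ?thesis by (simp add: power_abs)
qed

text \<open>The energy controls the lower powers of the derivative. With \<open>p = n - k\<close> this covers the flux
  (\<open>j = k\<close>, \<open>q = n - k\<close>) and the gradient itself (\<open>j = 1\<close>, \<open>q = n - 1\<close>); the weight \<open>r\<^sup>p\<close> is bounded,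
  so the constant \<open>1\<close> in \<open>|x|\<^sup>j \<le> 1 + |x|\<^sup>k\<^sup>+\<^sup>1\<close> is harmless.\<close>
lemma set_integrable_flux_density:
  fixes u :: "real \<Rightarrow> real"
  assumes m: "set_borel_measurable lebesgue {0<..<1} (deriv u)" and "j \<le> k + 1" "p \<le> q"
    and e: "set_integrable lebesgue {0<..<1} (\<lambda>r. r ^ p * deriv u r ^ (k + 1))"
  shows "set_integrable lebesgue {0<..<1} (\<lambda>r. r ^ q * deriv u r ^ j)"
proof (rule set_integrable_bound)
  show "set_integrable lebesgue {0<..<1} (\<lambda>r. 1 + \<bar>r ^ p * deriv u r ^ (k + 1)\<bar>)"
  proof (rule set_integral_add(1))
    show "set_integrable lebesgue {0<..<1} (\<lambda>r :: real. 1 :: real)" by simp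
    show "set_integrable lebesgue {0<..<1} (\<lambda>r. \<bar>r ^ p * deriv u r ^ (k + 1)\<bar>)"
      by (rule set_integrable_abs[OF e])
  qed
  have p: "(\<lambda>r :: real. r ^ q) \<in> borel_measurable (lebesgue_on {0<..<1})"
    by (intro measurable_restrict_space1 measurable_completion) measurable
  have d: "deriv u \<in> borel_measurable (lebesgue_on {0<..<1})"
    using m by (simp add: set_borel_measurable_iff_lebesgue_on)
  have "(\<lambda>r. r ^ q * deriv u r ^ j) \<in> borel_measurable (lebesgue_on {0<..<1})"
    by (intro borel_measurable_times borel_measurable_power p d)
  then show "set_borel_measurable lebesgue {0<..<1} (\<lambda>r. r ^ q * deriv u r ^ j)"
    by (simp add: set_borel_measurable_iff_lebesgue_on)
  show "AE r\<in>{0<..<1} in lebesgue. norm (r ^ q * deriv u r ^ j) \<le> norm (1 + \<bar>r ^ p * deriv u r ^ (k + 1)\<bar>)"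
  proof (intro AE_I2 impI)
    fix r :: real assume r: "r \<in> {0<..<1}"
    have qp: "r ^ q \<le> r ^ p" using r \<open>p \<le> q\<close> by (intro power_decreasing) auto
    have p1: "r ^ p \<le> 1" using r by (intro power_le_one) auto
    have "\<bar>r ^ q * deriv u r ^ j\<bar> = r ^ q * \<bar>deriv u r\<bar> ^ j"
      using r by (simp add: abs_mult power_abs)
    also have "\<dots> \<le> r ^ p * (1 + \<bar>deriv u r ^ (k + 1)\<bar>)"
      using qp r abs_power_le_Suc[OF \<open>j \<le> k + 1\<close>, of "deriv u r"] by (intro mult_mono) auto
    also have "\<dots> = r ^ p + \<bar>r ^ p * deriv u r ^ (k + 1)\<bar>"
      using r by (simp add: algebra_simps abs_mult)
    also have "\<dots> \<le> 1 + \<bar>r ^ p * deriv u r ^ (k + 1)\<bar>" using p1 by simp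
    finally show "norm (r ^ q * deriv u r ^ j) \<le> norm (1 + \<bar>r ^ p * deriv u r ^ (k + 1)\<bar>)" by simp
  qed
qed

lemma c_const_pos: "1 \<le> k \<Longrightarrow> k \<le> n \<Longrightarrow> 0 < c_const n k"
  by (simp add: c_const_def)

lemma energy_density:
  fixes r :: real
  assumes "1 \<le> k" "k \<le> n" "r \<noteq> 0"
  shows "r ^ (n - 1) * (C * (d / r) ^ (k - 1) * d\<^sup>2) = C * (r ^ (n - k) * d ^ (k + 1))"
proof -
  have "n - 1 = (n - k) + (k - 1)" using assms by simp
  then have "r ^ (n - 1) = r ^ (n - k) * r ^ (k - 1)" by (metis power_add)
  moreover have "d ^ (k + 1) = d ^ (k - 1) * d\<^sup>2" using assms by (simp flip: power_add)
  ultimately show ?thesis using assms by (simp add: power_divide)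
qed

lemma flux_density:
  fixes r :: real
  assumes "1 \<le> k" "k \<le> n" "r \<noteq> 0"
  shows "r ^ (n - 1) * ((d / r) ^ k * r) = r ^ (n - k) * d ^ k"
proof -
  have "n - 1 = (n - k) + (k - 1)" using assms by simp
  then have "r ^ (n - 1) = r ^ (n - k) * r ^ (k - 1)" by (metis power_add)
  moreover have "r ^ k = r ^ (k - 1) * r" using assms by (cases k) auto
  ultimately show ?thesis using assms by (simp add: power_divide)
qed

lemma set_integrable_Sk_energy_iff:
  fixes u :: "real \<Rightarrow> real"
  assumes k: "1 \<le> k" "k \<le> CARD('n::finite)" and m: "set_borel_measurable lebesgue {0<..<1} (deriv u)"
  shows "set_integrable lebesgue (ball 0 1) (\<lambda>x::real ^ 'n. Sk_energy k u x) \<longleftrightarrow>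
    set_integrable lebesgue {0<..<1} (\<lambda>r. r ^ (CARD('n) - k) * deriv u r ^ (k + 1))"
proof -
  define C where "C = real k * c_const CARD('n) k"
  have C: "C \<noteq> 0" using k c_const_pos[of k "CARD('n)"] by (simp add: C_def)
  have d: "deriv u \<in> borel_measurable (lebesgue_on {0<..<1})"
    using m by (simp add: set_borel_measurable_iff_lebesgue_on)
  have i: "(\<lambda>r :: real. r) \<in> borel_measurable (lebesgue_on {0<..<1})"
    by (intro measurable_restrict_space1 measurable_completion) measurable
  have "(\<lambda>r. C * (deriv u r / r) ^ (k - 1) * (deriv u r)\<^sup>2) \<in> borel_measurable (lebesgue_on {0<..<1})"
    by (intro borel_measurable_times borel_measurable_power borel_measurable_divide i d) auto
  then have m': "set_borel_measurable lebesgue {0<..<1} (\<lambda>r. C * (deriv u r / r) ^ (k - 1) * (deriv u r)\<^sup>2)"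
    by (simp add: set_borel_measurable_iff_lebesgue_on)
  have "set_integrable lebesgue (ball 0 1) (\<lambda>x::real ^ 'n. Sk_energy k u x) \<longleftrightarrow>
      set_integrable lebesgue {0<..<1} (\<lambda>r. r ^ (CARD('n) - 1) * (C * (deriv u r / r) ^ (k - 1) * (deriv u r)\<^sup>2))"
    using radial_integral(1)[OF m', where 'a = "real ^ 'n"] by (simp add: Sk_energy_def C_def)
  also have "\<dots> \<longleftrightarrow> set_integrable lebesgue {0<..<1} (\<lambda>r. C * (r ^ (CARD('n) - k) * deriv u r ^ (k + 1)))"
    by (intro set_integrable_cong refl energy_density k) auto
  also have "\<dots> \<longleftrightarrow> set_integrable lebesgue {0<..<1} (\<lambda>r. r ^ (CARD('n) - k) * deriv u r ^ (k + 1))"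
    using C by simp
  finally show ?thesis .
qed

text \<open>A function that is Lipschitz near \<open>1\<close> has a limit there, and the extended function obeys the same
  Lipschitz bounds.\<close>
lemma Lipschitz_extension_to_endpoint:
  fixes u :: "real \<Rightarrow> real"
  assumes "\<And>a. 0 < a \<Longrightarrow> a < 1 \<Longrightarrow> \<exists>M. \<forall>x\<in>{a..<1}. \<forall>y\<in>{a..<1}. \<bar>u y - u x\<bar> \<le> M * \<bar>y - x\<bar>"
  obtains l where "locally_absolutely_continuous_on {0<..1} (\<lambda>r. if r < 1 then u r else l)"
proof -
  obtain M0 where M0: "\<And>x y. x \<in> {1/2..<1} \<Longrightarrow> y \<in> {1/2..<1} \<Longrightarrow> \<bar>u y - u x\<bar> \<le> M0 * \<bar>y - x\<bar>"
  proof -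
    have "\<exists>M. \<forall>x\<in>{1/2..<1}. \<forall>y\<in>{1/2..<1}. \<bar>u y - u x\<bar> \<le> M * \<bar>y - x\<bar>"
      by (rule assms) auto
    then show thesis using that by blast
  qed
  have "(max M0 0)-lipschitz_on {1/2..<1} u"
  proof (rule lipschitz_onI)
    fix x y :: real assume xy: "x \<in> {1/2..<1}" "y \<in> {1/2..<1}"
    have "\<bar>u x - u y\<bar> \<le> M0 * \<bar>x - y\<bar>" by (rule M0[OF xy(2,1)])
    also have "\<dots> \<le> max M0 0 * \<bar>x - y\<bar>" by (intro mult_right_mono) auto
    finally show "dist (u x) (u y) \<le> max M0 0 * dist x y" by (simp add: dist_real_def)
  qed simp
  then have "uniformly_continuous_on {1/2..<1} u" by (rule lipschitz_on_uniformly_continuous)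
  moreover have "(1::real) \<in> closure {1/2..<1}" by simp
  ultimately obtain l where l0: "(u \<longlongrightarrow> l) (at 1 within {1/2..<1})"
    by (rule uniformly_continuous_on_extension_at_closure)
  have "at (1::real) within {1/2..<1} = at_left 1"
    by (rule at_within_nhd[of _ "{1/2<..}"]) auto
  then have l: "(u \<longlongrightarrow> l) (at_left 1)" using l0 by simp
  define v where "v r = (if r < 1 then u r else l)" for r
  have "locally_absolutely_continuous_on {0<..1} v"
    unfolding locally_absolutely_continuous_on_def
  proof (intro allI impI)
    fix a b :: real assume ab: "a \<le> b" "{a..b} \<subseteq> {0<..1}"
    then have "0 < a" "b \<le> 1" by auto
    show "absolutely_continuous_fun_on {a..b} v"
    proof (cases "a < 1")
      case False
      then have "a = 1" "b = 1" using ab \<open>b \<le> 1\<close> by auto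
      then show ?thesis by (intro Lipschitz_imp_absolutely_continuous[of _ _ 0]) auto
    next
      case True
      obtain M where M: "\<And>x y. x \<in> {a..<1} \<Longrightarrow> y \<in> {a..<1} \<Longrightarrow> \<bar>u y - u x\<bar> \<le> M * \<bar>y - x\<bar>"
        using assms[OF \<open>0 < a\<close> True] by blast
      have M1: "\<bar>l - u x\<bar> \<le> M * \<bar>1 - x\<bar>" if x: "x \<in> {a..<1}" for x
      proof (rule tendsto_le[of "at_left 1"])
        show "((\<lambda>y. \<bar>u y - u x\<bar>) \<longlongrightarrow> \<bar>l - u x\<bar>) (at_left 1)"
          by (intro tendsto_intros l)
        show "((\<lambda>y. M * \<bar>y - x\<bar>) \<longlongrightarrow> M * \<bar>1 - x\<bar>) (at_left 1)"
          by (intro tendsto_intros)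
        have "eventually (\<lambda>y. y \<in> {a<..<1}) (at_left 1)"
          by (rule eventually_at_left_real[OF True])
        then show "eventually (\<lambda>y. \<bar>u y - u x\<bar> \<le> M * \<bar>y - x\<bar>) (at_left 1)"
          by eventually_elim (use M x in auto)
      qed simp
      have "\<bar>v x - v y\<bar> \<le> M * \<bar>x - y\<bar>" if "x \<in> {a..b}" "y \<in> {a..b}" for x y
      proof -
        have "x \<le> 1" "y \<le> 1" using that \<open>b \<le> 1\<close> by auto
        then consider "x < 1" "y < 1" | "x = 1" "y < 1" | "x < 1" "y = 1" | "x = 1" "y = 1"
          by linarith
        then show ?thesis
        proof cases
          case 1 then show ?thesis using M[of y x] that by (simp add: v_def)
        next
          case 2 then show ?thesis using M1[of y] that by (simp add: v_def)
        next
          case 3 then show ?thesis using M1[of x] that by (simp add: v_def abs_minus_commute)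
        next
          case 4 then show ?thesis by simp
        qed
      qed
      then show ?thesis by (rule Lipschitz_imp_absolutely_continuous)
    qed
  qed
  then show ?thesis using that by (simp add: v_def[abs_def])
qed

text \<open>On \<open>[a, 1)\<close> the equation bounds \<open>|u'|\<^sup>k\<close>, because the right-hand side is bounded and
  \<open>r\<^sup>p \<ge> a\<^sup>p > 0\<close>.\<close>
lemma integral_equation_imp_Lipschitz:
  fixes u f :: "real \<Rightarrow> real"
  assumes k: "1 \<le> k" and c: "0 < c" and ac: "locally_absolutely_continuous_on {0<..<1} u"
    and fi: "set_integrable lebesgue {0<..<1} f"
    and AEw: "AE r\<in>{0<..<1} in lebesgue. r ^ p * deriv u r ^ k = inverse c * primitive f r"
    and a: "0 < a" "a < 1"
  shows "\<exists>M. \<forall>x\<in>{a..<1}. \<forall>y\<in>{a..<1}. \<bar>u y - u x\<bar> \<le> M * \<bar>y - x\<bar>"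
proof -
  define I where "I = (LINT s:{0<..<1}|lebesgue. \<bar>f s\<bar>)"
  define M where "M = max 1 (inverse c * I / a ^ p)"
  have bound: "AE r\<in>{a<..<1} in lebesgue. \<bar>deriv u r\<bar> \<le> M"
    using AEw
  proof eventually_elim
    case (elim r)
    show ?case
    proof
      assume r: "r \<in> {a<..<1}"
      then have e: "r ^ p * deriv u r ^ k = inverse c * primitive f r" using elim a by auto
      have "a ^ p * \<bar>deriv u r\<bar> ^ k \<le> r ^ p * \<bar>deriv u r\<bar> ^ k"
        using r a by (intro mult_right_mono power_mono) auto
      also have "\<dots> = \<bar>r ^ p * deriv u r ^ k\<bar>" using r a by (simp add: abs_mult power_abs)
      also have "\<dots> = inverse c * \<bar>primitive f r\<bar>" unfolding e using c by (simp add: abs_mult)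
      also have "\<dots> \<le> inverse c * I"
        using primitive_abs_le[OF fi, of r] r c by (intro mult_left_mono) (auto simp: I_def)
      finally have "\<bar>deriv u r\<bar> ^ k \<le> inverse c * I / a ^ p"
        using a by (subst pos_le_divide_eq) (auto simp: mult.commute)
      then show "\<bar>deriv u r\<bar> \<le> M" unfolding M_def by (rule abs_le_of_abs_power_le[OF _ k])
    qed
  qed
  have L: "\<bar>u y - u x\<bar> \<le> M * (y - x)" if xy: "x \<in> {a..<1}" "y \<in> {a..<1}" "x \<le> y" for x y
  proof (rule bounded_deriv_imp_Lipschitz[OF _ xy(3)])
    have "{x..y} \<subseteq> {0<..<1}" using xy a by auto
    then show "absolutely_continuous_fun_on {x..y} u"
      using ac xy(3) unfolding locally_absolutely_continuous_on_def by blast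
    show "AE r\<in>{x<..<y} in lebesgue. \<bar>deriv u r\<bar> \<le> M"
      using bound by eventually_elim (use xy in auto)
  qed
  have "\<bar>u y - u x\<bar> \<le> M * \<bar>y - x\<bar>" if "x \<in> {a..<1}" "y \<in> {a..<1}" for x y
    using L[of x y] L[of y x] that by (cases "x \<le> y") (auto simp: abs_minus_commute)
  then show ?thesis by blast
qed

text \<open>Radial test functions turn the weak equation into the hypothesis of \<open>weak_primitive_AE_eq\<close> for the
  flux \<open>w\<close> and the source \<open>f\<close>; continuity of \<open>g\<close> makes \<open>f\<close> continuous on the open interval. The solution
  is the given profile, completed at \<open>r = 1\<close> by its limit.\<close>
theorem weak_imp_integral_radial_solution:
  fixes U :: "real ^ 'n \<Rightarrow> real" and g :: "real \<Rightarrow> real"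
  assumes k: "1 \<le> k" "k \<le> CARD('n::finite)" and g: "continuous_on UNIV g"
    and weak: "weak_radial_solution k g U"
  shows "\<exists>u. (AE x\<in>ball 0 1 in lebesgue. U x = u (norm x)) \<and> integral_radial_solution CARD('n) k g u"
proof -
  define n where "n = CARD('n)"
  have D: "DIM(real ^ 'n) = n" by (simp add: n_def)
  have kn: "k \<le> n" using k by (simp add: n_def)
  define c where "c = c_const n k"
  have c: "c > 0" using k c_const_pos[of k n] by (simp add: c_def n_def)
  obtain u where u: "radial_profile U u"
    and energy: "set_integrable lebesgue (ball 0 1) (\<lambda>x::real ^ 'n. Sk_energy k u x)"
    and eq: "\<And>\<eta>. \<eta> \<in> Cc1 (ball 0 1) \<Longrightarrow>
        (LINT x:ball 0 1|lebesgue. 1 / real k * Sk_flux k u x (grad \<eta> x) + g (U x) * \<eta> x) = 0"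
    using weak unfolding weak_radial_solution_def by blast
  have Uk: "set_integrable lebesgue (ball 0 1) (\<lambda>x. \<bar>U x\<bar> ^ (k + 1))"
    and Ug: "set_integrable lebesgue (ball 0 1) (\<lambda>x. g (U x))"
    using weak unfolding weak_radial_solution_def by blast+
  have ac: "locally_absolutely_continuous_on {0<..<1} u"
    and Uu: "AE x\<in>ball 0 1 in lebesgue. U x = u (norm x)"
    using u by (auto simp: radial_profile_def)
  have cont: "continuous_on {0<..<1} u" by (rule locally_absolutely_continuous_continuous_on[OF ac])
  have dm: "set_borel_measurable lebesgue {0<..<1} (deriv u)"
    by (rule locally_absolutely_continuous_deriv_measurable[OF ac])
  have gu: "continuous_on {0<..<1} (\<lambda>r. g (u r))"
    by (rule continuous_on_compose2[OF g cont]) auto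
  have transfer: "set_integrable lebesgue {0<..<1} (\<lambda>r. r ^ (n - 1) * h (u r))"
    if h: "continuous_on UNIV h" and hU: "set_integrable lebesgue (ball 0 1) (\<lambda>x. h (U x))" for h :: "real \<Rightarrow> real"
  proof -
    have "continuous_on {0<..<1} (\<lambda>r. h (u r))"
      by (rule continuous_on_compose2[OF h cont]) auto
    then have m: "set_borel_measurable lebesgue {0<..<1} (\<lambda>r. h (u r))"
      by (intro set_borel_measurable_continuous_on) auto
    have m': "set_borel_measurable lebesgue (ball 0 1 :: (real ^ 'n) set) (\<lambda>x. h (u (norm x)))"
      using set_borel_measurable_radial[OF m, where 'a = "real ^ 'n"] by blast
    have "set_integrable lebesgue (ball 0 1 :: (real ^ 'n) set) (\<lambda>x. h (u (norm x)))"
      using hU m' by (rule set_integrable_bound) (use Uu in \<open>eventually_elim, auto\<close>)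
    then show ?thesis using radial_integral(1)[OF m, where 'a = "real ^ 'n", unfolded D] by blast
  qed
  define f where "f r = r ^ (n - 1) * g (u r)" for r
  have fi: "set_integrable lebesgue {0<..<1} f"
    unfolding f_def by (rule transfer[OF g Ug])
  have fc: "continuous_on {0<..<1} f"
    unfolding f_def by (intro continuous_intros gu)
  have ui: "set_integrable lebesgue {0<..<1} (\<lambda>r. r ^ (n - 1) * \<bar>u r\<bar> ^ (k + 1))"
    by (rule transfer[of "\<lambda>t. \<bar>t\<bar> ^ (k + 1)"]) (auto intro!: continuous_intros Uk[simplified])
  have ei: "set_integrable lebesgue {0<..<1} (\<lambda>r. r ^ (n - k) * deriv u r ^ (k + 1))"
    using energy set_integrable_Sk_energy_iff[OF k dm] by (simp add: n_def)
  define w where "w r = c * (r ^ (n - k) * deriv u r ^ k)" for r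
  have wi0: "set_integrable lebesgue {0<..<1} (\<lambda>r. r ^ (n - k) * deriv u r ^ k)"
    by (rule set_integrable_flux_density[OF dm _ order_refl ei]) simp
  then have wi: "set_integrable lebesgue {0<..<1} w"
    unfolding w_def by simp
  have "AE r\<in>{0<..<1} in lebesgue. w r = primitive f r"
  proof (rule weak_primitive_AE_eq[OF wi fi fc])
    fix \<psi> :: "real \<Rightarrow> real" and \<alpha> \<beta> :: real
    assume ab: "0 < \<alpha>" "\<beta> < 1" and \<psi>: "continuous_on UNIV \<psi>"
      and supp: "\<And>r. r \<notin> {\<alpha><..<\<beta>} \<Longrightarrow> \<psi> r = 0"
    define \<phi> where "\<phi> = tail_integral \<psi>"
    have test: "(\<lambda>x::real ^ 'n. \<phi> (norm x)) \<in> Cc1 (ball 0 1)"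
        "grad (\<lambda>x::real ^ 'n. \<phi> (norm x)) = (\<lambda>x. - \<psi> (norm x) *\<^sub>R sgn x)"
      unfolding \<phi>_def by (rule radial_test_function[OF \<psi> supp ab], assumption)+
    \<comment> \<open>The radial integrand of the weak equation for the test function with profile \<phi>.\<close>
    define H where "H r = g (u r) * \<phi> r - c * ((deriv u r / r) ^ k * r) * \<psi> r" for r
    have \<phi>c: "continuous_on {0<..<1} \<phi>"
      unfolding \<phi>_def by (rule continuous_on_subset[OF tail_integral(4)[OF \<psi> supp ab]]) auto
    have d: "deriv u \<in> borel_measurable (lebesgue_on {0<..<1})"
      using dm by (simp add: set_borel_measurable_iff_lebesgue_on)
    have i: "(\<lambda>r :: real. r) \<in> borel_measurable (lebesgue_on {0<..<1})"
      by (intro measurable_restrict_space1 measurable_completion) measurable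
    have gum: "(\<lambda>r. g (u r)) \<in> borel_measurable (lebesgue_on {0<..<1})"
      and \<phi>m: "\<phi> \<in> borel_measurable (lebesgue_on {0<..<1})"
      and \<psi>m: "\<psi> \<in> borel_measurable (lebesgue_on {0<..<1})"
      using gu \<phi>c continuous_on_subset[OF \<psi>]
      by (auto intro!: continuous_imp_measurable_on_sets_lebesgue)
    have "H \<in> borel_measurable (lebesgue_on {0<..<1})"
      unfolding H_def
      by (intro borel_measurable_diff borel_measurable_times borel_measurable_power
          borel_measurable_divide i d gum \<phi>m \<psi>m) auto
    then have Hm: "set_borel_measurable lebesgue {0<..<1} H"
      by (simp add: set_borel_measurable_iff_lebesgue_on)
    have "(LINT x:ball 0 1|lebesgue. H (norm (x :: real ^ 'n))) = 0"
    proof -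
      have eq0: "(LINT x:ball 0 1|lebesgue. 1 / real k * Sk_flux k u x (- \<psi> (norm x) *\<^sub>R sgn x) + g (U x) * \<phi> (norm x)) = 0"
        using eq[OF test(1)] unfolding test(2) .
      have fl: "1 / real k * Sk_flux k u x (- \<psi> (norm x) *\<^sub>R sgn x) = - c * ((deriv u (norm x) / norm x) ^ k * norm x) * \<psi> (norm x)" for x :: "real ^ 'n"
      proof -
        have "inner x (sgn x) = norm x"
          by (cases "x = 0") (auto simp: sgn_div_norm dot_square_norm power2_eq_square)
        then show ?thesis using k by (simp add: Sk_flux_def c_def n_def)
      qed
      have HU: "AE x in lebesgue. indicator (ball 0 1) x *\<^sub>R H (norm x) =
          indicator (ball 0 1) x *\<^sub>R (1 / real k * Sk_flux k u x (- \<psi> (norm x) *\<^sub>R sgn x) + g (U x) * \<phi> (norm x))"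
        using Uu
      proof eventually_elim
        case (elim x)
        then show ?case unfolding fl by (auto simp: H_def indicator_def)
      qed
      have "(\<lambda>x::real ^ 'n. indicator (ball 0 1) x *\<^sub>R H (norm x)) \<in> borel_measurable lebesgue"
        using set_borel_measurable_radial[OF Hm, where 'a = "real ^ 'n"] unfolding set_borel_measurable_def by blast
      then show ?thesis
        using eq0 integral_cong_AE[OF _ borel_measurable_AE[OF _ HU] HU] unfolding set_lebesgue_integral_def by simp
    qed
    then have "(LINT r:{0<..<1}|lebesgue. r ^ (n - 1) * H r) = 0"
      using radial_integral(2)[OF Hm, where 'a = "real ^ 'n", unfolded D] sphere_area_pos[where 'a = "real ^ 'n"]
      by simp
    also have "(LINT r:{0<..<1}|lebesgue. r ^ (n - 1) * H r) = (LINT r:{0<..<1}|lebesgue. f r * \<phi> r - w r * \<psi> r)"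
    proof (rule set_lebesgue_integral_cong)
      show "\<forall>r. r \<in> {0<..<1} \<longrightarrow> r ^ (n - 1) * H r = f r * \<phi> r - w r * \<psi> r"
      proof (intro allI impI)
        fix r :: real assume "r \<in> {0<..<1}"
        then have "r ^ (n - 1) * ((deriv u r / r) ^ k * r) = r ^ (n - k) * deriv u r ^ k"
          by (intro flux_density k(1) kn) auto
        moreover have "r ^ (n - 1) * H r = f r * \<phi> r - c * (r ^ (n - 1) * ((deriv u r / r) ^ k * r)) * \<psi> r"
          by (simp add: H_def f_def algebra_simps)
        ultimately show "r ^ (n - 1) * H r = f r * \<phi> r - w r * \<psi> r" by (simp add: w_def)
      qed
    qed auto
    also have "\<dots> = (LINT r:{0<..<1}|lebesgue. f r * \<phi> r) - (LINT r:{0<..<1}|lebesgue. w r * \<psi> r)"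
    proof (rule set_integral_diff(2))
      show "set_integrable lebesgue {0<..<1} (\<lambda>r. f r * \<phi> r)"
        using tail_integral(4)[OF \<psi> supp ab] by (intro set_integrable_times_continuous fi) (simp add: \<phi>_def)
      show "set_integrable lebesgue {0<..<1} (\<lambda>r. w r * \<psi> r)"
        by (intro set_integrable_times_continuous wi continuous_on_subset[OF \<psi>]) auto
    qed
    finally show "(LINT r:{0<..<1}|lebesgue. w r * \<psi> r) =
      (LINT r:{0<..<1}|lebesgue. f r * tail_integral \<psi> r)"
      by (simp add: \<phi>_def)
  qed
  then have AEw: "AE r\<in>{0<..<1} in lebesgue. r ^ (n - k) * deriv u r ^ k = inverse c * primitive f r"
  proof eventually_elim
    case (elim r)
    then show ?case using c by (auto simp: w_def field_simps)
  qed
  have "\<exists>M. \<forall>x\<in>{a..<1}. \<forall>y\<in>{a..<1}. \<bar>u y - u x\<bar> \<le> M * \<bar>y - x\<bar>" if "0 < a" "a < 1" for a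
    by (rule integral_equation_imp_Lipschitz[OF k(1) c ac fi AEw that])
  then obtain l where l: "locally_absolutely_continuous_on {0<..1} (\<lambda>r. if r < 1 then u r else l)"
    by (rule Lipschitz_extension_to_endpoint)
  \<comment> \<open>The value at r = 1 is the limit; on the open interval neither u nor its derivative changes.\<close>
  define v where "v r = (if r < 1 then u r else l)" for r
  have vu: "v r = u r" if "r \<in> {0<..<1}" for r using that by (simp add: v_def)
  have dv: "deriv v r = deriv u r" if r: "r \<in> {0<..<1}" for r
  proof (rule deriv_cong_ev)
    have "eventually (\<lambda>x. x \<in> {0<..<1}) (nhds r)"
      using r by (intro eventually_nhds_in_open) auto
    then show "eventually (\<lambda>x. v x = u x) (nhds r)"
      by eventually_elim (rule vu)
  qed simp
  have "integral_radial_solution n k g v"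
    unfolding integral_radial_solution_def
  proof (intro conjI)
    show "locally_absolutely_continuous_on {0<..1} v" using l by (simp add: v_def[abs_def])
    show "set_integrable lebesgue {0<..<1} (\<lambda>r. r ^ (n - 1) * g (v r))"
      using fi unfolding f_def by (rule iffD1[OF set_integrable_cong, rotated -1]) (auto simp: vu)
    show "set_integrable lebesgue {0<..<1} (\<lambda>r. r ^ (n - 1) * \<bar>v r\<bar> ^ (k + 1))"
      using ui by (rule iffD1[OF set_integrable_cong, rotated -1]) (auto simp: vu)
    show "set_integrable lebesgue {0<..<1} (\<lambda>r. r ^ (n - k) * deriv v r ^ (k + 1))"
      using ei by (rule iffD1[OF set_integrable_cong, rotated -1]) (auto simp: dv)
    show "AE r\<in>{0<..<1} in lebesgue. r ^ (n - k) * deriv v r ^ k = inverse (c_const n k) * (LINT s:{0<..<r}|lebesgue. s ^ (n - 1) * g (v s))"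
      using AEw
    proof eventually_elim
      case (elim r)
      show ?case
      proof
        assume r: "r \<in> {0<..<1}"
        have "primitive f r = (LINT s:{0<..<r}|lebesgue. s ^ (n - 1) * g (v s))"
          unfolding primitive_def using r by (intro set_lebesgue_integral_cong) (auto simp: f_def vu)
        then show "r ^ (n - k) * deriv v r ^ k = inverse (c_const n k) * (LINT s:{0<..<r}|lebesgue. s ^ (n - 1) * g (v s))"
          using elim r dv[OF r] by (simp add: c_def)
      qed
    qed
  qed
  moreover have "AE x\<in>ball 0 1 in lebesgue. U x = v (norm x)"
    using Uu AE_not_zero by eventually_elim (auto simp: v_def)
  ultimately show ?thesis unfolding n_def by blast
qed

section \<open>From the integral equation to the weak equation\<close>

lemma set_borel_measurable_times_indicator:
  fixes h :: "real \<Rightarrow> real"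
  assumes "set_borel_measurable lebesgue S h"
  shows "set_borel_measurable lebesgue S (\<lambda>r. indicator {a<..<b} r * h r)"
proof -
  have "(\<lambda>r :: real. indicator {a<..<b} r :: real) \<in> borel_measurable lebesgue"
    by (intro borel_measurable_indicator) simp
  from borel_measurable_times[OF this assms[unfolded set_borel_measurable_def]]
  show ?thesis unfolding set_borel_measurable_def by (simp add: mult_ac)
qed

text \<open>Freezing a profile outside \<open>[\<epsilon>, \<rho>]\<close> makes it globally Lipschitz and bounded, as the integration
  by parts requires. The radius \<open>\<rho>\<close> will bound the support of the test function, so only the inner
  cut-off changes an integral.\<close>
lemma clipped_profile:
  fixes v dv :: "real \<Rightarrow> real"
  assumes e: "0 < \<epsilon>" "\<epsilon> < \<rho>" "\<rho> < 1"
    and Lip: "\<forall>r\<in>{\<epsilon>..\<rho>}. \<forall>s\<in>{\<epsilon>..\<rho>}. \<bar>v r - v s\<bar> \<le> L * \<bar>r - s\<bar>"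
    and dv: "AE r\<in>{0<..<1} in lebesgue. (v has_real_derivative dv r) (at r)"
    and dvm: "set_borel_measurable lebesgue {0<..<1} dv"
  shows "\<And>r s. \<bar>v (clip \<epsilon> \<rho> r) - v (clip \<epsilon> \<rho> s)\<bar> \<le> L * \<bar>r - s\<bar>"
    and "\<And>r. \<bar>v (clip \<epsilon> \<rho> r)\<bar> \<le> \<bar>v \<epsilon>\<bar> + L"
    and "AE r\<in>{0<..<1} in lebesgue. ((\<lambda>r. v (clip \<epsilon> \<rho> r)) has_real_derivative (indicator {\<epsilon><..<\<rho>} r * dv r)) (at r)"
    and "set_borel_measurable lebesgue {0<..<1} (\<lambda>r. indicator {\<epsilon><..<\<rho>} r * dv r)"
proof -
  have L: "\<bar>v r - v s\<bar> \<le> L * \<bar>r - s\<bar>" if "r \<in> {\<epsilon>..\<rho>}" "s \<in> {\<epsilon>..\<rho>}" for r s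
    using Lip that by blast
  have cl: "clip \<epsilon> \<rho> r \<in> {\<epsilon>..\<rho>}" for r using clip_bounds[of \<epsilon> \<rho> r] e by auto
  have "\<bar>v \<epsilon> - v \<rho>\<bar> \<le> L * \<bar>\<epsilon> - \<rho>\<bar>" using e by (intro L) auto
  then have "0 \<le> L * \<bar>\<epsilon> - \<rho>\<bar>" by linarith
  then have L0: "0 \<le> L" using e by (simp add: zero_le_mult_iff)
  show "\<bar>v (clip \<epsilon> \<rho> r) - v (clip \<epsilon> \<rho> s)\<bar> \<le> L * \<bar>r - s\<bar>" for r s
    using L[OF cl cl, of r s] mult_left_mono[OF clip_contract L0, of \<epsilon> \<rho> r s] by linarith
  show "\<bar>v (clip \<epsilon> \<rho> r)\<bar> \<le> \<bar>v \<epsilon>\<bar> + L" for r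
  proof -
    have "\<bar>v (clip \<epsilon> \<rho> r) - v \<epsilon>\<bar> \<le> L * \<bar>clip \<epsilon> \<rho> r - \<epsilon>\<bar>" using e cl by (intro L) auto
    also have "\<dots> \<le> L * 1" using cl[of r] e L0 by (intro mult_left_mono) auto
    finally show ?thesis by linarith
  qed
  have "{\<epsilon>, \<rho>} \<in> null_sets lebesgue" by (simp add: negligible_iff_null_sets[symmetric])
  then have "AE r in lebesgue. r \<notin> {\<epsilon>, \<rho>}" by (rule AE_not_in)
  with dv show "AE r\<in>{0<..<1} in lebesgue. ((\<lambda>r. v (clip \<epsilon> \<rho> r)) has_real_derivative (indicator {\<epsilon><..<\<rho>} r * dv r)) (at r)"
  proof eventually_elim
    case (elim r)
    show ?case
    proof
      assume r: "r \<in> {0<..<1}"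
      consider "r < \<epsilon>" | "\<epsilon> < r" "r < \<rho>" | "\<rho> < r" using elim(2) by fastforce
      then show "((\<lambda>r. v (clip \<epsilon> \<rho> r)) has_real_derivative (indicator {\<epsilon><..<\<rho>} r * dv r)) (at r)"
      proof cases
        case 1
        have "((\<lambda>r. v (clip \<epsilon> \<rho> r)) has_real_derivative 0) (at r)"
        proof (rule has_field_derivative_transform_within_open[where f = "\<lambda>_. v \<epsilon>" and S = "{..<\<epsilon>}"])
          show "v \<epsilon> = v (clip \<epsilon> \<rho> s)" if "s \<in> {..<\<epsilon>}" for s
            using that e by (auto simp: clip_def)
        qed (use 1 in auto)
        then show ?thesis using 1 by simp
      next
        case 2
        have "(v has_real_derivative dv r) (at r)" using elim r by blast
        then have "((\<lambda>r. v (clip \<epsilon> \<rho> r)) has_real_derivative dv r) (at r)"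
        proof (rule has_field_derivative_transform_within_open[where S = "{\<epsilon><..<\<rho>}"])
          show "v s = v (clip \<epsilon> \<rho> s)" if "s \<in> {\<epsilon><..<\<rho>}" for s
            using that by (simp add: clip_eq)
        qed (use 2 in auto)
        then show ?thesis using 2 by simp
      next
        case 3
        have "((\<lambda>r. v (clip \<epsilon> \<rho> r)) has_real_derivative 0) (at r)"
        proof (rule has_field_derivative_transform_within_open[where f = "\<lambda>_. v \<rho>" and S = "{\<rho><..}"])
          show "v \<rho> = v (clip \<epsilon> \<rho> s)" if "s \<in> {\<rho><..}" for s
            using that e by (auto simp: clip_def)
        qed (use 3 in auto)
        then show ?thesis using 3 by simp
      qed
    qed
  qed
  show "set_borel_measurable lebesgue {0<..<1} (\<lambda>r. indicator {\<epsilon><..<\<rho>} r * dv r)"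
    by (rule set_borel_measurable_times_indicator[OF dvm])
qed

lemma shrinking_radii:
  assumes "0 < (\<rho>::real)"
  obtains e :: "nat \<Rightarrow> real" where "\<And>j. 0 < e j" "\<And>j. e j < \<rho>" "e \<longlonglongrightarrow> 0"
proof (rule that[of "\<lambda>j. \<rho> * inverse (real (Suc (Suc j)))"])
  show "0 < \<rho> * inverse (real (Suc (Suc j)))" for j using assms by simp
  show "\<rho> * inverse (real (Suc (Suc j))) < \<rho>" for j
    using assms by (simp add: field_simps add_pos_nonneg)
  have "(\<lambda>j. inverse (real (Suc (Suc j)))) \<longlonglongrightarrow> 0"
    using LIMSEQ_Suc[OF LIMSEQ_inverse_real_of_nat] .
  then show "(\<lambda>j. \<rho> * inverse (real (Suc (Suc j)))) \<longlonglongrightarrow> 0"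
    by (rule tendsto_mult_right_zero)
qed

text \<open>In polar coordinates the weight \<open>r\<^sup>n\<^sup>-\<^sup>1\<close> cancels the singularity. This is the dominating function for
  both passages to the limit \<open>\<epsilon> \<rightarrow> 0\<close>.\<close>
lemma set_integrable_inverse_radius_power:
  "set_integrable lebesgue (ball 0 1 :: 'a::euclidean_space set) (\<lambda>x. C / norm x ^ (DIM('a) - 1))"
proof -
  have m: "set_borel_measurable lebesgue {0<..<1} (\<lambda>r. C / r ^ (DIM('a) - 1))"
    by (intro set_borel_measurable_continuous_on continuous_intros) auto
  have "set_integrable lebesgue {0<..<1} (\<lambda>r. r ^ (DIM('a) - 1) * (C / r ^ (DIM('a) - 1)))
      \<longleftrightarrow> set_integrable lebesgue {0<..<1::real} (\<lambda>r. C)"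
    by (intro set_integrable_cong) auto
  then show ?thesis using radial_integral(1)[OF m, where 'a = 'a] by simp
qed

text \<open>At each point other than the origin the cut-off integrands are eventually equal to their limit.\<close>
lemma dominated_convergence_ball:
  fixes s :: "nat \<Rightarrow> 'a::euclidean_space \<Rightarrow> 'b::euclidean_space"
  assumes w: "set_integrable lebesgue (ball 0 1) w"
    and m: "\<And>j. set_borel_measurable lebesgue (ball 0 1) (s j)"
    and mf: "set_borel_measurable lebesgue (ball 0 1) f"
    and lim: "AE x\<in>ball 0 1 in lebesgue. x \<noteq> 0 \<longrightarrow> eventually (\<lambda>j. s j x = f x) sequentially"
    and b: "\<And>j. AE x\<in>ball 0 1 in lebesgue. x \<noteq> 0 \<longrightarrow> norm (s j x) \<le> w x"
  shows "(\<lambda>j. (LINT x:ball 0 1|lebesgue. s j x)) \<longlonglongrightarrow> (LINT x:ball 0 1|lebesgue. f x)"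
  unfolding set_lebesgue_integral_def
proof (rule integral_dominated_convergence)
  show "integrable lebesgue (\<lambda>x. indicator (ball 0 1) x *\<^sub>R w x)"
    using w by (simp add: set_integrable_def)
  show "(\<lambda>x. indicator (ball 0 1) x *\<^sub>R s j x) \<in> borel_measurable lebesgue" for j
    using m by (simp add: set_borel_measurable_def)
  show "(\<lambda>x. indicator (ball 0 1) x *\<^sub>R f x) \<in> borel_measurable lebesgue"
    using mf by (simp add: set_borel_measurable_def)
  show "AE x in lebesgue. (\<lambda>j. indicator (ball 0 1) x *\<^sub>R s j x) \<longlonglongrightarrow> indicator (ball 0 1) x *\<^sub>R f x"
    using lim AE_not_zero
  proof eventually_elim
    case (elim x)
    then have "eventually (\<lambda>j. indicator (ball 0 1) x *\<^sub>R s j x = indicator (ball 0 1) x *\<^sub>R f x) sequentially"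
      by (cases "x \<in> ball 0 1") (auto elim: eventually_mono)
    then show ?case by (rule tendsto_eventually)
  qed
  show "AE x in lebesgue. norm (indicator (ball 0 1) x *\<^sub>R s j x) \<le> indicator (ball 0 1) x *\<^sub>R w x" for j
    using b[of j] AE_not_zero by eventually_elim (auto simp: indicator_def)
qed

text \<open>For \<open>s < r\<close> the weight satisfies \<open>s\<^sup>m \<le> r\<^sup>m\<close>, so \<open>s\<^sup>m |u(\<rho>) - u(s)|\<close> is at most the integral of
  \<open>r\<^sup>m |u'(r)|\<close>.\<close>
lemma profile_growth:
  fixes u :: "real \<Rightarrow> real"
  assumes ac: "locally_absolutely_continuous_on {0<..<1} u" and \<rho>: "0 < \<rho>" "\<rho> < 1"
    and int: "set_integrable lebesgue {0<..<1} (\<lambda>r. r ^ m * deriv u r)"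
  obtains C where "\<And>s. 0 < s \<Longrightarrow> s \<le> \<rho> \<Longrightarrow> \<bar>u s\<bar> \<le> C / s ^ m"
proof -
  define J where "J = (LINT r:{0<..<1}|lebesgue. \<bar>r ^ m * deriv u r\<bar>)"
  have "\<bar>u s\<bar> \<le> (\<bar>u \<rho>\<bar> + J) / s ^ m" if s: "0 < s" "s \<le> \<rho>" for s
  proof -
    have sub: "{s..\<rho>} \<subseteq> {0<..<1}" using s \<rho> by auto
    have acs: "absolutely_continuous_fun_on {s..\<rho>} u"
      using ac s sub unfolding locally_absolutely_continuous_on_def by blast
    note ftc = absolutely_continuous_FTC(2,3)[OF acs s(2)]
    have sm: "set_integrable lebesgue {s..\<rho>} (\<lambda>r. s ^ m * \<bar>deriv u r\<bar>)"
      using set_integrable_abs[OF ftc(1)] by simp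
    have "u \<rho> - u s = (LINT r:{s..\<rho>}|lebesgue. deriv u r)"
      using set_lebesgue_integral_eq_integral(2)[OF ftc(1)] integral_unique[OF ftc(2)] by simp
    then have "\<bar>u \<rho> - u s\<bar> \<le> (LINT r:{s..\<rho>}|lebesgue. \<bar>deriv u r\<bar>)"
      using set_integral_norm_bound[OF ftc(1)] by simp
    then have "s ^ m * \<bar>u \<rho> - u s\<bar> \<le> s ^ m * (LINT r:{s..\<rho>}|lebesgue. \<bar>deriv u r\<bar>)"
      using s by (intro mult_left_mono) auto
    also have "\<dots> = (LINT r:{s..\<rho>}|lebesgue. s ^ m * \<bar>deriv u r\<bar>)"
      by simp
    also have "\<dots> \<le> J"
      unfolding J_def set_lebesgue_integral_def
    proof (rule integral_mono)
      show "integrable lebesgue (\<lambda>r. indicator {s..\<rho>} r *\<^sub>R (s ^ m * \<bar>deriv u r\<bar>))"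
        using sm by (simp add: set_integrable_def)
      show "integrable lebesgue (\<lambda>r. indicator {0<..<1} r *\<^sub>R \<bar>r ^ m * deriv u r\<bar>)"
        using set_integrable_abs[OF int] by (simp add: set_integrable_def)
      show "indicator {s..\<rho>} r *\<^sub>R (s ^ m * \<bar>deriv u r\<bar>) \<le> indicator {0<..<1} r *\<^sub>R \<bar>r ^ m * deriv u r\<bar>" for r
      proof (cases "r \<in> {s..\<rho>}")
        case True
        then have "s ^ m \<le> r ^ m" "r \<in> {0<..<1}" using s sub by (auto intro: power_mono)
        then show ?thesis using True s by (simp add: abs_mult mult_right_mono)
      qed simp
    qed
    finally have 1: "s ^ m * \<bar>u \<rho> - u s\<bar> \<le> J" .
    have "s ^ m * \<bar>u s\<bar> \<le> s ^ m * (\<bar>u \<rho>\<bar> + \<bar>u \<rho> - u s\<bar>)"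
      using s by (intro mult_left_mono) auto
    also have "\<dots> \<le> 1 * \<bar>u \<rho>\<bar> + J"
      unfolding distrib_left using 1 s \<rho> by (intro add_mono mult_right_mono power_le_one) auto
    finally show ?thesis using s by (simp add: field_simps)
  qed
  then show ?thesis using that by blast
qed

text \<open>Integrate by parts with the profile frozen below \<open>\<epsilon>\<close> and let \<open>\<epsilon> \<rightarrow> 0\<close>. The frozen profile still
  satisfies \<open>|u| \<le> C |x|\<^sup>1\<^sup>-\<^sup>n\<close>, which dominates the left-hand side; the right-hand side is dominated by
  the gradient.\<close>
theorem radial_weak_gradient:
  fixes u :: "real \<Rightarrow> real"
  assumes ac: "locally_absolutely_continuous_on {0<..<1} u"
    and Lip: "\<And>a. 0 < a \<Longrightarrow> a < 1 \<Longrightarrow> \<exists>M. \<forall>x\<in>{a..<1}. \<forall>y\<in>{a..<1}. \<bar>u y - u x\<bar> \<le> M * \<bar>y - x\<bar>"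
    and ui: "set_integrable lebesgue {0<..<1} (\<lambda>r. r ^ (DIM('a) - 1) * u r)"
    and di: "set_integrable lebesgue {0<..<1} (\<lambda>r. r ^ (DIM('a) - 1) * deriv u r)"
  shows "weak_gradient_on (ball 0 1) (\<lambda>x::'a::euclidean_space. u (norm x)) (\<lambda>x. deriv u (norm x) *\<^sub>R sgn x)"
proof -
  have cont: "continuous_on {0<..<1} u" by (rule locally_absolutely_continuous_continuous_on[OF ac])
  have dm: "set_borel_measurable lebesgue {0<..<1} (deriv u)"
    by (rule locally_absolutely_continuous_deriv_measurable[OF ac])
  have um: "set_borel_measurable lebesgue {0<..<1} u"
    using cont by (intro set_borel_measurable_continuous_on) auto
  have Ui: "set_integrable lebesgue (ball 0 1) (\<lambda>x::'a. u (norm x))"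
    using radial_integral(1)[OF um, where 'a = 'a] ui by blast
  have dUi: "set_integrable lebesgue (ball 0 1) (\<lambda>x::'a. deriv u (norm x))"
    using radial_integral(1)[OF dm, where 'a = 'a] di by blast
  have dUm: "set_borel_measurable lebesgue (ball 0 1) (\<lambda>x::'a. deriv u (norm x))"
    by (rule set_integrable_imp_set_borel_measurable[OF dUi])
  have Um: "set_borel_measurable lebesgue (ball 0 1) (\<lambda>x::'a. u (norm x))"
    by (rule set_integrable_imp_set_borel_measurable[OF Ui])
  have Fi: "set_integrable lebesgue (ball 0 1) (\<lambda>x::'a. deriv u (norm x) *\<^sub>R sgn x)"
  proof (rule set_integrable_bound[OF dUi])
    show "set_borel_measurable lebesgue (ball 0 1) (\<lambda>x::'a. deriv u (norm x) *\<^sub>R sgn x)"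
      using set_borel_measurable_scaleR_sgn[OF dUm, of "\<lambda>_. 1"] by simp
    show "AE x::'a in lebesgue. x \<in> ball 0 1 \<longrightarrow> norm (deriv u (norm x) *\<^sub>R sgn x) \<le> norm (deriv u (norm x))"
      by (intro AE_I2) (auto simp: norm_sgn)
  qed
  have loc: "locally_integrable_on (ball 0 1) h"
    if "set_integrable lebesgue (ball 0 1) h" for h :: "'a \<Rightarrow> 'b::{banach, second_countable_topology}"
    unfolding locally_integrable_on_def
    using set_integrable_subset[OF that] by (auto intro: lmeasurable_compact fmeasurableD)
  have "(LINT x:ball 0 1|lebesgue. u (norm x) *\<^sub>R grad \<eta> x) =
      - (LINT x:ball 0 1|lebesgue. \<eta> x *\<^sub>R (deriv u (norm x) *\<^sub>R sgn x))"
    if \<eta>: "\<eta> \<in> Cc1 (ball 0 1)" for \<eta> :: "'a \<Rightarrow> real"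
  proof -
    obtain \<rho> where \<rho>: "0 < \<rho>" "\<rho> < 1" "\<And>x. \<rho> \<le> norm x \<Longrightarrow> \<eta> x = 0" "\<And>x. \<rho> \<le> norm x \<Longrightarrow> grad \<eta> x = 0"
      using Cc1_ball_support[OF \<eta>] by blast
    obtain B where B: "0 \<le> B" "\<And>x. \<bar>\<eta> x\<bar> \<le> B" "\<And>x. norm (grad \<eta> x) \<le> B"
      using Cc1_bounded[OF \<eta>] by blast
    obtain e where e: "\<And>j. 0 < e j" "\<And>j. e j < \<rho>" "e \<longlonglongrightarrow> 0"
      using shrinking_radii[OF \<rho>(1)] by blast
    obtain C where C: "\<And>s. 0 < s \<Longrightarrow> s \<le> \<rho> \<Longrightarrow> \<bar>u s\<bar> \<le> C / s ^ (DIM('a) - 1)"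
      using profile_growth[OF ac \<rho>(1,2) di] by blast
    have C0: "0 \<le> C"
    proof -
      have "0 \<le> C / \<rho> ^ (DIM('a) - 1)" using C[of \<rho>] \<rho> by linarith
      then show ?thesis
        using zero_less_power[OF \<rho>(1), of "DIM('a) - 1"] by (auto simp: zero_le_divide_iff)
    qed
    define V where "V j r = u (clip (e j) \<rho> r)" for j r
    define dV where "dV j r = indicator {e j<..<\<rho>} r * deriv u r" for j r
    have "\<exists>L. \<forall>r\<in>{e j..\<rho>}. \<forall>s\<in>{e j..\<rho>}. \<bar>u r - u s\<bar> \<le> L * \<bar>r - s\<bar>" for j
    proof -
      obtain M where M: "\<forall>x\<in>{e j..<1}. \<forall>y\<in>{e j..<1}. \<bar>u y - u x\<bar> \<le> M * \<bar>y - x\<bar>"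
        using Lip[of "e j"] e(1,2)[of j] \<rho> by auto
      have "\<bar>u r - u s\<bar> \<le> M * \<bar>r - s\<bar>" if "r \<in> {e j..\<rho>}" "s \<in> {e j..\<rho>}" for r s
        using M that \<rho> by auto
      then show ?thesis by blast
    qed
    then obtain L where L: "\<And>j. \<forall>r\<in>{e j..\<rho>}. \<forall>s\<in>{e j..\<rho>}. \<bar>u r - u s\<bar> \<le> L j * \<bar>r - s\<bar>"
      by metis
    note clp = clipped_profile[OF e(1) e(2) \<rho>(2) L locally_absolutely_continuous_AE_deriv[OF ac] dm,
        folded V_def dV_def]
    note ibp = radial_integration_by_parts[OF clp \<eta>]
    have ev: "eventually (\<lambda>j. e j < norm x) sequentially" if "x \<noteq> 0" for x :: 'a
      using order_tendstoD(2)[OF e(3), of "norm x"] that by simp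
    have "(\<lambda>j. (LINT x:ball 0 1|lebesgue. V j (norm x) *\<^sub>R grad \<eta> x)) \<longlonglongrightarrow>
        (LINT x:ball 0 1|lebesgue. u (norm x) *\<^sub>R grad \<eta> x)"
    proof (rule dominated_convergence_ball)
      show "set_integrable lebesgue (ball 0 1) (\<lambda>x::'a. (C * B) / norm x ^ (DIM('a) - 1))"
        by (rule set_integrable_inverse_radius_power)
      show "set_borel_measurable lebesgue (ball 0 1) (\<lambda>x. V j (norm x) *\<^sub>R grad \<eta> x)" for j
        using ibp(1)[of j] unfolding set_integrable_def set_borel_measurable_def by (rule borel_measurable_integrable)
      have gm: "grad \<eta> \<in> borel_measurable lborel"
        using borel_measurable_continuous_onI[OF Cc1_continuous_grad[OF \<eta>]] by simp
      have "(\<lambda>x. (indicator (ball 0 1) x *\<^sub>R u (norm x)) *\<^sub>R grad \<eta> x) \<in> borel_measurable lebesgue"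
        by (rule borel_measurable_scaleR[OF Um[unfolded set_borel_measurable_def] measurable_completion[OF gm]])
      then show "set_borel_measurable lebesgue (ball 0 1) (\<lambda>x. u (norm x) *\<^sub>R grad \<eta> x)"
        by (simp add: set_borel_measurable_def)
      show "AE x\<in>ball 0 1 in lebesgue. x \<noteq> 0 \<longrightarrow>
          eventually (\<lambda>j. V j (norm x) *\<^sub>R grad \<eta> x = u (norm x) *\<^sub>R grad \<eta> x) sequentially"
      proof (intro AE_I2 impI)
        fix x :: 'a assume "x \<noteq> 0"
        from ev[OF this] show "eventually (\<lambda>j. V j (norm x) *\<^sub>R grad \<eta> x = u (norm x) *\<^sub>R grad \<eta> x) sequentially"
        proof (rule eventually_mono)
          fix j assume "e j < norm x"
          then show "V j (norm x) *\<^sub>R grad \<eta> x = u (norm x) *\<^sub>R grad \<eta> x"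
            using \<rho>(4)[of x] by (cases "norm x \<le> \<rho>") (auto simp: V_def clip_eq)
        qed
      qed
      show "AE x\<in>ball 0 1 in lebesgue. x \<noteq> 0 \<longrightarrow>
          norm (V j (norm x) *\<^sub>R grad \<eta> x) \<le> (C * B) / norm x ^ (DIM('a) - 1)" for j
      proof (intro AE_I2 impI)
        fix x :: 'a assume x: "x \<noteq> 0"
        show "norm (V j (norm x) *\<^sub>R grad \<eta> x) \<le> (C * B) / norm x ^ (DIM('a) - 1)"
        proof (cases "norm x \<le> \<rho>")
          case True
          \<comment> \<open>Freezing replaces |x| by a radius s that is at least as large, where the growth bound is no larger.\<close>
          define s where "s = clip (e j) \<rho> (norm x)"
          have s: "norm x \<le> s" "s \<le> \<rho>" "0 < s"
            using True e(1,2)[of j] by (auto simp: s_def clip_def)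
          have "\<bar>u s\<bar> \<le> C / s ^ (DIM('a) - 1)" using s by (intro C)
          also have "\<dots> \<le> C / norm x ^ (DIM('a) - 1)"
            using s x C0 by (intro divide_left_mono power_mono mult_pos_pos) auto
          finally have "\<bar>V j (norm x)\<bar> \<le> C / norm x ^ (DIM('a) - 1)" by (simp add: V_def s_def)
          then have "\<bar>V j (norm x)\<bar> * norm (grad \<eta> x) \<le> C / norm x ^ (DIM('a) - 1) * B"
            using B C0 by (intro mult_mono) auto
          then show ?thesis by simp
        next
          case False
          then show ?thesis using \<rho>(4)[of x] C0 B by simp
        qed
      qed
    qed
    moreover have "(\<lambda>j. (LINT x:ball 0 1|lebesgue. (\<eta> x * dV j (norm x)) *\<^sub>R sgn x)) \<longlonglongrightarrow>
        (LINT x:ball 0 1|lebesgue. \<eta> x *\<^sub>R (deriv u (norm x) *\<^sub>R sgn x))"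
    proof (rule dominated_convergence_ball)
      show "set_integrable lebesgue (ball 0 1) (\<lambda>x::'a. B * \<bar>deriv u (norm x)\<bar>)"
        using set_integrable_abs[OF dUi] by simp
      show "set_borel_measurable lebesgue (ball 0 1) (\<lambda>x. (\<eta> x * dV j (norm x)) *\<^sub>R sgn x)" for j
        using ibp(2)[of j] unfolding set_integrable_def set_borel_measurable_def by (rule borel_measurable_integrable)
      show "set_borel_measurable lebesgue (ball 0 1) (\<lambda>x. \<eta> x *\<^sub>R (deriv u (norm x) *\<^sub>R sgn x))"
        using set_borel_measurable_scaleR_sgn[OF dUm Cc1_continuous[OF \<eta>]] by simp
      show "AE x\<in>ball 0 1 in lebesgue. x \<noteq> 0 \<longrightarrow>
          eventually (\<lambda>j. (\<eta> x * dV j (norm x)) *\<^sub>R sgn x = \<eta> x *\<^sub>R (deriv u (norm x) *\<^sub>R sgn x)) sequentially"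
      proof (intro AE_I2 impI)
        fix x :: 'a assume "x \<noteq> 0"
        from ev[OF this] show "eventually (\<lambda>j. (\<eta> x * dV j (norm x)) *\<^sub>R sgn x = \<eta> x *\<^sub>R (deriv u (norm x) *\<^sub>R sgn x)) sequentially"
        proof (rule eventually_mono)
          fix j assume "e j < norm x"
          then show "(\<eta> x * dV j (norm x)) *\<^sub>R sgn x = \<eta> x *\<^sub>R (deriv u (norm x) *\<^sub>R sgn x)"
            using \<rho>(3)[of x] by (cases "norm x < \<rho>") (auto simp: dV_def)
        qed
      qed
      show "AE x\<in>ball 0 1 in lebesgue. x \<noteq> 0 \<longrightarrow>
          norm ((\<eta> x * dV j (norm x)) *\<^sub>R sgn x) \<le> B * \<bar>deriv u (norm x)\<bar>" for j
      proof (intro AE_I2 impI)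
        fix x :: 'a assume x: "x \<noteq> 0"
        have "\<bar>\<eta> x\<bar> * \<bar>dV j (norm x)\<bar> \<le> B * \<bar>deriv u (norm x)\<bar>"
          using B by (intro mult_mono) (auto simp: dV_def indicator_def)
        then show "norm ((\<eta> x * dV j (norm x)) *\<^sub>R sgn x) \<le> B * \<bar>deriv u (norm x)\<bar>"
          using x by (simp add: norm_sgn abs_mult)
      qed
    qed
    then have "(\<lambda>j. (LINT x:ball 0 1|lebesgue. V j (norm x) *\<^sub>R grad \<eta> x)) \<longlonglongrightarrow>
        - (LINT x:ball 0 1|lebesgue. \<eta> x *\<^sub>R (deriv u (norm x) *\<^sub>R sgn x))"
      unfolding ibp(3) by (rule tendsto_minus)
    ultimately show ?thesis by (rule LIMSEQ_unique)
  qed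
  then show ?thesis
    using loc[OF Ui] loc[OF Fi] by (simp add: weak_gradient_on_def)
qed

text \<open>With \<open>\<gamma>(r) = G(r) r\<^sup>-\<^sup>n\<close> the field \<open>\<gamma>(|x|) x\<close> has divergence \<open>n \<gamma> + r \<gamma>' = r\<^sup>1\<^sup>-\<^sup>n G' = g\<^sub>0\<close> away from
  the origin. When \<open>\<gamma>\<close> is frozen below \<open>\<epsilon>\<close>, the divergence there is the constant \<open>n \<gamma>(\<epsilon>)\<close>. It need not
  be dominated uniformly in \<open>\<epsilon>\<close>, but its integral over the ball of radius \<open>\<epsilon>\<close> is a multiple of
  \<open>\<gamma>(\<epsilon>) \<epsilon>\<^sup>n = G(\<epsilon>)\<close> and tends to \<open>0\<close>; hence this part is split off.\<close>
theorem primitive_flux_divergence: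
  fixes g0 :: "real \<Rightarrow> real" and \<eta> :: "'a::euclidean_space \<Rightarrow> real"
  defines "f \<equiv> \<lambda>r. r ^ (DIM('a) - 1) * g0 r"
  assumes cont: "continuous_on {0<..<1} g0" and fi: "set_integrable lebesgue {0<..<1} f"
    and \<eta>: "\<eta> \<in> Cc1 (ball 0 1)"
  shows "(LINT x:ball 0 1|lebesgue. primitive f (norm x) / norm x ^ DIM('a) * inner x (grad \<eta> x) + g0 (norm x) * \<eta> x) = 0"
proof -
  define n where "n = DIM('a)"
  have n: "n \<ge> 1" by (simp add: n_def Suc_le_eq)
  have fc: "continuous_on {0<..<1} f"
    unfolding f_def by (intro continuous_intros cont)
  define I where "I = (LINT s:{0<..<1}|lebesgue. \<bar>f s\<bar>)"
  have GI: "\<bar>primitive f r\<bar> \<le> I" if "r \<le> 1" for r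
    unfolding I_def by (rule primitive_abs_le[OF fi that])
  have I0: "0 \<le> I" using GI[of 0] by linarith
  define \<gamma> where "\<gamma> r = primitive f r / r ^ n" for r
  define d\<gamma> where "d\<gamma> r = (g0 r - real n * \<gamma> r) / r" for r
  have D\<gamma>: "(\<gamma> has_real_derivative d\<gamma> r) (at r)" if r: "r \<in> {0<..<1}" for r
  proof -
    have r0: "r \<noteq> 0" using r by auto
    have rn: "r ^ n = r ^ (n - 1) * r" using n by (cases n) auto
    have "(\<gamma> has_real_derivative (f r * r ^ n - primitive f r * (real n * r ^ (n - 1))) / (r ^ n * r ^ n)) (at r)"
      unfolding \<gamma>_def using r0 DERIV_primitive[OF fi fc r]
      by (auto intro!: derivative_eq_intros)
    moreover have "(f r * r ^ n - primitive f r * (real n * r ^ (n - 1))) / (r ^ n * r ^ n) = d\<gamma> r"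
      using r0 unfolding d\<gamma>_def \<gamma>_def f_def n_def[symmetric] rn by (simp add: field_simps)
    ultimately show ?thesis by simp
  qed
  have \<gamma>c: "continuous_on {0<..<1} \<gamma>"
    using D\<gamma> by (meson DERIV_isCont continuous_at_imp_continuous_on)
  have d\<gamma>c: "continuous_on {0<..<1} d\<gamma>"
    unfolding d\<gamma>_def by (intro continuous_intros cont \<gamma>c) auto
  have d\<gamma>m: "set_borel_measurable lebesgue {0<..<1} d\<gamma>"
    using d\<gamma>c by (intro set_borel_measurable_continuous_on) auto
  have AED: "AE r\<in>{0<..<1} in lebesgue. (\<gamma> has_real_derivative d\<gamma> r) (at r)"
    using D\<gamma> by (intro AE_I2) blast
  obtain \<rho> where \<rho>: "0 < \<rho>" "\<rho> < 1" "\<And>x. \<rho> \<le> norm x \<Longrightarrow> \<eta> x = 0" "\<And>x. \<rho> \<le> norm x \<Longrightarrow> grad \<eta> x = 0"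
    using Cc1_ball_support[OF \<eta>] by blast
  obtain B where B: "0 \<le> B" "\<And>x. \<bar>\<eta> x\<bar> \<le> B" "\<And>x. norm (grad \<eta> x) \<le> B"
    using Cc1_bounded[OF \<eta>] by blast
  obtain e where e: "\<And>j. 0 < e j" "\<And>j. e j < \<rho>" "e \<longlonglongrightarrow> 0"
    using shrinking_radii[OF \<rho>(1)] by blast
  define V where "V j r = \<gamma> (clip (e j) \<rho> r)" for j r
  define dV where "dV j r = indicator {e j<..<\<rho>} r * d\<gamma> r" for j r
  have "\<exists>L. \<forall>r\<in>{e j..\<rho>}. \<forall>s\<in>{e j..\<rho>}. \<bar>\<gamma> r - \<gamma> s\<bar> \<le> L * \<bar>r - s\<bar>" for j
  proof -
    have sub: "{e j..\<rho>} \<subseteq> {0<..<1}" using e(1)[of j] \<rho> by auto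
    have "bounded (d\<gamma> ` {e j..\<rho>})"
      by (intro compact_imp_bounded compact_continuous_image continuous_on_subset[OF d\<gamma>c sub]) auto
    then obtain L where "\<forall>y\<in>d\<gamma> ` {e j..\<rho>}. norm y \<le> L" unfolding bounded_iff by blast
    then have L: "norm (d\<gamma> r) \<le> L" if "r \<in> {e j..\<rho>}" for r using that by blast
    have "norm (\<gamma> r - \<gamma> s) \<le> L * norm (r - s)" if "r \<in> {e j..\<rho>}" "s \<in> {e j..\<rho>}" for r s
    proof (rule field_differentiable_bound[where S = "{e j..\<rho>}" and f' = d\<gamma>])
      show "(\<gamma> has_field_derivative d\<gamma> z) (at z within {e j..\<rho>})" if "z \<in> {e j..\<rho>}" for z
        by (rule has_field_derivative_at_within[OF D\<gamma>[OF subsetD[OF sub that]]])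
    qed (use that L in auto)
    then show ?thesis unfolding real_norm_def by blast
  qed
  then obtain L where L: "\<And>j. \<forall>r\<in>{e j..\<rho>}. \<forall>s\<in>{e j..\<rho>}. \<bar>\<gamma> r - \<gamma> s\<bar> \<le> L j * \<bar>r - s\<bar>"
    by metis
  note clp = clipped_profile[OF e(1) e(2) \<rho>(2) L AED d\<gamma>m, folded V_def dV_def]
  note div = radial_divergence_theorem[OF clp \<eta>, folded n_def]
  \<comment> \<open>Q is the divergence of the frozen field multiplied by \<eta>. Its part T is \<eta> times the divergence of the
    frozen field on the small ball, and the rest Y is dominated uniformly in j.\<close>
  define Q where "Q j x = V j (norm x) * (inner x (grad \<eta> x) + real n * \<eta> x) + \<eta> x * (norm x * dV j (norm x))" for j x
  define T where "T j x = indicator (cball 0 (e j)) x * (real n * \<gamma> (e j) * \<eta> x)" for j x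
  define Y where "Y j x = Q j x - T j x" for j x
  define Z where "Z x = \<gamma> (norm x) * inner x (grad \<eta> x) + g0 (norm x) * \<eta> x" for x
  have \<eta>m: "\<eta> \<in> borel_measurable lborel" "(\<lambda>x. inner x (grad \<eta> x)) \<in> borel_measurable lborel"
    using borel_measurable_continuous_onI[OF Cc1_continuous[OF \<eta>]]
      borel_measurable_continuous_onI[OF Cc1_continuous_grad[OF \<eta>]] by auto
  have rad: "set_borel_measurable lebesgue (ball 0 1) (\<lambda>x::'a. h (norm x) * p x)"
    if "set_borel_measurable lebesgue {0<..<1} h" "p \<in> borel_measurable lborel" for h :: "real \<Rightarrow> real" and p
  proof -
    have "set_borel_measurable lebesgue (ball 0 1) (\<lambda>x::'a. h (norm x))"
      using set_borel_measurable_radial[OF that(1)] by blast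
    from borel_measurable_times[OF this[unfolded set_borel_measurable_def] measurable_completion[OF that(2)]]
    show ?thesis by (simp add: set_borel_measurable_def mult_ac)
  qed
  have g0m: "set_borel_measurable lebesgue {0<..<1} g0"
    using cont by (intro set_borel_measurable_continuous_on) auto
  have \<gamma>m: "set_borel_measurable lebesgue {0<..<1} \<gamma>"
    using \<gamma>c by (intro set_borel_measurable_continuous_on) auto
  have plus: "set_borel_measurable lebesgue (ball 0 1) (\<lambda>x. p x + q x)"
    if "set_borel_measurable lebesgue (ball 0 1) p" "set_borel_measurable lebesgue (ball 0 1) q" for p q :: "'a \<Rightarrow> real"
    using borel_measurable_add[OF that[unfolded set_borel_measurable_def]]
    by (simp add: set_borel_measurable_def distrib_left)
  have Zm: "set_borel_measurable lebesgue (ball 0 1) Z"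
    unfolding Z_def by (intro plus rad \<gamma>m g0m \<eta>m)
  have Qi: "set_integrable lebesgue (ball 0 1) (Q j)" for j
    unfolding Q_def by (rule set_integral_add(1)[OF div(1,2)])
  have Q0: "(LINT x:ball 0 1|lebesgue. Q j x) = 0" for j
    unfolding Q_def using div(3)[of j] by (simp add: set_integral_add(2)[OF div(1,2)])
  have Y: "Y j x = V j (norm x) * inner x (grad \<eta> x) + indicator {e j<..<\<rho>} (norm x) * (g0 (norm x) * \<eta> x)"
    if "x \<noteq> 0" for j x
  proof -
    consider "norm x \<le> e j" | "e j < norm x" "norm x < \<rho>" | "\<rho> \<le> norm x" by linarith
    then show ?thesis
    proof cases
      case 1
      then have "clip (e j) \<rho> (norm x) = e j" using e(2)[of j] by (simp add: clip_def)
      then show ?thesis using 1 by (simp add: Y_def Q_def T_def V_def dV_def algebra_simps)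
    next
      case 2
      then have "g0 (norm x) = real n * V j (norm x) + norm x * dV j (norm x)"
        using that by (simp add: V_def clip_eq dV_def d\<gamma>_def)
      then show ?thesis using 2 by (simp add: Y_def Q_def T_def algebra_simps)
    next
      case 3
      then show ?thesis using e(2)[of j] \<rho>(3,4)[of x] by (simp add: Y_def Q_def T_def)
    qed
  qed
  have gi: "set_integrable lebesgue (ball 0 1) (\<lambda>x::'a. g0 (norm x))"
    using radial_integral(1)[OF g0m, where 'a = 'a] fi by (simp add: f_def)
  define wt where "wt x = (I * B) / norm x ^ (n - 1) + B * \<bar>g0 (norm x)\<bar>" for x :: 'a
  have wt: "set_integrable lebesgue (ball 0 1) wt"
    unfolding wt_def n_def
    by (intro set_integral_add(1) set_integrable_inverse_radius_power set_integrable_mult_right set_integrable_abs gi)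
  have Yw: "norm (Y j x) \<le> wt x" if x: "x \<noteq> 0" "x \<in> ball 0 1" for j x
  proof -
    have "\<bar>V j (norm x) * inner x (grad \<eta> x)\<bar> \<le> (I * B) / norm x ^ (n - 1)"
    proof (cases "norm x \<le> \<rho>")
      case True
      define s where "s = clip (e j) \<rho> (norm x)"
      have s: "norm x \<le> s" "s \<le> \<rho>" "0 < s"
        using True e(1,2)[of j] by (auto simp: s_def clip_def)
      have "\<bar>V j (norm x)\<bar> = \<bar>primitive f s\<bar> / s ^ n"
        using s by (simp add: V_def s_def[symmetric] \<gamma>_def abs_divide)
      also have "\<dots> \<le> I / norm x ^ n"
        using s x \<rho> I0 by (intro frac_le GI power_mono) auto
      finally have V: "\<bar>V j (norm x)\<bar> \<le> I / norm x ^ n" .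
      have "\<bar>inner x (grad \<eta> x)\<bar> \<le> norm x * B"
        using Cauchy_Schwarz_ineq2[of x "grad \<eta> x"] mult_left_mono[OF B(3)[of x] norm_ge_zero[of x]] by linarith
      then have "\<bar>V j (norm x)\<bar> * \<bar>inner x (grad \<eta> x)\<bar> \<le> I / norm x ^ n * (norm x * B)"
        using V I0 by (intro mult_mono) auto
      also have "\<dots> = (I * B) / norm x ^ (n - 1)"
        using x n by (cases n) auto
      finally show ?thesis by (simp add: abs_mult)
    next
      case False
      then show ?thesis using \<rho>(4)[of x] I0 B by simp
    qed
    moreover have "\<bar>indicator {e j<..<\<rho>} (norm x) * (g0 (norm x) * \<eta> x)\<bar> \<le> B * \<bar>g0 (norm x)\<bar>"
    proof -
      have "\<bar>g0 (norm x)\<bar> * \<bar>\<eta> x\<bar> \<le> \<bar>g0 (norm x)\<bar> * B" using B by (intro mult_left_mono) auto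
      then show ?thesis using B by (auto simp: indicator_def abs_mult mult.commute)
    qed
    ultimately show ?thesis
      unfolding Y[OF x(1)] wt_def real_norm_def by linarith
  qed
  have Ti: "set_integrable lebesgue (ball 0 1) (T j)"
    and Tb: "\<bar>LINT x:ball 0 1|lebesgue. T j x\<bar> \<le> real n * B * unit_ball_vol (real n) * \<bar>primitive f (e j)\<bar>" for j
  proof -
    have Tint: "integrable lebesgue (T j)"
      and Tle: "\<bar>integral\<^sup>L lebesgue (T j)\<bar> \<le> real n * B * unit_ball_vol (real n) * \<bar>primitive f (e j)\<bar>"
    proof -
      have Kint: "integrable lebesgue (\<lambda>x::'a. real n * \<bar>\<gamma> (e j)\<bar> * B * indicator (cball 0 (e j)) x)"
        by (intro integrable_mult_right integrable_real_indicator) (auto simp: emeasure_cball less_imp_le[OF e(1)])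
      have Tm: "T j \<in> borel_measurable lebesgue"
        unfolding T_def by (intro borel_measurable_times measurable_completion[OF \<eta>m(1)] borel_measurable_const borel_measurable_indicator) simp
      have le: "\<bar>T j x\<bar> \<le> real n * \<bar>\<gamma> (e j)\<bar> * B * indicator (cball 0 (e j)) x" for x
        using mult_left_mono[OF B(2)[of x], of "real n * \<bar>\<gamma> (e j)\<bar>"]
        by (auto simp: T_def indicator_def abs_mult)
      show i: "integrable lebesgue (T j)"
        by (rule Bochner_Integration.integrable_bound[OF Kint Tm])
          (use le B in \<open>auto simp: abs_mult intro!: AE_I2\<close>)
      have "\<bar>integral\<^sup>L lebesgue (T j)\<bar> \<le> integral\<^sup>L lebesgue (\<lambda>x. \<bar>T j x\<bar>)"
        by (rule integral_abs_bound)
      also have "\<dots> \<le> integral\<^sup>L lebesgue (\<lambda>x::'a. real n * \<bar>\<gamma> (e j)\<bar> * B * indicator (cball 0 (e j)) x)"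
        by (intro integral_mono integrable_abs i Kint le)
      also have "\<dots> = real n * \<bar>\<gamma> (e j)\<bar> * B * measure lebesgue (cball (0::'a) (e j))"
        by simp
      also have "measure lebesgue (cball (0::'a) (e j)) = unit_ball_vol (real n) * e j ^ n"
        using content_cball[of "e j" "0::'a"] e(1)[of j] by (simp add: n_def)
      also have "real n * \<bar>\<gamma> (e j)\<bar> * B * (unit_ball_vol (real n) * e j ^ n) =
          real n * B * unit_ball_vol (real n) * \<bar>primitive f (e j)\<bar>"
        using e(1)[of j] by (simp add: \<gamma>_def abs_divide)
      finally show "\<bar>integral\<^sup>L lebesgue (T j)\<bar> \<le> real n * B * unit_ball_vol (real n) * \<bar>primitive f (e j)\<bar>" .
    qed
    have Tball: "indicator (ball 0 1) x *\<^sub>R T j x = T j x" for x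
      using e(2)[of j] \<rho>(2) by (auto simp: T_def indicator_def)
    show "set_integrable lebesgue (ball 0 1) (T j)"
      using Tint by (simp only: set_integrable_def Tball)
    show "\<bar>LINT x:ball 0 1|lebesgue. T j x\<bar> \<le> real n * B * unit_ball_vol (real n) * \<bar>primitive f (e j)\<bar>"
      using Tle by (simp only: set_lebesgue_integral_def Tball)
  qed
  have Ym: "set_borel_measurable lebesgue (ball 0 1) (Y j)" for j
    unfolding Y_def by (intro set_integrable_imp_set_borel_measurable set_integral_diff(1) Qi Ti)
  have YT: "(LINT x:ball 0 1|lebesgue. Y j x) = - (LINT x:ball 0 1|lebesgue. T j x)" for j
    unfolding Y_def by (simp add: set_integral_diff(2)[OF Qi Ti] Q0)
  have Ylim: "(\<lambda>j. (LINT x:ball 0 1|lebesgue. Y j x)) \<longlonglongrightarrow> (LINT x:ball 0 1|lebesgue. Z x)"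
  proof (rule dominated_convergence_ball[OF wt Ym Zm])
    show "AE x\<in>ball 0 1 in lebesgue. x \<noteq> 0 \<longrightarrow> norm (Y j x) \<le> wt x" for j
      using Yw by (intro AE_I2) blast
    show "AE x\<in>ball 0 1 in lebesgue. x \<noteq> 0 \<longrightarrow> eventually (\<lambda>j. Y j x = Z x) sequentially"
    proof (intro AE_I2 impI)
      fix x :: 'a assume x: "x \<noteq> 0"
      then have "eventually (\<lambda>j. e j < norm x) sequentially"
        using order_tendstoD(2)[OF e(3), of "norm x"] by simp
      then show "eventually (\<lambda>j. Y j x = Z x) sequentially"
      proof (rule eventually_mono)
        fix j assume "e j < norm x"
        then show "Y j x = Z x"
          using \<rho>(3,4)[of x] unfolding Y[OF x] by (cases "norm x < \<rho>") (auto simp: Z_def V_def clip_eq)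
      qed
    qed
  qed
  have "(\<lambda>j. (LINT x:ball 0 1|lebesgue. Y j x)) \<longlonglongrightarrow> 0"
  proof (rule Lim_null_comparison)
    show "eventually (\<lambda>j. norm (LINT x:ball 0 1|lebesgue. Y j x) \<le> real n * B * unit_ball_vol (real n) * \<bar>primitive f (e j)\<bar>) sequentially"
      using Tb YT by (intro always_eventually) simp
    have "(\<lambda>j. primitive f (e j)) \<longlonglongrightarrow> 0"
      using e \<rho>(2) by (intro primitive_tendsto_0[OF fi]) (auto intro: less_imp_le order.strict_trans)
    then show "(\<lambda>j. real n * B * unit_ball_vol (real n) * \<bar>primitive f (e j)\<bar>) \<longlonglongrightarrow> 0"
      by (intro tendsto_mult_right_zero tendsto_rabs_zero)
  qed
  from LIMSEQ_unique[OF Ylim this] show ?thesis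
    by (simp add: Z_def \<gamma>_def n_def)
qed

text \<open>By the integral equation \<open>c (u'/r)\<^sup>k = G(r) r\<^sup>-\<^sup>n\<close> almost everywhere, so the flux term of the weak
  equation is the field of the preceding theorem. For the weak derivative the energy has to make
  \<open>r\<^sup>n\<^sup>-\<^sup>1 u'\<close> integrable, which holds as \<open>k \<le> n\<close>.\<close>
theorem integral_imp_weak_radial_solution:
  fixes u g :: "real \<Rightarrow> real"
  assumes k: "1 \<le> k" "k \<le> CARD('n::finite)" and g: "continuous_on UNIV g"
    and sol: "integral_radial_solution CARD('n) k g u"
  shows "weak_radial_solution k g (\<lambda>x :: real ^ 'n. u (norm x))"
proof -
  define n where "n = CARD('n)"
  have D: "DIM(real ^ 'n) = n" by (simp add: n_def)
  have kn: "k \<le> n" using k by (simp add: n_def)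
  define c where "c = c_const n k"
  have c: "c > 0" using k c_const_pos[of k n] by (simp add: c_def n_def)
  define f where "f = (\<lambda>r. r ^ (n - 1) * g (u r))"
  have ac: "locally_absolutely_continuous_on {0<..<1} u"
    using sol unfolding integral_radial_solution_def
    by (auto intro: locally_absolutely_continuous_on_subset)
  have fi: "set_integrable lebesgue {0<..<1} f"
    and ui: "set_integrable lebesgue {0<..<1} (\<lambda>r. r ^ (n - 1) * \<bar>u r\<bar> ^ (k + 1))"
    and ei: "set_integrable lebesgue {0<..<1} (\<lambda>r. r ^ (n - k) * deriv u r ^ (k + 1))"
    and AEw: "AE r\<in>{0<..<1} in lebesgue. r ^ (n - k) * deriv u r ^ k = inverse c * primitive f r"
    using sol unfolding integral_radial_solution_def f_def n_def c_def primitive_def by blast+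
  have cont: "continuous_on {0<..<1} u" by (rule locally_absolutely_continuous_continuous_on[OF ac])
  have dm: "set_borel_measurable lebesgue {0<..<1} (deriv u)"
    by (rule locally_absolutely_continuous_deriv_measurable[OF ac])
  have um: "set_borel_measurable lebesgue {0<..<1} u"
    using cont by (intro set_borel_measurable_continuous_on) auto
  have gu: "continuous_on {0<..<1} (\<lambda>r. g (u r))"
    by (rule continuous_on_compose2[OF g cont]) auto
  have Lip: "\<exists>M. \<forall>x\<in>{a..<1}. \<forall>y\<in>{a..<1}. \<bar>u y - u x\<bar> \<le> M * \<bar>y - x\<bar>" if "0 < a" "a < 1" for a
    by (rule integral_equation_imp_Lipschitz[OF k(1) c ac fi AEw that])
  have u1: "set_integrable lebesgue {0<..<1} (\<lambda>r. r ^ (n - 1) * u r)"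
  proof (rule set_integrable_bound)
    show "set_integrable lebesgue {0<..<1} (\<lambda>r. 1 + r ^ (n - 1) * \<bar>u r\<bar> ^ (k + 1))"
      using ui by (intro set_integral_add(1)) auto
    show "set_borel_measurable lebesgue {0<..<1} (\<lambda>r. r ^ (n - 1) * u r)"
      by (intro set_borel_measurable_continuous_on continuous_intros cont) auto
    show "AE r\<in>{0<..<1} in lebesgue. norm (r ^ (n - 1) * u r) \<le> norm (1 + r ^ (n - 1) * \<bar>u r\<bar> ^ (k + 1))"
    proof (intro AE_I2 impI)
      fix r :: real assume r: "r \<in> {0<..<1}"
      have "\<bar>u r\<bar> \<le> 1 + \<bar>u r\<bar> ^ (k + 1)"
        using abs_power_le_Suc[of 1 "k + 1" "u r"] by (simp only: power_abs power_one_right)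
      then have "r ^ (n - 1) * \<bar>u r\<bar> \<le> r ^ (n - 1) * (1 + \<bar>u r\<bar> ^ (k + 1))"
        using r by (intro mult_left_mono) auto
      also have "\<dots> \<le> 1 + r ^ (n - 1) * \<bar>u r\<bar> ^ (k + 1)"
        using r by (simp add: distrib_left power_le_one)
      finally show "norm (r ^ (n - 1) * u r) \<le> norm (1 + r ^ (n - 1) * \<bar>u r\<bar> ^ (k + 1))"
        using r by (simp add: abs_mult)
    qed
  qed
  have d1: "set_integrable lebesgue {0<..<1} (\<lambda>r. r ^ (n - 1) * deriv u r)"
  proof -
    have "set_integrable lebesgue {0<..<1} (\<lambda>r. r ^ (n - 1) * deriv u r ^ 1)"
      by (rule set_integrable_flux_density[OF dm _ _ ei]) (use k in auto)
    then show ?thesis by simp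
  qed
  have wd: "weakly_differentiable_on (ball 0 1) (\<lambda>x :: real ^ 'n. u (norm x))"
    unfolding weakly_differentiable_on_def
    using radial_weak_gradient[OF ac Lip, where 'a = "real ^ 'n", unfolded D, OF _ _ u1 d1] by blast
  have U1: "set_integrable lebesgue (ball 0 1) (\<lambda>x :: real ^ 'n. \<bar>u (norm x)\<bar> ^ (k + 1))"
  proof -
    have m: "set_borel_measurable lebesgue {0<..<1} (\<lambda>r. \<bar>u r\<bar> ^ (k + 1))"
      by (intro set_borel_measurable_continuous_on continuous_intros cont) auto
    show ?thesis using radial_integral(1)[OF m, where 'a = "real ^ 'n", unfolded D] ui by blast
  qed
  have U2: "set_integrable lebesgue (ball 0 1) (\<lambda>x :: real ^ 'n. g (u (norm x)))"
  proof -
    have m: "set_borel_measurable lebesgue {0<..<1} (\<lambda>r. g (u r))"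
      by (intro set_borel_measurable_continuous_on gu) auto
    show ?thesis using radial_integral(1)[OF m, where 'a = "real ^ 'n", unfolded D] fi unfolding f_def by blast
  qed
  have E: "set_integrable lebesgue (ball 0 1) (\<lambda>x::real ^ 'n. Sk_energy k u x)"
    using ei set_integrable_Sk_energy_iff[OF k dm] by (simp add: n_def)
  have W: "(LINT x:ball 0 1|lebesgue. 1 / real k * Sk_flux k u x (grad \<eta> x) + g (u (norm x)) * \<eta> x) = 0"
    if \<eta>: "\<eta> \<in> Cc1 (ball 0 1)" for \<eta> :: "real ^ 'n \<Rightarrow> real"
  proof -
    have div: "(LINT x:ball 0 1|lebesgue. primitive f (norm x) / norm x ^ n * inner x (grad \<eta> x) + g (u (norm x)) * \<eta> x) = 0"
      using primitive_flux_divergence[OF gu _ \<eta>] fi unfolding f_def D by blast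
    have flux: "AE x::real ^ 'n in lebesgue. x \<in> ball 0 1 \<longrightarrow>
        c * (deriv u (norm x) / norm x) ^ k = primitive f (norm x) / norm x ^ n"
    proof (rule AE_radial_ball)
      show "AE r\<in>{0<..<1} in lebesgue. c * (deriv u r / r) ^ k = primitive f r / r ^ n"
        using AEw
      proof eventually_elim
        case (elim r)
        show ?case
        proof
          assume r: "r \<in> {0<..<1}"
          then have "primitive f r = c * (r ^ (n - k) * deriv u r ^ k)"
            using elim c by (simp add: field_simps)
          moreover have "r ^ n = r ^ (n - k) * r ^ k"
            using kn by (simp flip: power_add)
          ultimately show "c * (deriv u r / r) ^ k = primitive f r / r ^ n"
            using r by (simp add: power_divide)
        qed
      qed
    qed
    have "set_borel_measurable lebesgue (ball 0 1) (\<lambda>x::real ^ 'n. deriv u (norm x))"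
      using set_borel_measurable_radial[OF dm] by blast
    then have m1: "(\<lambda>x::real ^ 'n. deriv u (norm x)) \<in> borel_measurable (lebesgue_on (ball 0 1))"
      by (simp add: set_borel_measurable_iff_lebesgue_on)
    have "set_borel_measurable lebesgue (ball 0 1) (\<lambda>x::real ^ 'n. g (u (norm x)))"
      by (rule set_integrable_imp_set_borel_measurable[OF U2])
    then have m2: "(\<lambda>x::real ^ 'n. g (u (norm x))) \<in> borel_measurable (lebesgue_on (ball 0 1))"
      by (simp add: set_borel_measurable_iff_lebesgue_on)
    have "\<eta> \<in> borel_measurable lborel" "(\<lambda>x. inner x (grad \<eta> x)) \<in> borel_measurable lborel"
      "(norm :: real ^ 'n \<Rightarrow> real) \<in> borel_measurable lborel"
      using borel_measurable_continuous_onI[OF Cc1_continuous[OF \<eta>]]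
        borel_measurable_continuous_onI[OF Cc1_continuous_grad[OF \<eta>]] by auto
    then have m3: "\<eta> \<in> borel_measurable (lebesgue_on (ball 0 1))"
      "(\<lambda>x. inner x (grad \<eta> x)) \<in> borel_measurable (lebesgue_on (ball 0 1))"
      "norm \<in> borel_measurable (lebesgue_on (ball 0 1 :: (real ^ 'n) set))"
      by (auto intro!: measurable_restrict_space1 measurable_completion)
    have "(\<lambda>x. c * (deriv u (norm x) / norm x) ^ k * inner x (grad \<eta> x) + g (u (norm x)) * \<eta> x)
        \<in> borel_measurable (lebesgue_on (ball 0 1))"
      by (intro borel_measurable_add borel_measurable_times borel_measurable_power
        borel_measurable_divide borel_measurable_const m1 m2 m3)
    then have mm: "set_borel_measurable lebesgue (ball 0 1)
        (\<lambda>x. c * (deriv u (norm x) / norm x) ^ k * inner x (grad \<eta> x) + g (u (norm x)) * \<eta> x)"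
      by (simp add: set_borel_measurable_iff_lebesgue_on)
    have ae: "AE x in lebesgue. indicator (ball 0 1) x *\<^sub>R
          (c * (deriv u (norm x) / norm x) ^ k * inner x (grad \<eta> x) + g (u (norm x)) * \<eta> x) =
        indicator (ball 0 1) x *\<^sub>R (primitive f (norm x) / norm x ^ n * inner x (grad \<eta> x) + g (u (norm x)) * \<eta> x)"
      using flux by eventually_elim (auto simp: indicator_def)
    have "(LINT x:ball 0 1|lebesgue. 1 / real k * Sk_flux k u x (grad \<eta> x) + g (u (norm x)) * \<eta> x) =
        (LINT x:ball 0 1|lebesgue. c * (deriv u (norm x) / norm x) ^ k * inner x (grad \<eta> x) + g (u (norm x)) * \<eta> x)"
      using k by (simp add: Sk_flux_def c_def n_def mult.assoc)
    also have "\<dots> = (LINT x:ball 0 1|lebesgue. primitive f (norm x) / norm x ^ n * inner x (grad \<eta> x) + g (u (norm x)) * \<eta> x)"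
      unfolding set_lebesgue_integral_def
      by (rule integral_cong_AE[OF mm[unfolded set_borel_measurable_def]
            borel_measurable_AE[OF mm[unfolded set_borel_measurable_def] ae] ae])
    finally show ?thesis using div by simp
  qed
  have "radial_profile (\<lambda>x :: real ^ 'n. u (norm x)) u"
    using ac by (simp add: radial_profile_def)
  then show ?thesis
    unfolding weak_radial_solution_def using wd U1 U2 E W by blast
qed

theorem lemma1p6:
  fixes g :: "real \<Rightarrow> real" and k :: nat
  assumes "1 \<le> k" and "k \<le> CARD('n::finite)"
    and "\<And>t. g t > 0"
    and "g C1_differentiable_on UNIV"
  shows "(\<forall>U :: real ^ 'n \<Rightarrow> real. weak_radial_solution k g U \<longrightarrow>
            (\<exists>u. (AE x\<in>ball 0 1 in lebesgue. U x = u (norm x)) \<and>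
                 integral_radial_solution CARD('n) k g u)) \<and>
         (\<forall>u. integral_radial_solution CARD('n) k g u \<longrightarrow>
            weak_radial_solution k g (\<lambda>x :: real ^ 'n. u (norm x)))"
proof -
  have g: "continuous_on UNIV g"
    using C1_differentiable_imp_continuous_on[OF assms(4)] .
  show ?thesis
    using weak_imp_integral_radial_solution[OF assms(1,2) g]
      integral_imp_weak_radial_solution[OF assms(1,2) g] by blast
qed

end
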